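(* Let $C$ be a formal multicurve over an affine scheme $S$. Then every weak divisor on $C$ is a divisor on $C$.
   Context: All rings are commutative with unit. $S=\operatorname{spec}(k)$, $\mathcal{O}_S=k$. A formal ring is a complete Hausdorff linearly topologised ring $R$; $\operatorname{spf}(R)=\operatorname{colim}_J\operatorname{spec}(R/J)$ ($J$ running over open ideals), and $\mathcal{O}_X=R$ for $X=\operatorname{spf}(R)$. A closed subscheme $\operatorname{spf}(R/J)$ of $\operatorname{spf}(R)$ is a regular hypersurface if $J$ is generated by a single regular element. A formal multicurve over $S$ is a formal scheme $C=\operatorname{spf}(R)$ over $S$ such that (i) there is a regular element $y\in R$ such that for all $m\geq 0$ the ideal $Ry^m$ is open, $R/y^m$ is a finitely generated free $k$-module, and $R=\varprojlim_m R/y^m$; (ii) the diagonal in $C\times_SC$ is a regular hypersurface (where $C\times_SC=\operatorname{spf}(R\widehat{\otimes}_kR)$). A weak divisor on $C$ is a closed subscheme $D=\operatorname{spf}(R/J)\subset C$ such that $\mathcal{O}_D=R/J$ is a discrete (i.e. $J$ is open) finitely generated projective module over $\mathcal{O}_S$. A divisor on $C$ is a closed subscheme $D=\operatorname{spec}(R/J)$ where $J$ is an open ideal generated by a single regular element and $R/J$ is a finitely generated projective $\mathcal{O}_S$-module. *)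

theory Defs
  imports
    "HOL-Analysis.T1_Spaces"
    "HOL-Algebra.Free_Abelian_Groups"
    "HOL-Algebra.QuotRing"
    "HOL-Algebra.Module"
begin

section \<open>Finitely generated, free and projective modules\<close>

definition module_hom ::
    "('a, 'm) ring_scheme \<Rightarrow> ('a, 'b, 'n) module_scheme \<Rightarrow> ('a, 'c, 'o) module_scheme \<Rightarrow> ('b \<Rightarrow> 'c) set"
  where "module_hom K M N =
    {h. h \<in> carrier M \<rightarrow> carrier N \<and>
        (\<forall>x\<in>carrier M. \<forall>y\<in>carrier M. h (x \<oplus>\<^bsub>M\<^esub> y) = h x \<oplus>\<^bsub>N\<^esub> h y) \<and>
        (\<forall>a\<in>carrier K. \<forall>x\<in>carrier M. h (a \<odot>\<^bsub>M\<^esub> x) = a \<odot>\<^bsub>N\<^esub> h x)}"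

text \<open>
  The direct sum of copies of \<open>K\<close> indexed by \<open>I\<close>.  It is only ever used as a module, so the
  multiplicative fields of the record are left unspecified.
\<close>

definition free_module :: "('a, 'm) ring_scheme \<Rightarrow> 'i set \<Rightarrow> ('a, 'i \<Rightarrow> 'a) module"
  where "free_module K I =
    \<lparr>carrier = {f \<in> I \<rightarrow>\<^sub>E carrier K. finite {i \<in> I. f i \<noteq> \<zero>\<^bsub>K\<^esub>}},
     mult = undefined, one = undefined,
     zero = (\<lambda>i\<in>I. \<zero>\<^bsub>K\<^esub>),
     add = (\<lambda>f g. \<lambda>i\<in>I. f i \<oplus>\<^bsub>K\<^esub> g i),
     smult = (\<lambda>a f. \<lambda>i\<in>I. a \<otimes>\<^bsub>K\<^esub> f i)\<rparr>"

definition fg_module :: "('a, 'm) ring_scheme \<Rightarrow> ('a, 'b, 'n) module_scheme \<Rightarrow> bool"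
  where "fg_module K M \<longleftrightarrow>
    module K M \<and>
    (\<exists>n h. h \<in> module_hom K (free_module K {..<n::nat}) M \<and>
           h ` carrier (free_module K {..<n}) = carrier M)"

definition fg_free_module :: "('a, 'm) ring_scheme \<Rightarrow> ('a, 'b, 'n) module_scheme \<Rightarrow> bool"
  where "fg_free_module K M \<longleftrightarrow>
    module K M \<and>
    (\<exists>n h. h \<in> module_hom K (free_module K {..<n::nat}) M \<and>
           bij_betw h (carrier (free_module K {..<n})) (carrier M))"

text \<open>
  Projective means: a direct summand (retract) of a free module.  Taking the index set inside the
  type of elements of \<open>M\<close> is no restriction, since a projective module is in particular a retract
  of the free module on its own underlying set.
\<close>

definition projective_module :: "('a, 'm) ring_scheme \<Rightarrow> ('a, 'b, 'n) module_scheme \<Rightarrow> bool"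
  where "projective_module K M \<longleftrightarrow>
    module K M \<and>
    (\<exists>(I :: 'b set) i p.
        i \<in> module_hom K M (free_module K I) \<and>
        p \<in> module_hom K (free_module K I) M \<and>
        (\<forall>x\<in>carrier M. p (i x) = x))"

text \<open>The quotient ring \<open>A/J\<close> of a \<open>K\<close>-algebra with its induced scalar multiplication.\<close>

definition quot_algebra :: "('a, 'b, 'n) module_scheme \<Rightarrow> 'b set \<Rightarrow> ('a, 'b set) module"
  where "quot_algebra A J =
    \<lparr>carrier = carrier (A Quot J),
     mult = mult (A Quot J), one = one (A Quot J),
     zero = zero (A Quot J), add = add (A Quot J),
     smult = (\<lambda>a X. \<Union>x\<in>X. J +>\<^bsub>A\<^esub> (a \<odot>\<^bsub>A\<^esub> x))\<rparr>"


section \<open>Regular elements\<close>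

definition regular_element :: "('b, 'm) ring_scheme \<Rightarrow> 'b \<Rightarrow> bool"
  where "regular_element R d \<longleftrightarrow>
    d \<in> carrier R \<and> (\<forall>x\<in>carrier R. d \<otimes>\<^bsub>R\<^esub> x = \<zero>\<^bsub>R\<^esub> \<longrightarrow> x = \<zero>\<^bsub>R\<^esub>)"

definition generated_by_regular :: "('b, 'm) ring_scheme \<Rightarrow> 'b set \<Rightarrow> bool"
  where "generated_by_regular R J \<longleftrightarrow> (\<exists>d. regular_element R d \<and> J = PIdl\<^bsub>R\<^esub> d)"


section \<open>Inverse limits of quotient rings\<close>

text \<open>
  For a family \<open>\<A>\<close> of ideals of \<open>R\<close>, the limit of the rings \<open>R/J\<close> for \<open>J \<in> \<A>\<close>, ordered by
  inclusion.  The elements of \<open>R/J\<close> are cosets, and for \<open>J \<subseteq> J'\<close> the transition map \<open>R/J \<rightarrow> R/J'\<close>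
  sends a coset of \<open>J\<close> to the unique coset of \<open>J'\<close> containing it.
\<close>

definition limit_ring :: "('b, 'm) ring_scheme \<Rightarrow> 'b set set \<Rightarrow> ('b set \<Rightarrow> 'b set) ring"
  where "limit_ring R \<A> =
    \<lparr>carrier = {c \<in> (\<Pi>\<^sub>E J\<in>\<A>. carrier (R Quot J)). \<forall>J\<in>\<A>. \<forall>J'\<in>\<A>. J \<subseteq> J' \<longrightarrow> c J \<subseteq> c J'},
     mult = (\<lambda>c d. \<lambda>J\<in>\<A>. c J \<otimes>\<^bsub>R Quot J\<^esub> d J),
     one = (\<lambda>J\<in>\<A>. \<one>\<^bsub>R Quot J\<^esub>),
     zero = (\<lambda>J\<in>\<A>. \<zero>\<^bsub>R Quot J\<^esub>),
     add = (\<lambda>c d. \<lambda>J\<in>\<A>. c J \<oplus>\<^bsub>R Quot J\<^esub> d J)\<rparr>"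

text \<open>The limit topology, every \<open>R/J\<close> being discrete.\<close>

definition limit_topology :: "('b, 'm) ring_scheme \<Rightarrow> 'b set set \<Rightarrow> ('b set \<Rightarrow> 'b set) topology"
  where "limit_topology R \<A> =
    subtopology (product_topology (\<lambda>J. discrete_topology (carrier (R Quot J))) \<A>)
      (carrier (limit_ring R \<A>))"

definition limit_map :: "('b, 'm) ring_scheme \<Rightarrow> 'b set set \<Rightarrow> 'b \<Rightarrow> 'b set \<Rightarrow> 'b set"
  where "limit_map R \<A> x = (\<lambda>J\<in>\<A>. J +>\<^bsub>R\<^esub> x)"


section \<open>Formal rings\<close>

definition open_ideals :: "('b, 'm) ring_scheme \<Rightarrow> 'b topology \<Rightarrow> 'b set set"
  where "open_ideals R T = {J. ideal J R \<and> openin T J}"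

definition linearly_topologised_ring :: "('b, 'm) ring_scheme \<Rightarrow> 'b topology \<Rightarrow> bool"
  where "linearly_topologised_ring R T \<longleftrightarrow>
    cring R \<and> topspace T = carrier R \<and>
    continuous_map (prod_topology T T) T (\<lambda>(x, y). x \<oplus>\<^bsub>R\<^esub> y) \<and>
    continuous_map T T (\<lambda>x. \<ominus>\<^bsub>R\<^esub> x) \<and>
    continuous_map (prod_topology T T) T (\<lambda>(x, y). x \<otimes>\<^bsub>R\<^esub> y) \<and>
    (\<forall>U. openin T U \<and> \<zero>\<^bsub>R\<^esub> \<in> U \<longrightarrow> (\<exists>J\<in>open_ideals R T. J \<subseteq> U))"

text \<open>
  A linearly topologised ring is complete if it maps onto the inverse limit of its quotients by open ideals.
\<close>

definition formal_ring :: "('b, 'm) ring_scheme \<Rightarrow> 'b topology \<Rightarrow> bool"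
  where "formal_ring R T \<longleftrightarrow>
    linearly_topologised_ring R T \<and> Hausdorff_space T \<and>
    limit_map R (open_ideals R T) ` carrier R = carrier (limit_ring R (open_ideals R T))"


section \<open>Tensor products of algebras\<close>

text \<open>
  The integral monoid ring on the multiplicative monoid \<open>A \<times> B\<close>, whose additive group is the free
  abelian group on the pairs \<open>(a, b)\<close>.
\<close>

definition pairs_ring ::
    "('b, 'm) ring_scheme \<Rightarrow> ('c, 'n) ring_scheme \<Rightarrow> ('b \<times> 'c \<Rightarrow>\<^sub>0 int) ring"
  where "pairs_ring A B =
    \<lparr>carrier = carrier (free_Abelian_group (carrier A \<times> carrier B)),
     mult = (\<lambda>f g. frag_extend (\<lambda>(a, b). frag_extend (\<lambda>(a', b').
               frag_of (a \<otimes>\<^bsub>A\<^esub> a', b \<otimes>\<^bsub>B\<^esub> b')) g) f),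
     one = frag_of (\<one>\<^bsub>A\<^esub>, \<one>\<^bsub>B\<^esub>),
     zero = 0, add = (+)\<rparr>"

definition tensor_relations ::
    "('a, 'k) ring_scheme \<Rightarrow> ('a, 'b, 'm) module_scheme \<Rightarrow> ('a, 'c, 'n) module_scheme
      \<Rightarrow> ('b \<times> 'c \<Rightarrow>\<^sub>0 int) set"
  where "tensor_relations K A B =
    {frag_of (a \<oplus>\<^bsub>A\<^esub> a', b) - frag_of (a, b) - frag_of (a', b) | a a' b.
       a \<in> carrier A \<and> a' \<in> carrier A \<and> b \<in> carrier B} \<union>
    {frag_of (a, b \<oplus>\<^bsub>B\<^esub> b') - frag_of (a, b) - frag_of (a, b') | a b b'.
       a \<in> carrier A \<and> b \<in> carrier B \<and> b' \<in> carrier B} \<union>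
    {frag_of (r \<odot>\<^bsub>A\<^esub> a, b) - frag_of (a, r \<odot>\<^bsub>B\<^esub> b) | r a b.
       r \<in> carrier K \<and> a \<in> carrier A \<and> b \<in> carrier B}"

text \<open>
  The subgroup generated by \<open>tensor_relations K A B\<close> is stable under multiplication by pairs, hence
  equal to the ideal generated by it; so the additive group below is the usual
  \<open>A \<otimes>\<^sub>K B\<close>.
\<close>

definition tensor_ideal ::
    "('a, 'k) ring_scheme \<Rightarrow> ('a, 'b, 'm) module_scheme \<Rightarrow> ('a, 'c, 'n) module_scheme
      \<Rightarrow> ('b \<times> 'c \<Rightarrow>\<^sub>0 int) set"
  where "tensor_ideal K A B = Idl\<^bsub>pairs_ring A B\<^esub> (tensor_relations K A B)"

definition tensor_ring ::
    "('a, 'k) ring_scheme \<Rightarrow> ('a, 'b, 'm) module_scheme \<Rightarrow> ('a, 'c, 'n) module_scheme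
      \<Rightarrow> ('b \<times> 'c \<Rightarrow>\<^sub>0 int) set ring"
  where "tensor_ring K A B = pairs_ring A B Quot tensor_ideal K A B"

definition pure_tensor ::
    "('a, 'k) ring_scheme \<Rightarrow> ('a, 'b, 'm) module_scheme \<Rightarrow> ('a, 'c, 'n) module_scheme
      \<Rightarrow> 'b \<Rightarrow> 'c \<Rightarrow> ('b \<times> 'c \<Rightarrow>\<^sub>0 int) set"
  where "pure_tensor K A B a b = tensor_ideal K A B +>\<^bsub>pairs_ring A B\<^esub> frag_of (a, b)"

text \<open>
  The multiplication map \<open>A \<otimes>\<^sub>K A \<rightarrow> A\<close>, given on representatives by
  \<open>\<Sum> n\<^sub>i (a\<^sub>i, b\<^sub>i) \<mapsto> \<Sum> n\<^sub>i a\<^sub>i b\<^sub>i\<close>.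
\<close>

definition pairs_mult :: "('b, 'm) ring_scheme \<Rightarrow> ('b \<times> 'b \<Rightarrow>\<^sub>0 int) \<Rightarrow> 'b"
  where "pairs_mult A f =
    (\<Oplus>\<^bsub>A\<^esub>p\<in>Poly_Mapping.keys f. [Poly_Mapping.lookup f p] \<cdot>\<^bsub>A\<^esub> (fst p \<otimes>\<^bsub>A\<^esub> snd p))"

definition tensor_mult :: "('b, 'm) ring_scheme \<Rightarrow> ('b \<times> 'b \<Rightarrow>\<^sub>0 int) set \<Rightarrow> 'b"
  where "tensor_mult A t = the_elem (pairs_mult A ` t)"


section \<open>Completed tensor products and the diagonal\<close>

text \<open>The ideal \<open>I \<otimes> B + A \<otimes> J\<close>, i.e. the kernel of \<open>A \<otimes>\<^sub>K B \<rightarrow> A/I \<otimes>\<^sub>K B/J\<close>.\<close>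

definition tensor_nbhd ::
    "('a, 'k) ring_scheme \<Rightarrow> ('a, 'b, 'm) module_scheme \<Rightarrow> ('a, 'c, 'n) module_scheme
      \<Rightarrow> 'b set \<Rightarrow> 'c set \<Rightarrow> ('b \<times> 'c \<Rightarrow>\<^sub>0 int) set set"
  where "tensor_nbhd K A B I J = Idl\<^bsub>tensor_ring K A B\<^esub>
    ({pure_tensor K A B a b | a b. a \<in> I \<and> b \<in> carrier B} \<union>
     {pure_tensor K A B a b | a b. a \<in> carrier A \<and> b \<in> J})"

definition completed_tensor_ring ::
    "('a, 'k) ring_scheme \<Rightarrow> ('a, 'b, 'm) module_scheme \<Rightarrow> 'b topology
      \<Rightarrow> ('a, 'c, 'n) module_scheme \<Rightarrow> 'c topology
      \<Rightarrow> (('b \<times> 'c \<Rightarrow>\<^sub>0 int) set set \<Rightarrow> ('b \<times> 'c \<Rightarrow>\<^sub>0 int) set set) ring"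
  where "completed_tensor_ring K A S B T = limit_ring (tensor_ring K A B)
    {tensor_nbhd K A B I J | I J. I \<in> open_ideals A S \<and> J \<in> open_ideals B T}"

text \<open>
  The continuous extension of the multiplication map to the completed tensor product
  \<open>A \<otimes> A \<rightarrow> A\<close>: the image of \<open>c\<close> is the element whose class modulo every open ideal \<open>J\<close> is the
  image of the component of \<open>c\<close> in \<open>A/J \<otimes>\<^sub>K A/J\<close>.
\<close>

definition diagonal_map ::
    "('a, 'k) ring_scheme \<Rightarrow> ('a, 'b, 'm) module_scheme \<Rightarrow> 'b topology
      \<Rightarrow> (('b \<times> 'b \<Rightarrow>\<^sub>0 int) set set \<Rightarrow> ('b \<times> 'b \<Rightarrow>\<^sub>0 int) set set) \<Rightarrow> 'b"
  where "diagonal_map K A T c =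
    (THE r. r \<in> carrier A \<and>
       (\<forall>J\<in>open_ideals A T. \<forall>t\<in>c (tensor_nbhd K A A J J). tensor_mult A t \<in> J +>\<^bsub>A\<^esub> r))"

definition diagonal_ideal ::
    "('a, 'k) ring_scheme \<Rightarrow> ('a, 'b, 'm) module_scheme \<Rightarrow> 'b topology
      \<Rightarrow> (('b \<times> 'b \<Rightarrow>\<^sub>0 int) set set \<Rightarrow> ('b \<times> 'b \<Rightarrow>\<^sub>0 int) set set) set"
  where "diagonal_ideal K A T =
    a_kernel (completed_tensor_ring K A T A T) A (diagonal_map K A T)"


section \<open>Formal multicurves and divisors\<close>

text \<open>
  \<open>C = spf(R)\<close> over \<open>S = spec(K)\<close>.  The equality of \<open>R\<close> with the limit of the \<open>R/y\<^sup>m\<close> is one of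
  topological rings, so that the powers of \<open>y\<close> define the topology of \<open>R\<close>.
\<close>

definition formal_multicurve ::
    "('a, 'k) ring_scheme \<Rightarrow> ('a, 'b, 'm) module_scheme \<Rightarrow> 'b topology \<Rightarrow> bool"
  where "formal_multicurve K R T \<longleftrightarrow>
    algebra K R \<and> formal_ring R T \<and>
    (\<exists>y. regular_element R y \<and>
       (\<forall>m::nat. openin T (PIdl\<^bsub>R\<^esub> (y [^]\<^bsub>R\<^esub> m)) \<and>
                 fg_free_module K (quot_algebra R (PIdl\<^bsub>R\<^esub> (y [^]\<^bsub>R\<^esub> m)))) \<and>
       homeomorphic_map T (limit_topology R {PIdl\<^bsub>R\<^esub> (y [^]\<^bsub>R\<^esub> m) | m::nat. True})
         (limit_map R {PIdl\<^bsub>R\<^esub> (y [^]\<^bsub>R\<^esub> m) | m::nat. True})) \<and>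
    generated_by_regular (completed_tensor_ring K R T R T) (diagonal_ideal K R T)"

text \<open>Closed subschemes \<open>spf(R/J)\<close> of \<open>spf(R)\<close> are represented by their ideals \<open>J\<close>.\<close>

definition weak_divisor ::
    "('a, 'k) ring_scheme \<Rightarrow> ('a, 'b, 'm) module_scheme \<Rightarrow> 'b topology \<Rightarrow> 'b set \<Rightarrow> bool"
  where "weak_divisor K R T J \<longleftrightarrow>
    J \<in> open_ideals R T \<and>
    fg_module K (quot_algebra R J) \<and> projective_module K (quot_algebra R J)"

definition divisor ::
    "('a, 'k) ring_scheme \<Rightarrow> ('a, 'b, 'm) module_scheme \<Rightarrow> 'b topology \<Rightarrow> 'b set \<Rightarrow> bool"
  where "divisor K R T J \<longleftrightarrow>
    J \<in> open_ideals R T \<and> generated_by_regular R J \<and>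
    fg_module K (quot_algebra R J) \<and> projective_module K (quot_algebra R J)"

end

(* J is the zeroth Fitting ideal of the R-module R/J.  Base change of the diagonal along spf(R/J) -> C
   presents R/J as the cokernel of multiplication by a generator d of the diagonal ideal on the finitely
   generated projective R-module R (x) R/J.  After adding a complement this is a square matrix over R,
   so J is generated by its determinant f.  As J is open it contains a power of the regular element y,
   and f divides that power, so f is regular.

   Only the image of d modulo I = (y^(m+1)) is needed, where y^m lies in J.  Working modulo I gives
   y^m in (f) + (y^(m+1)), and since 1 - y h is a unit by completeness, y^m lies in (f); hence J = (f). *)

theory Submission
  imports Defs "HOL-Library.Multiset" "Jordan_Normal_Form.Determinant"
begin


section \<open>Cyclic cokernels and determinants\<close>


text \<open>The cokernel is R/J because dividing R \<otimes> R/J by all 1 \<otimes> a - a \<otimes>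
  1 identifies the two actions of R, and d both generates these elements and multiplies out to zero.
  The complement comes from a dual basis: functionals \<psi>_s on R vanishing on J and elements a_s
  of R give the idempotent P with entries \<psi>_s(a_t), and 1 - P is what is added to the matrix of
  d.

  The obstacle is that d lives in a limit. Only its components at open ideals can be handled, and a
  component fixes an element of R \<otimes> R only up to the kernel of R \<otimes> R -> R/I
  \<otimes> R/I. So the matrix identities become congruences modulo I, and I is taken inside J so
  that the functionals \<psi>_s are defined on R/I. The module R \<otimes> R/J is never formed: its
  elements are represented by integral combinations of pairs and seen only through their
  coordinates, those of a \<otimes> b being a \<psi>_s(b).\<close>

lemma det_one_minus_rank_one:
  fixes u v :: "nat \<Rightarrow> 'a::comm_ring_1"
  shows "det (mat n n (\<lambda>(i,j). (if i = j then 1 else 0) - u i * v j)) = 1 - (\<Sum>i<n. v i * u i)"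
proof -
  define M where "M = mat n n (\<lambda>(i,j). (if i = j then 1 else 0) - u i * v j)"
  define U where "U = mat n 1 (\<lambda>(i,j). u i)"
  define V where "V = mat 1 n (\<lambda>(i,j). v j)"
  define c where "c = mat 1 1 (\<lambda>(i,j). 1 - (\<Sum>i<n. v i * u i))"
  let ?E = "four_block_mat (1\<^sub>m n) (0\<^sub>m n 1) V (1\<^sub>m 1)"
  let ?X = "four_block_mat M U (0\<^sub>m 1 n) (1\<^sub>m 1)"
  let ?Y = "four_block_mat (1\<^sub>m n) U (0\<^sub>m 1 n) c"
  have cM: "M \<in> carrier_mat n n" and cU: "U \<in> carrier_mat n 1" and cV: "V \<in> carrier_mat 1 n"
    and cc: "c \<in> carrier_mat 1 1"
    by (auto simp: M_def U_def V_def c_def)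
  have cE: "?E \<in> carrier_mat (n+1) (n+1)" and cX: "?X \<in> carrier_mat (n+1) (n+1)"
    and cY: "?Y \<in> carrier_mat (n+1) (n+1)"
    using cM cU cV cc by auto
  have a: "M * 1\<^sub>m n + U * V = 1\<^sub>m n"
    by (rule eq_matI) (auto simp: M_def U_def V_def scalar_prod_def)
  have b: "V * U + 1\<^sub>m 1 * c = 1\<^sub>m 1"
    by (rule eq_matI) (auto simp: c_def U_def V_def scalar_prod_def lessThan_atLeast0)
  \<comment> \<open>The block matrix with rows (1, U) and (V, 1) is factored in two ways, through
    the Schur complement of either diagonal block: these are \<open>M\<close> = 1 - UV and
    \<open>c\<close> = 1 - VU, so their determinants agree.\<close>
  have "?X * ?E = four_block_mat (1\<^sub>m n) U V (1\<^sub>m 1)"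
    by (subst mult_four_block_mat[of _ n n _ 1 _ 1 _ _ n _ 1]) (use cM cU cV a in auto)
  moreover have "?E * ?Y = four_block_mat (1\<^sub>m n) U V (1\<^sub>m 1)"
    by (subst mult_four_block_mat[of _ n n _ 1 _ 1 _ _ n _ 1]) (use cc cU cV b in auto)
  ultimately have eq: "det ?X * det ?E = det ?E * det ?Y"
    using det_mult[OF cX cE] det_mult[OF cE cY] by simp
  have "det ?E = 1"
    by (subst det_four_block_mat_upper_right_zero_col[of _ n]) (use cV in auto)
  moreover have "det ?X = det M"
  proof -
    have "det ?X = det (transpose_mat ?X)"
      by (rule det_transpose[OF cX, symmetric])
    also have "transpose_mat ?X =
        four_block_mat (transpose_mat M) (0\<^sub>m n 1) (transpose_mat U) (1\<^sub>m 1)"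
      by (subst transpose_four_block_mat[OF cM cU]) auto
    also have "det \<dots> = det M"
      by (subst det_four_block_mat_upper_right_zero_col[of _ n])
        (use cM cU det_transpose[OF cM] in auto)
    finally show ?thesis .
  qed
  moreover have "det ?Y = 1 - (\<Sum>i<n. v i * u i)"
  proof -
    have "det ?Y = det (transpose_mat ?Y)"
      by (rule det_transpose[OF cY, symmetric])
    also have "transpose_mat ?Y =
        four_block_mat (1\<^sub>m n) (0\<^sub>m n 1) (transpose_mat U) (transpose_mat c)"
      by (subst transpose_four_block_mat[of _ n n _ 1 _ 1]) (use cU cc in auto)
    also have "det \<dots> = det c"
      by (subst det_four_block_mat_upper_right_zero_col[of _ n])
        (use cc cU det_transpose[OF cc] in auto)
    also have "\<dots> = 1 - (\<Sum>i<n. v i * u i)"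
      using det_single[OF cc] by (simp add: c_def)
    finally show ?thesis .
  qed
  ultimately show ?thesis
    using eq by (simp add: M_def)
qed

section \<open>Congruences modulo an ideal in a type-class ring\<close>

locale comm_ring_ideal =
  fixes I :: "'a::comm_ring_1 set"
  assumes zero_mem: "0 \<in> I"
    and add_mem: "x \<in> I \<Longrightarrow> y \<in> I \<Longrightarrow> x + y \<in> I"
    and mult_mem: "x \<in> I \<Longrightarrow> r * x \<in> I"
begin

lemma mult_mem': "x \<in> I \<Longrightarrow> x * r \<in> I"
  using mult_mem[of x r] by (simp add: mult.commute)

lemma uminus_mem: "x \<in> I \<Longrightarrow> - x \<in> I"
  using mult_mem[of x "-1"] by simp

lemma diff_mem: "x \<in> I \<Longrightarrow> y \<in> I \<Longrightarrow> x - y \<in> I"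
  using add_mem[of x "- y"] uminus_mem by simp

lemma sum_mem: "(\<And>i. i \<in> A \<Longrightarrow> f i \<in> I) \<Longrightarrow> sum f A \<in> I"
  by (induction A rule: infinite_finite_induct) (auto intro: zero_mem add_mem)

lemma prod_cong_mem:
  "(\<And>i. i \<in> A \<Longrightarrow> f i - g i \<in> I) \<Longrightarrow> prod f A - prod g A \<in> I"
proof (induction A rule: infinite_finite_induct)
  case (insert x A)
  have "prod f (insert x A) - prod g (insert x A) = f x * (prod f A - prod g A) + (f x - g x) * prod g A"
    using insert by (simp add: algebra_simps)
  then show ?case
    using insert by (simp add: add_mem mult_mem mult_mem')
qed (auto intro: zero_mem)

text \<open>By the Leibniz formula the determinant is an integral polynomial in the entries, and
  such polynomials respect congruences.\<close>

lemma det_cong_mem: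
  assumes "M \<in> carrier_mat n n" "N \<in> carrier_mat n n"
    and "\<And>i j. i < n \<Longrightarrow> j < n \<Longrightarrow> M $$ (i,j) - N $$ (i,j) \<in> I"
  shows "det M - det N \<in> I"
  unfolding det_def'[OF assms(1)] det_def'[OF assms(2)] sum_subtractf[symmetric]
    right_diff_distrib[symmetric]
  by (intro sum_mem mult_mem prod_cong_mem assms) (auto simp: permutes_in_image)

end

text \<open>
  If \<open>P\<close> is an idempotent matrix, \<open>L\<close> is an endomorphism of its image \<open>Q\<close>, and \<open>\<phi>\<close> and \<open>e\<close> induce
  an isomorphism of the cokernel of \<open>L\<close> with \<open>A/J\<close>, then \<open>J\<close> is the zeroth Fitting ideal of the
  cokernel of the square matrix \<open>L + (1 - P)\<close>, hence generated by its determinant.  All of this holds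
  modulo the ideal \<open>I\<close>.  The generation is seen directly: \<open>(L + 1 - P) B = 1 - (1 - j) e \<phi>\<close> is
  solvable in \<open>B\<close> for each \<open>j \<in> J\<close>, and the right-hand side has determinant
  \<open>j + (1 - j) (1 - \<phi> e)\<close>.
\<close>

lemma cyclic_cokernel_ideal_principal:
  fixes I J :: "'a::comm_ring_1 set" and L P :: "nat \<Rightarrow> nat \<Rightarrow> 'a" and \<phi> e :: "nat \<Rightarrow> 'a"
  assumes I: "comm_ring_ideal I" and J: "comm_ring_ideal J"
    and LP: "\<And>s t. s < n \<Longrightarrow> t < n \<Longrightarrow> (\<Sum>k<n. L s k * P k t) - L s t \<in> I"
    and PP: "\<And>s t. s < n \<Longrightarrow> t < n \<Longrightarrow> (\<Sum>k<n. P s k * P k t) - P s t \<in> I"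
    and surj: "\<And>t. t < n \<Longrightarrow> \<exists>w. (\<forall>s<n. (\<Sum>k<n. P s k * w k) - w s \<in> I) \<and>
                 (\<forall>s<n. (\<Sum>k<n. L s k * w k) - (P s t - e s * \<phi> t) \<in> I)"
    and ker: "\<And>j. j \<in> J \<Longrightarrow> \<exists>w. (\<forall>s<n. (\<Sum>k<n. P s k * w k) - w s \<in> I) \<and>
                 (\<forall>s<n. (\<Sum>k<n. L s k * w k) - j * e s \<in> I)"
    and \<phi>P: "\<And>t. t < n \<Longrightarrow> (\<Sum>s<n. \<phi> s * P s t) - \<phi> t \<in> J"
    and \<phi>L: "\<And>t. t < n \<Longrightarrow> (\<Sum>s<n. \<phi> s * L s t) \<in> J"
    and \<phi>e: "1 - (\<Sum>s<n. \<phi> s * e s) \<in> J"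
  shows "\<exists>f\<in>J. \<forall>j\<in>J. \<exists>g. j - f * g \<in> I"
proof -
  interpret I: comm_ring_ideal I by fact
  interpret J: comm_ring_ideal J by fact
  define \<delta> :: "nat \<Rightarrow> nat \<Rightarrow> 'a" where "\<delta> s t = (if s = t then 1 else 0)" for s t
  \<comment> \<open>\<open>A\<close> acts like \<open>L\<close> on the image of \<open>P\<close> and
    like the identity on the complement; modulo \<open>I\<close> this is \<open>Aw\<close> and
    \<open>AQ\<close> below.\<close>
  define A where "A s t = L s t + (\<delta> s t - P s t)" for s t
  define MA where "MA = mat n n (\<lambda>(s,t). A s t)"
  define c where "c = (\<Sum>s<n. \<phi> s * e s)"
  have MA: "MA \<in> carrier_mat n n" by (simp add: MA_def)
  have \<delta>_sum: "(\<Sum>k<n. \<delta> s k * x k) = x s" "(\<Sum>k<n. x k * \<delta> k s) = x s" if "s < n" for x s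
    using that by (simp_all add: \<delta>_def if_distrib[of "\<lambda>a. a * _"] if_distrib[of "\<lambda>a. _ * a"] cong: if_cong)
  have \<phi>A: "(\<Sum>s<n. \<phi> s * A s t) \<in> J" if "t < n" for t
  proof -
    have "(\<Sum>s<n. \<phi> s * A s t) = (\<Sum>s<n. \<phi> s * L s t) - ((\<Sum>s<n. \<phi> s * P s t) - \<phi> t)"
      using \<delta>_sum(2)[OF that, of \<phi>]
      by (simp add: A_def algebra_simps sum.distrib sum_subtractf)
    then show ?thesis
      using \<phi>L[OF that] \<phi>P[OF that] J.diff_mem by simp
  qed
  \<comment> \<open>The row \<phi> A has its entries in \<open>J\<close>; multiplying it by the
    adjugate puts each det \<phi>_t into \<open>J\<close>. Since the sum of the \<phi>_t e_t is 1
    modulo \<open>J\<close>, the determinant itself lies in \<open>J\<close>.\<close>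
  have detA_J: "det MA \<in> J"
  proof -
    have adj: "adj_mat MA \<in> carrier_mat n n" using adj_mat[OF MA] by simp
    have row: "det MA * \<phi> t \<in> J" if t: "t < n" for t
    proof -
      have ent: "(\<Sum>k<n. A s k * adj_mat MA $$ (k,t)) = det MA * \<delta> s t" if s: "s < n" for s
      proof -
        have "(MA * adj_mat MA) $$ (s,t) = (\<Sum>k<n. A s k * adj_mat MA $$ (k,t))"
          using s t adj by (simp add: MA_def scalar_prod_def lessThan_atLeast0)
        then show ?thesis
          using adj_mat(2)[OF MA] s t by (simp add: \<delta>_def)
      qed
      have "(\<Sum>k<n. (\<Sum>s<n. \<phi> s * A s k) * adj_mat MA $$ (k,t)) =
          (\<Sum>s<n. \<phi> s * (\<Sum>k<n. A s k * adj_mat MA $$ (k,t)))"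
        unfolding sum_distrib_left sum_distrib_right by (subst sum.swap) (simp add: mult.assoc)
      also have "\<dots> = (\<Sum>s<n. (det MA * \<phi> s) * \<delta> s t)"
        by (rule sum.cong) (simp_all add: ent algebra_simps)
      also have "\<dots> = det MA * \<phi> t" by (rule \<delta>_sum(2)[OF t])
      finally show ?thesis
        using J.sum_mem[of "{..<n}" "\<lambda>k. (\<Sum>s<n. \<phi> s * A s k) * adj_mat MA $$ (k,t)"]
          J.mult_mem' \<phi>A by simp
    qed
    have "(\<Sum>t<n. (det MA * \<phi> t) * e t) \<in> J"
      using row by (intro J.sum_mem J.mult_mem'[of "det MA * _"]) auto
    moreover have "det MA * (1 - c) \<in> J"
      using \<phi>e J.mult_mem by (simp add: c_def)
    ultimately have "(\<Sum>t<n. (det MA * \<phi> t) * e t) + det MA * (1 - c) \<in> J"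
      by (rule J.add_mem)
    then show ?thesis
      by (simp add: c_def algebra_simps sum_distrib_left)
  qed
  have Aw: "(\<Sum>k<n. A s k * w k) - (\<Sum>k<n. L s k * w k) \<in> I"
    if "s < n" "(\<Sum>k<n. P s k * w k) - w s \<in> I" for s w
  proof -
    have "(\<Sum>k<n. A s k * w k) - (\<Sum>k<n. L s k * w k) = - ((\<Sum>k<n. P s k * w k) - w s)"
      using \<delta>_sum(1)[OF that(1), of w]
      by (simp add: A_def algebra_simps sum.distrib sum_subtractf)
    then show ?thesis using I.uminus_mem[OF that(2)] by simp
  qed
  have AQ: "(\<Sum>k<n. A s k * (\<delta> k t - P k t)) - (\<delta> s t - P s t) \<in> I" if s: "s < n" and t: "t < n" for s t
  proof -
    have eq: "(\<Sum>k<n. A s k * (\<delta> k t - P k t)) - (\<delta> s t - P s t)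
        = ((\<Sum>k<n. P s k * P k t) - P s t) - ((\<Sum>k<n. L s k * P k t) - L s t)"
      using \<delta>_sum(1)[OF s, of "\<lambda>k. P k t"] \<delta>_sum(1)[OF s, of "\<lambda>k. \<delta> k t"]
        \<delta>_sum(2)[OF t, of "L s"] \<delta>_sum(2)[OF t, of "P s"]
      by (simp add: A_def algebra_simps sum.distrib sum_subtractf)
    show ?thesis unfolding eq by (rule I.diff_mem[OF PP[OF s t] LP[OF s t]])
  qed
  have solve: "\<exists>g. (1 - (1 - j) * c) - det MA * g \<in> I" if j: "j \<in> J" for j
  proof -
    obtain w where w: "\<forall>s<n. (\<Sum>k<n. P s k * w k) - w s \<in> I"
        "\<forall>s<n. (\<Sum>k<n. L s k * w k) - j * e s \<in> I"
      using ker[OF j] by blast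
    obtain v where v: "\<And>t. t < n \<Longrightarrow> \<forall>s<n. (\<Sum>k<n. P s k * v t k) - v t s \<in> I"
        "\<And>t. t < n \<Longrightarrow> \<forall>s<n. (\<Sum>k<n. L s k * v t k) - (P s t - e s * \<phi> t) \<in> I"
      using surj by metis
    \<comment> \<open>Modulo \<open>I\<close>, the matrix \<open>A\<close> sends the three summands
      to \<delta> - P, to P - e \<phi> and to j e \<phi>, with total 1 - (1 - j) e \<phi>.\<close>
    define B where "B k t = (\<delta> k t - P k t) + v t k + w k * \<phi> t" for k t
    define MB where "MB = mat n n (\<lambda>(s,t). B s t)"
    define MC where "MC = mat n n (\<lambda>(s,t). (if s = t then 1 else 0) - ((1 - j) * e s) * \<phi> t)"
    have MB: "MB \<in> carrier_mat n n" and MC: "MC \<in> carrier_mat n n" by (simp_all add: MB_def MC_def)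
    have "(MC $$ (s,t)) - (MA * MB) $$ (s,t) \<in> I" if s: "s < n" and t: "t < n" for s t
    proof -
      have "(MA * MB) $$ (s,t) = (\<Sum>k<n. A s k * B k t)"
        using s t by (simp add: MA_def MB_def scalar_prod_def lessThan_atLeast0)
      also have "\<dots> = (\<Sum>k<n. A s k * (\<delta> k t - P k t)) + (\<Sum>k<n. A s k * v t k)
          + (\<Sum>k<n. A s k * w k) * \<phi> t"
        by (simp add: B_def algebra_simps sum.distrib sum_subtractf sum_distrib_left)
      finally have eq: "(MA * MB) $$ (s,t) - MC $$ (s,t) =
          ((\<Sum>k<n. A s k * (\<delta> k t - P k t)) - (\<delta> s t - P s t))
          + (((\<Sum>k<n. A s k * v t k) - (\<Sum>k<n. L s k * v t k))
             + ((\<Sum>k<n. L s k * v t k) - (P s t - e s * \<phi> t)))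
          + (((\<Sum>k<n. A s k * w k) - (\<Sum>k<n. L s k * w k))
             + ((\<Sum>k<n. L s k * w k) - j * e s)) * \<phi> t"
        using s t by (simp add: MC_def \<delta>_def algebra_simps)
      have "(MA * MB) $$ (s,t) - MC $$ (s,t) \<in> I"
        unfolding eq by (intro I.add_mem I.mult_mem' AQ Aw s t) (use s t v w in auto)
      then show ?thesis using I.uminus_mem by fastforce
    qed
    then have "det MC - det (MA * MB) \<in> I"
      by (intro I.det_cong_mem[OF MC]) (use MA MB in auto)
    moreover have "det MC = 1 - (1 - j) * c"
      unfolding MC_def det_one_minus_rank_one c_def by (simp add: sum_distrib_left algebra_simps)
    moreover have "det (MA * MB) = det MA * det MB" by (rule det_mult[OF MA MB])
    ultimately show ?thesis by auto
  qed
  have "\<exists>g. j - det MA * g \<in> I" if j: "j \<in> J" for j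
  proof -
    \<comment> \<open>The case j = 0 makes 1 - c a multiple of the determinant. Subtracting 1 - j
      times it from the case of j leaves exactly j.\<close>
    obtain g0 where g0: "(1 - (1 - 0) * c) - det MA * g0 \<in> I" using solve[OF J.zero_mem] by blast
    obtain g1 where g1: "(1 - (1 - j) * c) - det MA * g1 \<in> I" using solve[OF j] by blast
    have "j - det MA * (g1 - (1 - j) * g0) =
        ((1 - (1 - j) * c) - det MA * g1) - (1 - j) * ((1 - (1 - 0) * c) - det MA * g0)"
      by (simp add: algebra_simps)
    then show ?thesis using I.diff_mem[OF g1 I.mult_mem[OF g0]] by metis
  qed
  then show ?thesis using detA_J by blast
qed


section \<open>Evaluating integral polynomials in a ring\<close>


text \<open>The homomorphism out of the free abelian group that extends \<open>g\<close>. It is used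
  twice: to evaluate polynomials, and to define maps on integral combinations of pairs.\<close>

definition frag_lift :: "('b, 'm) ring_scheme \<Rightarrow> ('i \<Rightarrow> 'b) \<Rightarrow> ('i \<Rightarrow>\<^sub>0 int) \<Rightarrow> 'b"
  where "frag_lift G g f =
    (\<Oplus>\<^bsub>G\<^esub>p\<in>Poly_Mapping.keys f. [Poly_Mapping.lookup f p] \<cdot>\<^bsub>G\<^esub> g p)"

context abelian_group
begin

text \<open>Additional indices carry the coefficient zero. Over a common index set, additivity in
  the argument reduces to that of finite sums.\<close>

lemma frag_lift_superset:
  assumes "finite U" "Poly_Mapping.keys f \<subseteq> U" "g \<in> U \<rightarrow> carrier G"
  shows "frag_lift G g f = (\<Oplus>p\<in>U. [Poly_Mapping.lookup f p] \<cdot> g p)"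
proof -
  have "[(0::int)] \<cdot> x = \<zero>" for x by (simp add: add_pow_def)
  then show ?thesis
    unfolding frag_lift_def
    by (intro add.finprod_mono_neutral_cong_left)
      (use assms in \<open>auto simp: in_keys_iff\<close>)
qed

lemma frag_lift_closed:
  assumes "g \<in> Poly_Mapping.keys f \<rightarrow> carrier G"
  shows "frag_lift G g f \<in> carrier G"
  unfolding frag_lift_def by (rule finsum_closed) (use assms in auto)

lemma frag_lift_zero: "frag_lift G g 0 = \<zero>"
  by (simp add: frag_lift_def)

lemma frag_lift_of:
  assumes "g x \<in> carrier G"
  shows "frag_lift G g (frag_of x) = g x"
  using assms by (simp add: frag_lift_def add.int_pow_1)

lemma frag_lift_add:
  assumes "g \<in> Poly_Mapping.keys a \<union> Poly_Mapping.keys b \<rightarrow> carrier G"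
  shows "frag_lift G g (a + b) = frag_lift G g a \<oplus> frag_lift G g b"
proof -
  let ?U = "Poly_Mapping.keys a \<union> Poly_Mapping.keys b"
  have g: "\<And>p. p \<in> ?U \<Longrightarrow> g p \<in> carrier G" using assms by auto
  have "frag_lift G g (a + b) = (\<Oplus>p\<in>?U. [Poly_Mapping.lookup (a + b) p] \<cdot> g p)"
    by (rule frag_lift_superset) (use assms Poly_Mapping.keys_add[of a b] in auto)
  also have "\<dots> = (\<Oplus>p\<in>?U. [Poly_Mapping.lookup a p] \<cdot> g p \<oplus> [Poly_Mapping.lookup b p] \<cdot> g p)"
    by (rule finsum_cong') (auto simp: lookup_add add.int_pow_mult g)
  also have "\<dots> = (\<Oplus>p\<in>?U. [Poly_Mapping.lookup a p] \<cdot> g p) \<oplus> (\<Oplus>p\<in>?U. [Poly_Mapping.lookup b p] \<cdot> g p)"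
    by (rule finsum_addf) (use g in auto)
  also have "\<dots> = frag_lift G g a \<oplus> frag_lift G g b"
    using assms by (simp add: frag_lift_superset[of ?U])
  finally show ?thesis .
qed

lemma frag_lift_uminus:
  assumes "g \<in> Poly_Mapping.keys a \<rightarrow> carrier G"
  shows "frag_lift G g (- a) = \<ominus> frag_lift G g a"
proof -
  have "frag_lift G g (- a) \<oplus> frag_lift G g a = \<zero>"
    using frag_lift_add[of g "- a" a] assms by (simp add: frag_lift_zero)
  then show ?thesis
    using frag_lift_closed[of g a] frag_lift_closed[of g "- a"] assms
    by (simp add: minus_equality)
qed

lemma frag_lift_diff:
  assumes "g \<in> Poly_Mapping.keys a \<union> Poly_Mapping.keys b \<rightarrow> carrier G"
  shows "frag_lift G g (a - b) = frag_lift G g a \<ominus> frag_lift G g b"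
  using frag_lift_add[of g a "- b"] frag_lift_uminus[of g b] assms
  by (simp add: a_minus_def Pi_iff)

end

text \<open>
  The polynomial ring \<open>\<int>[X\<^sub>b]\<close> is the type \<open>'b multiset \<Rightarrow>\<^sub>0 int\<close> of class \<open>comm_ring_1\<close>.  Evaluating
  \<open>X\<^sub>b\<close> at \<open>b\<close> maps it onto any commutative ring with elements of type \<open>'b\<close>; this transfers facts about
  determinants from the type class to rings with carriers.
\<close>

definition mset_eval :: "('b, 'm) ring_scheme \<Rightarrow> 'b multiset \<Rightarrow> 'b"
  where "mset_eval R M =
    (\<Otimes>\<^bsub>R\<^esub>x\<in>set_mset M. if x \<in> carrier R then x [^]\<^bsub>R\<^esub> count M x else \<one>\<^bsub>R\<^esub>)"

definition poly_eval :: "('b, 'm) ring_scheme \<Rightarrow> ('b multiset \<Rightarrow>\<^sub>0 int) \<Rightarrow> 'b"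
  where "poly_eval R = frag_lift R (mset_eval R)"

definition poly_var :: "'b \<Rightarrow> ('b multiset \<Rightarrow>\<^sub>0 int)"
  where "poly_var b = frag_of {#b#}"

context cring
begin

text \<open>Indeterminates named by elements outside the carrier are sent to one. This makes
  evaluation a ring homomorphism on the whole type, free of side conditions.\<close>

lemma mset_eval_closed [simp]: "mset_eval R M \<in> carrier R"
  unfolding mset_eval_def by (rule finprod_closed) auto

lemma mset_eval_superset:
  assumes "finite U" "set_mset M \<subseteq> U"
  shows "mset_eval R M = (\<Otimes>x\<in>U. if x \<in> carrier R then x [^] count M x else \<one>)"
  unfolding mset_eval_def
  by (rule finprod_mono_neutral_cong_left) (use assms in \<open>auto simp: not_in_iff\<close>)

lemma mset_eval_add: "mset_eval R (M + N) = mset_eval R M \<otimes> mset_eval R N"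
proof -
  let ?U = "set_mset M \<union> set_mset N"
  have "mset_eval R (M + N) = (\<Otimes>x\<in>?U. if x \<in> carrier R then x [^] count (M + N) x else \<one>)"
    by (rule mset_eval_superset) auto
  also have "\<dots> = (\<Otimes>x\<in>?U. (if x \<in> carrier R then x [^] count M x else \<one>) \<otimes>
      (if x \<in> carrier R then x [^] count N x else \<one>))"
    by (rule finprod_cong') (auto simp: nat_pow_mult)
  also have "\<dots> = mset_eval R M \<otimes> mset_eval R N"
    by (subst finprod_multf) (auto simp: mset_eval_superset[of ?U])
  finally show ?thesis .
qed

lemma poly_eval_closed [simp]: "poly_eval R f \<in> carrier R"
  unfolding poly_eval_def by (rule frag_lift_closed) auto

lemma poly_eval_zero [simp]: "poly_eval R 0 = \<zero>"
  unfolding poly_eval_def by (rule frag_lift_zero)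

lemma poly_eval_add [simp]: "poly_eval R (f + g) = poly_eval R f \<oplus> poly_eval R g"
  unfolding poly_eval_def by (rule frag_lift_add) auto

lemma poly_eval_diff [simp]: "poly_eval R (f - g) = poly_eval R f \<ominus> poly_eval R g"
  unfolding poly_eval_def by (rule frag_lift_diff) auto

lemma poly_eval_of [simp]: "poly_eval R (frag_of M) = mset_eval R M"
  unfolding poly_eval_def by (rule frag_lift_of) auto

lemma poly_eval_one [simp]: "poly_eval R 1 = \<one>"
  unfolding single_one[symmetric] using poly_eval_of[of "0"] by (simp add: mset_eval_def)

lemma poly_eval_var [simp]: "x \<in> carrier R \<Longrightarrow> poly_eval R (poly_var x) = x"
  by (simp add: poly_var_def mset_eval_def)

text \<open>Both sides are additive in each factor, which leaves two monomials, where the multisets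
  of indeterminates add up.\<close>

lemma poly_eval_mult [simp]: "poly_eval R (f * g) = poly_eval R f \<otimes> poly_eval R g"
proof (rule frag_induction[of f UNIV])
  show "poly_eval R (frag_of M * g) = poly_eval R (frag_of M) \<otimes> poly_eval R g" for M
  proof (rule frag_induction[of g UNIV])
    show "poly_eval R (frag_of M * frag_of N) = poly_eval R (frag_of M) \<otimes> poly_eval R (frag_of N)" for N
    proof -
      have "frag_of M * frag_of N = frag_of (M + N)" by (simp add: mult_single)
      then show ?thesis by (metis poly_eval_of mset_eval_add)
    qed
  qed (auto simp: right_diff_distrib a_minus_def r_distr r_minus)
qed (auto simp: left_diff_distrib a_minus_def l_distr l_minus)

lemma poly_eval_sum: "poly_eval R (sum f A) = (\<Oplus>i\<in>A. poly_eval R (f i))"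
  by (induction A rule: infinite_finite_induct) (auto simp: finsum_insert finsum_infinite)

text \<open>The bridge between the two worlds: a congruence in \<open>R\<close> between values of
  polynomials is a congruence of the polynomials modulo this preimage.\<close>

lemma comm_ring_ideal_poly_eval:
  assumes "ideal I R"
  shows "comm_ring_ideal {f. poly_eval R f \<in> I}"
proof -
  interpret I: ideal I R by fact
  show ?thesis
    by unfold_locales (auto simp: I.I_l_closed I.a_closed)
qed

end


section \<open>Tensor products of algebras\<close>


lemma keys_frag_of_diff:
  "x \<in> S \<Longrightarrow> y \<in> S \<Longrightarrow> Poly_Mapping.keys (frag_of x - frag_of y) \<subseteq> S"
  "x \<in> S \<Longrightarrow> y \<in> S \<Longrightarrow> z \<in> S \<Longrightarrow> Poly_Mapping.keys (frag_of x - frag_of y - frag_of z) \<subseteq> S"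
  using keys_diff[of "frag_of x - frag_of y" "frag_of z"] keys_diff[of "frag_of x" "frag_of y"] by auto

lemma genideal_mono: "S \<subseteq> S' \<Longrightarrow> Idl\<^bsub>R\<^esub> S \<subseteq> Idl\<^bsub>R\<^esub> S'"
  unfolding genideal_def by blast

lemma (in ring_hom_ring) ideal_image:
  assumes "ideal I R" and surj: "h ` carrier R = carrier S"
  shows "ideal (h ` I) S"
proof -
  interpret I: ideal I R by fact
  show ?thesis
  proof (rule idealI)
    show "ring S" by (rule S.ring_axioms)
    show "subgroup (h ` I) (add_monoid S)"
    proof (rule S.add.subgroupI)
      show "h ` I \<subseteq> carrier S" using I.a_Hcarr by auto
      show "h ` I \<noteq> {}" using additive_subgroup.zero_closed[OF I.additive_subgroup_axioms] by blast
    next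
      fix x assume "x \<in> h ` I"
      then obtain a where a: "a \<in> I" "x = h a" by blast
      then have "\<ominus>\<^bsub>S\<^esub> x = h (\<ominus> a)" using I.a_Hcarr by simp
      then show "\<ominus>\<^bsub>S\<^esub> x \<in> h ` I" using I.a_inv_closed[OF a(1)] by (rule image_eqI)
    next
      fix x y assume "x \<in> h ` I" "y \<in> h ` I"
      then obtain a b where a: "a \<in> I" "b \<in> I" "x = h a" "y = h b" by blast
      then have "x \<oplus>\<^bsub>S\<^esub> y = h (a \<oplus> b)" using I.a_Hcarr by simp
      then show "x \<oplus>\<^bsub>S\<^esub> y \<in> h ` I"
        using additive_subgroup.a_closed[OF I.additive_subgroup_axioms a(1,2)] by (rule image_eqI)
    qed
  next
    fix x y assume xy: "x \<in> h ` I" "y \<in> carrier S"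
    obtain a where "a \<in> I" "x = h a" using xy(1) by blast
    moreover obtain b where "b \<in> carrier R" "y = h b" using xy(2) surj by blast
    ultimately show "y \<otimes>\<^bsub>S\<^esub> x \<in> h ` I" "x \<otimes>\<^bsub>S\<^esub> y \<in> h ` I"
      using imageI[OF I.I_l_closed[of a b], of h] imageI[OF I.I_r_closed[of a b], of h] I.a_Hcarr by simp_all
  qed
qed

section \<open>The ring of integral combinations of pairs\<close>

locale cring_pair = A: cring A + B: cring B
  for A :: "('b, 'm) ring_scheme" and B :: "('c, 'n) ring_scheme"
begin

abbreviation P :: "('b \<times> 'c \<Rightarrow>\<^sub>0 int) ring"
  where "P \<equiv> pairs_ring A B"

lemma pairs_simps [simp]:
  "f \<in> carrier P \<longleftrightarrow> Poly_Mapping.keys f \<subseteq> carrier A \<times> carrier B"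
  "f \<oplus>\<^bsub>P\<^esub> g = f + g" "\<zero>\<^bsub>P\<^esub> = 0" "\<one>\<^bsub>P\<^esub> = frag_of (\<one>\<^bsub>A\<^esub>, \<one>\<^bsub>B\<^esub>)"
  "frag_of (a, b) \<otimes>\<^bsub>P\<^esub> frag_of (a', b') = frag_of (a \<otimes>\<^bsub>A\<^esub> a', b \<otimes>\<^bsub>B\<^esub> b')"
  "0 \<otimes>\<^bsub>P\<^esub> g = 0"
  by (simp_all add: pairs_ring_def)

lemma pairs_times_diff_left: "(f - f') \<otimes>\<^bsub>P\<^esub> g = f \<otimes>\<^bsub>P\<^esub> g - f' \<otimes>\<^bsub>P\<^esub> g"
  by (simp add: pairs_ring_def frag_extend_diff)

lemma pairs_times_diff_right: "f \<otimes>\<^bsub>P\<^esub> (g - g') = f \<otimes>\<^bsub>P\<^esub> g - f \<otimes>\<^bsub>P\<^esub> g'"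
proof (rule frag_induction[of f UNIV])
  show "frag_of x \<otimes>\<^bsub>P\<^esub> (g - g') = frag_of x \<otimes>\<^bsub>P\<^esub> g - frag_of x \<otimes>\<^bsub>P\<^esub> g'" for x
    by (cases x) (simp add: pairs_ring_def frag_extend_diff)
qed (auto simp: pairs_times_diff_left)

lemma pairs_times_zero_right [simp]: "f \<otimes>\<^bsub>P\<^esub> 0 = 0"
  using pairs_times_diff_right[of f 0 0] by simp

text \<open>Pairs generate the additive group by differences alone, so an identity additive in
  \<open>f\<close> need only be checked on pairs. The carrier condition travels along because the
  laws of \<open>A\<close> and \<open>B\<close> hold only there.\<close>

lemma pairs_induct [consumes 1, case_names zero of diff]:
  assumes "f \<in> carrier P" "Q 0"
    and "\<And>a b. a \<in> carrier A \<Longrightarrow> b \<in> carrier B \<Longrightarrow> Q (frag_of (a, b))"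
    and "\<And>f g. f \<in> carrier P \<Longrightarrow> g \<in> carrier P \<Longrightarrow> Q f \<Longrightarrow> Q g \<Longrightarrow> Q (f - g)"
  shows "Q f"
proof -
  have "f \<in> carrier P \<and> Q f"
    using assms(1)[unfolded pairs_simps]
  proof (induction f rule: frag_induction)
    case (diff a b)
    then show ?case
      using assms(4)[of a b] keys_diff[of a b] by auto
  qed (use assms in auto)
  then show ?thesis ..
qed

lemma pairs_diff_closed: "f \<in> carrier P \<Longrightarrow> g \<in> carrier P \<Longrightarrow> f - g \<in> carrier P"
  using keys_diff[of f g] by auto

lemma pairs_times_closed:
  assumes "f \<in> carrier P" "g \<in> carrier P"
  shows "f \<otimes>\<^bsub>P\<^esub> g \<in> carrier P"
  using assms(1)
proof (induction f rule: pairs_induct)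
  case (of a b)
  show ?case
    using assms(2)
  proof (induction g rule: pairs_induct)
    case (diff f g)
    then show ?case unfolding pairs_times_diff_right by (intro pairs_diff_closed)
  qed (use of in auto)
next
  case (diff f f')
  then show ?case unfolding pairs_times_diff_left by (intro pairs_diff_closed)
qed auto

lemma pairs_times_comm:
  assumes "f \<in> carrier P" "g \<in> carrier P"
  shows "f \<otimes>\<^bsub>P\<^esub> g = g \<otimes>\<^bsub>P\<^esub> f"
  using assms(1)
proof (induction f rule: pairs_induct)
  case (of a b)
  show ?case
    using assms(2)
    by (induction g rule: pairs_induct)
      (use of in \<open>auto simp: A.m_comm B.m_comm pairs_times_diff_left pairs_times_diff_right\<close>)
qed (auto simp: pairs_times_diff_left pairs_times_diff_right)

lemma pairs_times_assoc:
  assumes "f \<in> carrier P" "g \<in> carrier P" "h \<in> carrier P"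
  shows "(f \<otimes>\<^bsub>P\<^esub> g) \<otimes>\<^bsub>P\<^esub> h = f \<otimes>\<^bsub>P\<^esub> (g \<otimes>\<^bsub>P\<^esub> h)"
  using assms(1)
proof (induction f rule: pairs_induct)
  case f: (of a b)
  show ?case
    using assms(2)
  proof (induction g rule: pairs_induct)
    case g: (of a' b')
    show ?case
      using assms(3)
      by (induction h rule: pairs_induct)
        (use f g in \<open>auto simp: A.m_assoc B.m_assoc pairs_times_diff_right\<close>)
  qed (auto simp: pairs_times_diff_left pairs_times_diff_right)
qed (auto simp: pairs_times_diff_left)

lemma pairs_times_one:
  assumes "f \<in> carrier P"
  shows "frag_of (\<one>\<^bsub>A\<^esub>, \<one>\<^bsub>B\<^esub>) \<otimes>\<^bsub>P\<^esub> f = f"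
  using assms by (induction f rule: pairs_induct) (auto simp: pairs_times_diff_right)

lemma pairs_cring: "cring P"
proof (rule cringI)
  show "abelian_group P"
  proof (rule abelian_groupI)
    fix f assume "f \<in> carrier P"
    then show "\<exists>g\<in>carrier P. g \<oplus>\<^bsub>P\<^esub> f = \<zero>\<^bsub>P\<^esub>"
      by (intro bexI[of _ "- f"]) auto
  next
    fix f g assume "f \<in> carrier P" "g \<in> carrier P"
    then show "f \<oplus>\<^bsub>P\<^esub> g \<in> carrier P" using Poly_Mapping.keys_add[of f g] by auto
  qed auto
  show "comm_monoid P"
    by (rule comm_monoidI)
      (use pairs_times_closed pairs_times_comm pairs_times_assoc pairs_times_one in auto)
  show "(f \<oplus>\<^bsub>P\<^esub> g) \<otimes>\<^bsub>P\<^esub> h = f \<otimes>\<^bsub>P\<^esub> h \<oplus>\<^bsub>P\<^esub> g \<otimes>\<^bsub>P\<^esub> h" for f g h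
    using pairs_times_diff_left[of f "- g" h] pairs_times_diff_left[of 0 g h] by simp
qed

sublocale P: cring P
  by (rule pairs_cring)

lemma pairs_uminus: "f \<in> carrier P \<Longrightarrow> \<ominus>\<^bsub>P\<^esub> f = - f"
  by (rule P.minus_equality) auto

lemma pairs_minus: "f \<in> carrier P \<Longrightarrow> g \<in> carrier P \<Longrightarrow> f \<ominus>\<^bsub>P\<^esub> g = f - g"
  unfolding a_minus_def using pairs_uminus by auto

lemma ideal_diff:
  assumes "ideal I P" "f \<in> I" "g \<in> I"
  shows "f - g \<in> I"
proof -
  interpret I: ideal I P by fact
  show ?thesis
    using I.a_closed[of f "\<ominus>\<^bsub>P\<^esub> g"] I.a_inv_closed[of g] I.a_Hcarr assms pairs_uminus[of g] by auto
qed

text \<open>Since pairs generate additively, stability under multiplication by pairs implies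
  stability under all of \<open>P\<close>; commutativity supplies the other side.\<close>

lemma pairs_idealI:
  assumes "Z \<subseteq> carrier P" "0 \<in> Z" "\<And>f g. f \<in> Z \<Longrightarrow> g \<in> Z \<Longrightarrow> f - g \<in> Z"
    and "\<And>a b f. a \<in> carrier A \<Longrightarrow> b \<in> carrier B \<Longrightarrow> f \<in> Z \<Longrightarrow> frag_of (a, b) \<otimes>\<^bsub>P\<^esub> f \<in> Z"
  shows "ideal Z P"
proof (rule idealI)
  show "ring P" ..
  have uminus: "- f \<in> Z" if "f \<in> Z" for f
    using assms(3)[OF assms(2) that] by simp
  show "subgroup Z (add_monoid P)"
  proof (rule P.add.subgroupI)
    show "f \<oplus>\<^bsub>P\<^esub> g \<in> Z" if "f \<in> Z" "g \<in> Z" for f g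
      using assms(3)[OF that(1) uminus[OF that(2)]] by simp
    show "\<ominus>\<^bsub>P\<^esub> f \<in> Z" if "f \<in> Z" for f
      using uminus[OF that] pairs_uminus[of f] that assms(1) by auto
  qed (use assms in auto)
  show mult: "g \<otimes>\<^bsub>P\<^esub> f \<in> Z" if "f \<in> Z" "g \<in> carrier P" for f g
    using that(2)
    by (induction g rule: pairs_induct) (use that assms in \<open>auto simp: pairs_times_diff_left\<close>)
  show "f \<otimes>\<^bsub>P\<^esub> g \<in> Z" if "f \<in> Z" "g \<in> carrier P" for f g
    using mult[OF that] pairs_times_comm[of f g] that assms(1) by auto
qed

end

section \<open>The tensor product and its neighbourhoods of zero\<close>

locale algebra_pair = A: algebra K A + B: algebra K B
  for K :: "('a, 'k) ring_scheme" and A :: "('a, 'b, 'm) module_scheme" and B :: "('a, 'c, 'n) module_scheme"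

sublocale algebra_pair \<subseteq> cring_pair A B ..

context algebra_pair
begin

lemma tensor_relations_carrier: "tensor_relations K A B \<subseteq> carrier P"
proof
  fix f assume "f \<in> tensor_relations K A B"
  then show "f \<in> carrier P"
    unfolding tensor_relations_def pairs_simps
    by (elim UnE CollectE exE conjE) (simp_all add: keys_frag_of_diff)
qed

lemma tensor_ideal_ideal: "ideal (tensor_ideal K A B) P"
  unfolding tensor_ideal_def by (rule P.genideal_ideal[OF tensor_relations_carrier])

lemma tensor_cring: "cring (tensor_ring K A B)"
  unfolding tensor_ring_def by (rule ideal.quotient_is_cring[OF tensor_ideal_ideal pairs_cring])

lemma tensor_carrier:
  "carrier (tensor_ring K A B) = (\<lambda>f. tensor_ideal K A B +>\<^bsub>P\<^esub> f) ` carrier P"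
  by (auto simp: tensor_ring_def FactRing_def A_RCOSETS_def')

lemma pure_tensor_closed:
  "a \<in> carrier A \<Longrightarrow> b \<in> carrier B \<Longrightarrow> pure_tensor K A B a b \<in> carrier (tensor_ring K A B)"
  by (simp add: pure_tensor_def tensor_carrier)

lemma tensor_nbhd_ideal:
  assumes "I \<subseteq> carrier A" "J \<subseteq> carrier B"
  shows "ideal (tensor_nbhd K A B I J) (tensor_ring K A B)"
  unfolding tensor_nbhd_def
  by (rule ring.genideal_ideal[OF cring.axioms(1)[OF tensor_cring]])
    (use assms pure_tensor_closed in auto)

lemma tensor_nbhd_mono:
  assumes "I \<subseteq> I'" "J \<subseteq> J'"
  shows "tensor_nbhd K A B I J \<subseteq> tensor_nbhd K A B I' J'"
proof -
  have "{pure_tensor K A B a b | a b. a \<in> I \<and> b \<in> carrier B} \<union>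
      {pure_tensor K A B a b | a b. a \<in> carrier A \<and> b \<in> J}
    \<subseteq> {pure_tensor K A B a b | a b. a \<in> I' \<and> b \<in> carrier B} \<union>
      {pure_tensor K A B a b | a b. a \<in> carrier A \<and> b \<in> J'}"
    using assms by blast
  then show ?thesis
    unfolding tensor_nbhd_def by (rule genideal_mono)
qed

text \<open>Reduces membership in a neighbourhood to representatives. The image of \<open>Z\<close>
  in the tensor product is an ideal containing the generators of the neighbourhood; and as
  \<open>Z\<close> contains all relations, a coset that has one representative in \<open>Z\<close>
  lies wholly in \<open>Z\<close>.\<close>

lemma tensor_nbhd_subset:
  assumes Z: "ideal Z P" and rel: "tensor_relations K A B \<subseteq> Z"
    and I: "I \<subseteq> carrier A" "\<And>a b. a \<in> I \<Longrightarrow> b \<in> carrier B \<Longrightarrow> frag_of (a, b) \<in> Z"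
    and J: "J \<subseteq> carrier B" "\<And>a b. a \<in> carrier A \<Longrightarrow> b \<in> J \<Longrightarrow> frag_of (a, b) \<in> Z"
    and X: "X \<in> tensor_nbhd K A B I J"
  shows "X \<subseteq> Z"
proof -
  interpret Z: ideal Z P by fact
  interpret T: ideal "tensor_ideal K A B" P by (rule tensor_ideal_ideal)
  interpret Q: cring "tensor_ring K A B" by (rule tensor_cring)
  let ?T = "tensor_ideal K A B" and ?Q = "tensor_ring K A B"
  define V where "V = (\<lambda>f. ?T +>\<^bsub>P\<^esub> f) ` Z"
  have TZ: "?T \<subseteq> Z"
    unfolding tensor_ideal_def by (rule P.genideal_minimal[OF Z rel])
  have hom: "ring_hom_ring P ?Q (\<lambda>f. ?T +>\<^bsub>P\<^esub> f)"
    unfolding tensor_ring_def by (rule T.rcos_ring_hom_ring)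
  interpret h: ring_hom_ring P ?Q "\<lambda>f. ?T +>\<^bsub>P\<^esub> f" by (rule hom)
  have "ideal V ?Q"
    unfolding V_def by (rule h.ideal_image[OF Z]) (rule tensor_carrier[symmetric])
  moreover have "pure_tensor K A B a b \<in> V" if "frag_of (a, b) \<in> Z" for a b
    unfolding V_def pure_tensor_def using that by (rule imageI)
  then have "{pure_tensor K A B a b | a b. a \<in> I \<and> b \<in> carrier B} \<union>
     {pure_tensor K A B a b | a b. a \<in> carrier A \<and> b \<in> J} \<subseteq> V"
    using I(2) J(2) by auto
  ultimately have "tensor_nbhd K A B I J \<subseteq> V"
    unfolding tensor_nbhd_def by (rule Q.genideal_minimal)
  then have "X \<in> V" using X by (rule subsetD)
  then obtain f where f: "f \<in> Z" "X = ?T +>\<^bsub>P\<^esub> f" unfolding V_def by blast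
  show ?thesis
  proof
    fix x assume "x \<in> X"
    then obtain t where t: "t \<in> ?T" "x = t \<oplus>\<^bsub>P\<^esub> f"
      unfolding f(2) a_r_coset_def' by blast
    show "x \<in> Z"
      unfolding t(2) by (rule Z.a_closed[OF subsetD[OF TZ t(1)] f(1)])
  qed
qed

end


section \<open>Complete linearly topologised rings\<close>


lemma (in abelian_group) minus_eq_zeroD:
  assumes "x \<in> carrier G" "y \<in> carrier G" "x \<ominus> y = \<zero>"
  shows "x = y"
  using minus_equality[of x "\<ominus> y"] assms by (simp add: a_minus_def)

lemma (in ideal) coset_mem_iff:
  assumes "x \<in> carrier R" "y \<in> carrier R"
  shows "y \<in> I +> x \<longleftrightarrow> y \<ominus> x \<in> I"
  using a_rcos_module_minus[OF ring_axioms assms] .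

lemma (in ideal) coset_self: "x \<in> carrier R \<Longrightarrow> x \<in> I +> x"
  by (rule a_rcos_self)

lemma (in ideal) coset_eq_iff:
  assumes "x \<in> carrier R" "y \<in> carrier R"
  shows "I +> x = I +> y \<longleftrightarrow> x \<ominus> y \<in> I"
  using quotient_eq_iff_same_a_r_cos[OF ideal_axioms assms] by simp

lemma (in ideal) diff_mem:
  assumes "x \<in> I" "y \<in> I"
  shows "x \<ominus> y \<in> I"
  using assms a_closed a_inv_closed by (simp add: a_minus_def)

locale formal_cring = cring R for R (structure) +
  fixes T :: "'a topology"
  assumes formal: "formal_ring R T"
begin

abbreviation OI :: "'a set set"
  where "OI \<equiv> open_ideals R T"

lemma OI_D:
  assumes "I \<in> OI"
  shows OI_ideal: "ideal I R" and OI_open: "openin T I"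
  using assms by (auto simp: open_ideals_def)

lemma zero_in_OI: "I \<in> OI \<Longrightarrow> \<zero> \<in> I"
  using additive_subgroup.zero_closed ideal.axioms(1) OI_ideal by blast

lemma topspace: "topspace T = carrier R"
  using formal by (simp add: formal_ring_def linearly_topologised_ring_def)

text \<open>A nonzero element common to all open ideals could not be separated from zero, because
  the open ideals form a basis of neighbourhoods of zero.\<close>

lemma separated:
  assumes x: "x \<in> carrier R" and I: "\<And>I. I \<in> OI \<Longrightarrow> x \<in> I"
  shows "x = \<zero>"
proof (rule ccontr)
  assume "x \<noteq> \<zero>"
  moreover have "Hausdorff_space T" using formal by (simp add: formal_ring_def)
  ultimately obtain U V where UV: "openin T U" "openin T V" "x \<in> U" "\<zero> \<in> V" "disjnt U V"
    using x topspace unfolding Hausdorff_space_def by (metis zero_closed)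
  then obtain I where "I \<in> OI" "I \<subseteq> V"
    using formal unfolding formal_ring_def linearly_topologised_ring_def by blast
  then show False using I[of I] UV by (auto simp: disjnt_def)
qed

text \<open>The cosets of the \<open>g I\<close> form a point of the limit, and completeness lifts
  it to an element of the ring.\<close>

lemma complete:
  assumes g: "\<And>I. I \<in> OI \<Longrightarrow> g I \<in> carrier R"
    and compat: "\<And>I I'. I \<in> OI \<Longrightarrow> I' \<in> OI \<Longrightarrow> I \<subseteq> I' \<Longrightarrow> g I \<ominus> g I' \<in> I'"
  shows "\<exists>r\<in>carrier R. \<forall>I\<in>OI. g I \<ominus> r \<in> I"
proof -
  define c where "c = (\<lambda>I\<in>OI. I +> g I)"
  have "c \<in> carrier (limit_ring R OI)"
    unfolding limit_ring_def partial_object.simps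
  proof (intro CollectI conjI ballI impI)
    show "c \<in> (\<Pi>\<^sub>E J\<in>OI. carrier (R Quot J))"
    proof (rule PiE_I)
      fix I assume I: "I \<in> OI"
      interpret I: ideal I R by (rule OI_ideal[OF I])
      show "c I \<in> carrier (R Quot I)"
        using a_rcosetsI[OF I.a_subset g[OF I]] I by (simp add: c_def FactRing_def)
    qed (simp add: c_def)
    fix I I' assume I: "I \<in> OI" "I' \<in> OI" "I \<subseteq> I'"
    interpret I': ideal I' R by (rule OI_ideal[OF I(2)])
    have "I' +> g I = I' +> g I'"
      using I'.coset_eq_iff[OF g[OF I(1)] g[OF I(2)]] compat[OF I] by (rule iffD2)
    moreover have "I +> g I \<subseteq> I' +> g I"
      using I(3) by (auto simp: a_r_coset_def')
    ultimately show "c I \<subseteq> c I'" using I by (simp add: c_def)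
  qed
  then obtain r where r: "r \<in> carrier R" "limit_map R OI r = c"
    using formal unfolding formal_ring_def by (metis imageE)
  have "g I \<ominus> r \<in> I" if I: "I \<in> OI" for I
  proof -
    have "I +> g I = I +> r"
      using fun_cong[OF r(2), of I] I by (simp add: limit_map_def c_def)
    then show ?thesis
      using ideal.coset_eq_iff[OF OI_ideal[OF I] g[OF I] r(1)] by blast
  qed
  then show ?thesis using r(1) by blast
qed

text \<open>The geometric series, without convergence: its partial sums invert \<one> \<ominus> z
  modulo each open ideal, the inverses are compatible, completeness glues them, and separatedness
  turns the congruences into an equation.\<close>

lemma one_minus_unit:
  assumes z: "z \<in> carrier R" and nil: "\<And>I. I \<in> OI \<Longrightarrow> \<exists>n::nat. z [^] n \<in> I"
  shows "\<exists>u\<in>carrier R. (\<one> \<ominus> z) \<otimes> u = \<one>"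
proof -
  have geom: "\<exists>x\<in>carrier R. (\<one> \<ominus> z) \<otimes> x = \<one> \<ominus> z [^] n" for n :: nat
  proof (induction n)
    case 0
    show ?case using z by (intro bexI[of _ \<zero>]) (simp_all add: a_minus_def r_neg)
  next
    case (Suc n)
    then obtain x where x: "x \<in> carrier R" "(\<one> \<ominus> z) \<otimes> x = \<one> \<ominus> z [^] n" by blast
    define w where "w = z [^] n"
    have w: "w \<in> carrier R" using z by (simp add: w_def)
    have "(\<one> \<ominus> z) \<otimes> (x \<oplus> w) = (\<one> \<ominus> z) \<otimes> x \<oplus> (w \<ominus> w \<otimes> z)"
      using x(1) z w by algebra
    also have "\<dots> = \<one> \<ominus> w \<otimes> z"
      unfolding x(2) w_def[symmetric] using z w by algebra
    finally have "(\<one> \<ominus> z) \<otimes> (x \<oplus> z [^] n) = \<one> \<ominus> z [^] Suc n" by (simp add: w_def)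
    then show ?case using x(1) z by (intro bexI[of _ "x \<oplus> z [^] n"]) auto
  qed
  have "\<exists>x. x \<in> carrier R \<and> (\<one> \<ominus> z) \<otimes> x \<ominus> \<one> \<in> I" if I: "I \<in> OI" for I
  proof -
    interpret I: ideal I R by (rule OI_ideal[OF I])
    obtain n where n: "z [^] (n::nat) \<in> I" using nil[OF I] by (rule exE)
    obtain x where x: "x \<in> carrier R" "(\<one> \<ominus> z) \<otimes> x = \<one> \<ominus> z [^] n" using geom by blast
    have "\<one> \<ominus> w \<ominus> \<one> = \<ominus> w" if "w \<in> carrier R" for w
      using that by algebra
    then have "(\<one> \<ominus> z) \<otimes> x \<ominus> \<one> = \<ominus> (z [^] n)"
      unfolding x(2) using z by simp
    then show ?thesis using x I.a_inv_closed[OF n] by auto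
  qed
  then obtain g where g: "\<And>I. I \<in> OI \<Longrightarrow> g I \<in> carrier R"
    "\<And>I. I \<in> OI \<Longrightarrow> (\<one> \<ominus> z) \<otimes> g I \<ominus> \<one> \<in> I"
    by metis
  have "\<exists>r\<in>carrier R. \<forall>I\<in>OI. g I \<ominus> r \<in> I"
  proof (rule complete[OF g(1)])
    fix I I' assume I: "I \<in> OI" "I' \<in> OI" "I \<subseteq> I'"
    interpret I': ideal I' R by (rule OI_ideal[OF I(2)])
    define a b where "a = g I" and "b = g I'"
    have ab: "a \<in> carrier R" "b \<in> carrier R" using g(1) I by (auto simp: a_def b_def)
    have mem: "(\<one> \<ominus> z) \<otimes> a \<ominus> \<one> \<in> I'" "(\<one> \<ominus> z) \<otimes> b \<ominus> \<one> \<in> I'"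
      using g(2) I by (auto simp: a_def b_def)
    \<comment> \<open>Uniqueness of inverses, modulo \<open>I'\<close>: the identity expresses the
      difference of two approximate inverses through their two errors.\<close>
    have "a \<ominus> b = b \<otimes> ((\<one> \<ominus> z) \<otimes> a \<ominus> \<one>) \<ominus> a \<otimes> ((\<one> \<ominus> z) \<otimes> b \<ominus> \<one>)"
      using ab z by algebra
    then show "g I \<ominus> g I' \<in> I'"
      using I'.diff_mem[OF I'.I_l_closed[OF mem(1) ab(2)] I'.I_l_closed[OF mem(2) ab(1)]]
      by (simp add: a_def b_def)
  qed
  then obtain r where r: "r \<in> carrier R" "\<And>I. I \<in> OI \<Longrightarrow> g I \<ominus> r \<in> I" by blast
  have "(\<one> \<ominus> z) \<otimes> r \<ominus> \<one> = \<zero>"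
  proof (rule separated)
    show "(\<one> \<ominus> z) \<otimes> r \<ominus> \<one> \<in> carrier R" using r(1) z by simp
    fix I assume I: "I \<in> OI"
    interpret I: ideal I R by (rule OI_ideal[OF I])
    have gI: "g I \<in> carrier R" using g(1) I .
    have "(\<one> \<ominus> z) \<otimes> r \<ominus> \<one> = ((\<one> \<ominus> z) \<otimes> g I \<ominus> \<one>) \<ominus> (\<one> \<ominus> z) \<otimes> (g I \<ominus> r)"
      using gI r(1) z by algebra
    then show "(\<one> \<ominus> z) \<otimes> r \<ominus> \<one> \<in> I"
      using I.diff_mem[OF g(2)[OF I] I.I_l_closed[OF r(2)[OF I]]] z by simp
  qed
  then show ?thesis
    using r(1) z minus_eq_zeroD[of "(\<one> \<ominus> z) \<otimes> r" \<one>] by (intro bexI[of _ r]) simp_all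
qed

text \<open>The image of \<open>J\<close> is open in the limit, so near zero it contains everything
  that satisfies finitely many conditions, each at some ideal generated by a power of y. A high
  power of y satisfies them all, and injectivity brings it back into \<open>J\<close>.\<close>

lemma power_mem_open:
  assumes y: "y \<in> carrier R"
    and homeo: "homeomorphic_map T (limit_topology R {PIdl (y [^] m) | m::nat. True})
         (limit_map R {PIdl (y [^] m) | m::nat. True})"
    and J: "J \<in> OI"
  shows "\<exists>m::nat. y [^] m \<in> J"
proof -
  define \<A> where "\<A> = {PIdl (y [^] m) | m::nat. True}"
  define X where "X = (\<lambda>J. discrete_topology (carrier (R Quot J)))"
  define C where "C = carrier (limit_ring R \<A>)"
  let ?f = "limit_map R \<A>"
  have homeo: "homeomorphic_map T (subtopology (product_topology X \<A>) C) ?f"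
    using homeo by (simp add: \<A>_def limit_topology_def X_def C_def)
  have inj: "inj_on ?f (carrier R)"
    using homeo topspace by (simp add: homeomorphic_map_def)
  have fC: "?f ` carrier R \<subseteq> C"
    using homeomorphic_imp_surjective_map[OF homeo] topspace by auto
  have "openin (subtopology (product_topology X \<A>) C) (?f ` J)"
    using homeomorphic_imp_open_map[OF homeo] OI_open[OF J] by (auto simp: open_map_def)
  then obtain W where W: "openin (product_topology X \<A>) W" "?f ` J = W \<inter> C"
    by (auto simp: openin_subtopology)
  have "?f \<zero> \<in> W" using W(2) zero_in_OI[OF J] by blast
  then obtain U where U: "finite {A \<in> \<A>. U A \<noteq> topspace (X A)}"
      "?f \<zero> \<in> Pi\<^sub>E \<A> U" "Pi\<^sub>E \<A> U \<subseteq> W"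
    using W(1)[unfolded openin_product_topology_alt, rule_format, of "?f \<zero>"] by blast
  have "{A \<in> \<A>. U A \<noteq> topspace (X A)} \<subseteq> (\<lambda>m::nat. PIdl (y [^] m)) ` UNIV"
    by (auto simp: \<A>_def)
  from finite_subset_image[OF U(1) this] obtain N :: "nat set" where N: "finite N"
      "{A \<in> \<A>. U A \<noteq> topspace (X A)} = (\<lambda>m. PIdl (y [^] m)) ` N"
    by blast
  \<comment> \<open>The sum is an upper bound of the finite set \<open>N\<close>, also when
    \<open>N\<close> is empty.\<close>
  define M where "M = \<Sum>N"
  have "?f (y [^] M) \<in> Pi\<^sub>E \<A> U"
  proof (rule PiE_I)
    fix A assume A: "A \<in> \<A>"
    then have idA: "ideal A R" unfolding \<A>_def using y cgenideal_ideal nat_pow_closed by blast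
    show "?f (y [^] M) A \<in> U A"
    proof (cases "U A = topspace (X A)")
      case True
      have "A +> y [^] M \<in> a_rcosets A"
        using idA y by (intro a_rcosetsI additive_subgroup.a_subset ideal.axioms(1)) simp_all
      with True show ?thesis
        using A by (simp add: limit_map_def X_def FactRing_def)
    next
      case False
      then obtain m where m: "m \<in> N" "A = PIdl (y [^] m)" using A N(2) by blast
      then have "m \<le> M" unfolding M_def using member_le_sum[of m N "\<lambda>x. x"] N(1) by simp
      then have "y [^] M = y [^] (M - m) \<otimes> y [^] m" using y by (simp add: nat_pow_mult)
      then have "y [^] M \<in> A" unfolding m(2) cgenideal_def using y by blast
      then have "A +> y [^] M = A +> \<zero>"
        using ideal.coset_eq_iff[OF idA, of "y [^] M" \<zero>] y by (simp add: a_minus_def)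
      then show ?thesis using PiE_mem[OF U(2) A] A by (simp add: limit_map_def)
    qed
  next
    fix A assume "A \<notin> \<A>" then show "?f (y [^] M) A = undefined" by (simp add: limit_map_def)
  qed
  moreover have "?f (y [^] M) \<in> C" using fC y by auto
  ultimately have "?f (y [^] M) \<in> ?f ` J" using U(3) W(2) by blast
  then obtain j where j: "j \<in> J" "?f (y [^] M) = ?f j" by blast
  have "y [^] M = j"
    by (rule inj_onD[OF inj j(2)]) (use y ideal.Icarr[OF OI_ideal[OF J] j(1)] in simp_all)
  then have "y [^] M \<in> J" using j(1) by simp
  then show ?thesis by (rule exI)
qed

end


section \<open>The diagonal\<close>


text \<open>The map a \<otimes> b -> a g(b), that is, 1 \<otimes> g followed by multiplication. For
  g the identity it is the multiplication map; for g a coordinate functional on R/J it gives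
  coordinates in R \<otimes> R/J.\<close>

definition tensor_eval :: "('b, 'm) ring_scheme \<Rightarrow> ('b \<Rightarrow> 'b) \<Rightarrow> ('b \<times> 'b \<Rightarrow>\<^sub>0 int) \<Rightarrow> 'b"
  where "tensor_eval R g = frag_lift R (\<lambda>(a, b). a \<otimes>\<^bsub>R\<^esub> g b)"

lemma pairs_mult_eq_tensor_eval: "pairs_mult R f = tensor_eval R (\<lambda>x. x) f"
  by (simp add: pairs_mult_def tensor_eval_def frag_lift_def case_prod_unfold)

lemma module_homD:
  assumes "h \<in> module_hom K M N"
  shows "x \<in> carrier M \<Longrightarrow> h x \<in> carrier N"
    and "x \<in> carrier M \<Longrightarrow> y \<in> carrier M \<Longrightarrow> h (x \<oplus>\<^bsub>M\<^esub> y) = h x \<oplus>\<^bsub>N\<^esub> h y"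
    and "a \<in> carrier K \<Longrightarrow> x \<in> carrier M \<Longrightarrow> h (a \<odot>\<^bsub>M\<^esub> x) = a \<odot>\<^bsub>N\<^esub> h x"
  using assms by (auto simp: module_hom_def)

locale tensor_square = cring R + A: algebra K R
  for K :: "('a, 'k) ring_scheme" and R :: "('a, 'b, 'm) module_scheme" (structure)

sublocale tensor_square \<subseteq> tp: algebra_pair K R R ..

context tensor_square
begin

abbreviation "P \<equiv> pairs_ring R R"

lemma tensor_eval_closed:
  assumes "g \<in> carrier R \<rightarrow> carrier R" "f \<in> carrier P"
  shows "tensor_eval R g f \<in> carrier R"
  unfolding tensor_eval_def by (rule frag_lift_closed) (use assms in auto)

lemma tensor_eval_zero: "tensor_eval R g 0 = \<zero>"
  by (simp add: tensor_eval_def frag_lift_zero)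

lemma tensor_eval_of:
  assumes "g \<in> carrier R \<rightarrow> carrier R" "a \<in> carrier R" "b \<in> carrier R"
  shows "tensor_eval R g (frag_of (a, b)) = a \<otimes> g b"
  unfolding tensor_eval_def by (subst frag_lift_of) (use assms in auto)

lemma tensor_eval_diff:
  assumes "g \<in> carrier R \<rightarrow> carrier R" "f \<in> carrier P" "f' \<in> carrier P"
  shows "tensor_eval R g (f - f') = tensor_eval R g f \<ominus> tensor_eval R g f'"
  unfolding tensor_eval_def by (rule frag_lift_diff) (use assms in auto)

lemma mult_minus_distr:
  assumes "a \<in> carrier R" "x \<in> carrier R" "y \<in> carrier R"
  shows "a \<otimes> (x \<ominus> y) = a \<otimes> x \<ominus> a \<otimes> y"
  using assms by algebra

text \<open>Multiplying by a \<otimes> b changes the functional from g to g(b -). Ideals defined by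
  such evaluations therefore have to allow for all these functionals together.\<close>

lemma tensor_eval_mult_of:
  assumes g: "g \<in> carrier R \<rightarrow> carrier R" and ab: "a \<in> carrier R" "b \<in> carrier R" and f: "f \<in> carrier P"
  shows "tensor_eval R g (frag_of (a, b) \<otimes>\<^bsub>P\<^esub> f) = a \<otimes> tensor_eval R (\<lambda>x. g (b \<otimes> x)) f"
  using f
proof (induction f rule: tp.pairs_induct)
  case zero
  show ?case using ab by (simp add: tensor_eval_zero)
next
  case (of a' b')
  have "(\<lambda>x. g (b \<otimes> x)) \<in> carrier R \<rightarrow> carrier R" using g ab by auto
  then show ?case using of ab g by (simp add: tensor_eval_of m_assoc Pi_iff)
next
  case (diff f f')
  have g': "(\<lambda>x. g (b \<otimes> x)) \<in> carrier R \<rightarrow> carrier R" using g ab by auto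
  have ab': "frag_of (a, b) \<in> carrier P" using ab by simp
  show ?case
    unfolding tp.pairs_times_diff_right
      tensor_eval_diff[OF g tp.pairs_times_closed[OF ab' diff.hyps(1)] tp.pairs_times_closed[OF ab' diff.hyps(2)]]
      tensor_eval_diff[OF g' diff.hyps] diff.IH
    by (rule mult_minus_distr[OF ab(1) tensor_eval_closed[OF g' diff.hyps(1)]
          tensor_eval_closed[OF g' diff.hyps(2)], symmetric])
qed

text \<open>A substitute for the kernel of R \<otimes> R -> R/I \<otimes> R/I: it contains that
  kernel and is tested by functionals only. Letting \<open>g\<close> range over all linear maps that
  preserve \<open>I\<close> makes it an ideal, since this class is closed under passing from g to
  g(b -).\<close>

definition diag_ideal :: "'b set \<Rightarrow> ('b \<times> 'b \<Rightarrow>\<^sub>0 int) set"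
  where "diag_ideal I =
    {f \<in> carrier P. \<forall>g\<in>module_hom K R R. g ` I \<subseteq> I \<longrightarrow> tensor_eval R g f \<in> I}"

lemma module_hom_funcset: "g \<in> module_hom K R R \<Longrightarrow> g \<in> carrier R \<rightarrow> carrier R"
  by (simp add: module_hom_def)

lemma module_hom_id: "(\<lambda>x. x) \<in> module_hom K R R"
  by (simp add: module_hom_def)

lemma smult_mult_right:
  assumes "k \<in> carrier K" "x \<in> carrier R" "y \<in> carrier R"
  shows "x \<otimes> (k \<odot>\<^bsub>R\<^esub> y) = k \<odot>\<^bsub>R\<^esub> (x \<otimes> y)"
  using A.smult_assoc2[OF assms(1,3,2)] assms by (simp add: m_comm)

lemma module_hom_mult:
  assumes "g \<in> module_hom K R R" "b \<in> carrier R"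
  shows "(\<lambda>x. g (b \<otimes> x)) \<in> module_hom K R R"
  using assms by (auto simp: module_hom_def r_distr smult_mult_right)

lemma diag_idealD:
  "f \<in> diag_ideal I \<Longrightarrow> g \<in> module_hom K R R \<Longrightarrow> g ` I \<subseteq> I \<Longrightarrow> tensor_eval R g f \<in> I"
  "f \<in> diag_ideal I \<Longrightarrow> f \<in> carrier P"
  by (auto simp: diag_ideal_def)

context
  fixes I assumes I: "ideal I R"
begin

interpretation I: ideal I R by (rule I)

lemma zero_mem: "\<zero> \<in> I"
  by (rule additive_subgroup.zero_closed[OF I.additive_subgroup_axioms])

lemma diag_ideal_ideal: "ideal (diag_ideal I) P"
proof (rule tp.pairs_idealI)
  show "diag_ideal I \<subseteq> carrier P" by (auto simp: diag_ideal_def)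
  show "0 \<in> diag_ideal I" by (auto simp: diag_ideal_def tensor_eval_zero zero_mem)
  show "f - f' \<in> diag_ideal I" if f: "f \<in> diag_ideal I" "f' \<in> diag_ideal I" for f f'
    unfolding diag_ideal_def
  proof (intro CollectI conjI ballI impI)
    show "f - f' \<in> carrier P" by (intro tp.pairs_diff_closed diag_idealD(2)[OF f(1)] diag_idealD(2)[OF f(2)])
    fix g assume g: "g \<in> module_hom K R R" "g ` I \<subseteq> I"
    show "tensor_eval R g (f - f') \<in> I"
      unfolding tensor_eval_diff[OF module_hom_funcset[OF g(1)] diag_idealD(2)[OF f(1)] diag_idealD(2)[OF f(2)]]
      by (intro I.diff_mem diag_idealD(1)[OF f(1) g] diag_idealD(1)[OF f(2) g])
  qed
  show "frag_of (a, b) \<otimes>\<^bsub>P\<^esub> f \<in> diag_ideal I"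
    if ab: "a \<in> carrier R" "b \<in> carrier R" and f: "f \<in> diag_ideal I" for a b f
    unfolding diag_ideal_def
  proof (intro CollectI conjI ballI impI)
    show "frag_of (a, b) \<otimes>\<^bsub>P\<^esub> f \<in> carrier P"
      by (rule tp.pairs_times_closed) (use ab diag_idealD(2)[OF f] in simp_all)
    fix g assume g: "g \<in> module_hom K R R" "g ` I \<subseteq> I"
    have "(\<lambda>x. g (b \<otimes> x)) ` I \<subseteq> I" using g(2) I.I_l_closed[OF _ ab(2)] by auto
    then show "tensor_eval R g (frag_of (a, b) \<otimes>\<^bsub>P\<^esub> f) \<in> I"
      unfolding tensor_eval_mult_of[OF module_hom_funcset[OF g(1)] ab diag_idealD(2)[OF f]]
      by (intro I.I_l_closed[OF _ ab(1)] diag_idealD(1)[OF f] module_hom_mult[OF g(1) ab(2)])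
  qed
qed

text \<open>For linear g the expression a g(b) is bilinear and balanced over \<open>K\<close>, so
  the relations evaluate to zero and not merely into \<open>I\<close>.\<close>

lemma tensor_relations_diag: "tensor_relations K R R \<subseteq> diag_ideal I"
proof
  fix f assume f: "f \<in> tensor_relations K R R"
  have fP: "f \<in> carrier P" using tp.tensor_relations_carrier f by (rule subsetD)
  have "tensor_eval R g f = \<zero>" if g: "g \<in> module_hom K R R" for g
  proof -
    note gc = module_hom_funcset[OF g] and gm = module_homD[OF g]
    have two: "tensor_eval R g (frag_of (a, b) - frag_of (a', b')) = a \<otimes> g b \<ominus> a' \<otimes> g b'"
      if "a \<in> carrier R" "b \<in> carrier R" "a' \<in> carrier R" "b' \<in> carrier R" for a b a' b'
      using that by (subst tensor_eval_diff[OF gc]) (simp_all add: tensor_eval_of[OF gc])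
    have three: "tensor_eval R g (frag_of (a, b) - frag_of (a', b') - frag_of (a'', b''))
        = (a \<otimes> g b \<ominus> a' \<otimes> g b') \<ominus> a'' \<otimes> g b''"
      if c: "a \<in> carrier R" "b \<in> carrier R" "a' \<in> carrier R" "b' \<in> carrier R" "a'' \<in> carrier R" "b'' \<in> carrier R"
      for a b a' b' a'' b''
    proof -
      have "frag_of (a, b) - frag_of (a', b') \<in> carrier P"
        by (rule tp.pairs_diff_closed) (use c in simp_all)
      then show ?thesis
        using c by (subst tensor_eval_diff[OF gc]) (simp_all add: two tensor_eval_of[OF gc])
    qed
    have *: "((a \<oplus> a') \<otimes> b \<ominus> a \<otimes> b) \<ominus> a' \<otimes> b = \<zero>" "(a \<otimes> (b \<oplus> b') \<ominus> a \<otimes> b) \<ominus> a \<otimes> b' = \<zero>"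
      "a \<ominus> a = \<zero>"
      if "a \<in> carrier R" "a' \<in> carrier R" "b \<in> carrier R" "b' \<in> carrier R" for a a' b b'
      using that by algebra+
    from f show ?thesis
      unfolding tensor_relations_def
    proof (elim UnE CollectE exE conjE)
      fix a a' b assume "f = frag_of (a \<oplus> a', b) - frag_of (a, b) - frag_of (a', b)"
        and c: "a \<in> carrier R" "a' \<in> carrier R" "b \<in> carrier R"
      then show ?thesis using gm(1)[OF c(3)] by (simp add: three *)
    next
      fix a b b' assume "f = frag_of (a, b \<oplus> b') - frag_of (a, b) - frag_of (a, b')"
        and c: "a \<in> carrier R" "b \<in> carrier R" "b' \<in> carrier R"
      then show ?thesis using gm(1)[OF c(2)] gm(1)[OF c(3)] by (simp add: three gm(2) *)
    next
      fix k a b assume "f = frag_of (k \<odot>\<^bsub>R\<^esub> a, b) - frag_of (a, k \<odot>\<^bsub>R\<^esub> b)"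
        and c: "k \<in> carrier K" "a \<in> carrier R" "b \<in> carrier R"
      then show ?thesis
        using gm(1)[OF c(3)] by (simp add: two gm(3) A.smult_assoc2 smult_mult_right *(3))
    qed
  qed
  then show "f \<in> diag_ideal I" using fP zero_mem by (simp add: diag_ideal_def)
qed

text \<open>On a generator a \<otimes> b the value a g(b) lies in \<open>I\<close>: if a is in
  \<open>I\<close> because \<open>I\<close> is an ideal, if b is in \<open>I\<close> because g
  preserves \<open>I\<close>.\<close>

lemma tensor_nbhd_diag:
  assumes "X \<in> tensor_nbhd K R R I I"
  shows "X \<subseteq> diag_ideal I"
proof (rule tp.tensor_nbhd_subset[OF diag_ideal_ideal tensor_relations_diag I.a_subset _ I.a_subset _ assms])
  show "frag_of (a, b) \<in> diag_ideal I" if "a \<in> I" "b \<in> carrier R" for a b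
    using that I.Icarr
    by (auto simp: diag_ideal_def tensor_eval_of[OF module_hom_funcset] module_homD(1) I.I_r_closed)
  show "frag_of (a, b) \<in> diag_ideal I" if "a \<in> carrier R" "b \<in> I" for a b
    using that I.Icarr
    by (auto simp: diag_ideal_def tensor_eval_of[OF module_hom_funcset] intro!: I.I_l_closed)
qed

lemma tensor_ideal_diag: "tensor_ideal K R R \<subseteq> diag_ideal I"
  unfolding tensor_ideal_def by (rule tp.P.genideal_minimal[OF diag_ideal_ideal tensor_relations_diag])

lemma pairs_mult_diag: "f \<in> diag_ideal I \<Longrightarrow> pairs_mult R f \<in> I"
  unfolding pairs_mult_eq_tensor_eval by (rule diag_idealD(1)[OF _ module_hom_id]) auto

end

lemma pairs_mult_of: "a \<in> carrier R \<Longrightarrow> b \<in> carrier R \<Longrightarrow> pairs_mult R (frag_of (a, b)) = a \<otimes> b"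
  unfolding pairs_mult_eq_tensor_eval by (subst tensor_eval_of) auto

lemma pairs_mult_closed: "f \<in> carrier P \<Longrightarrow> pairs_mult R f \<in> carrier R"
  unfolding pairs_mult_eq_tensor_eval by (rule tensor_eval_closed) auto

lemma pairs_mult_diff:
  "f \<in> carrier P \<Longrightarrow> f' \<in> carrier P \<Longrightarrow> pairs_mult R (f - f') = pairs_mult R f \<ominus> pairs_mult R f'"
  unfolding pairs_mult_eq_tensor_eval by (rule tensor_eval_diff) auto

text \<open>The multiplication map is constant on a coset, so \<open>the_elem\<close> picks a
  genuine value. This is the earlier analysis for the zero ideal, where landing in the ideal means
  vanishing.\<close>

lemma tensor_mult_coset:
  assumes f: "f \<in> carrier P"
  shows "tensor_mult R (tensor_ideal K R R +>\<^bsub>P\<^esub> f) = pairs_mult R f"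
proof -
  interpret T: ideal "tensor_ideal K R R" P by (rule tp.tensor_ideal_ideal)
  have "pairs_mult R x = pairs_mult R f" if x: "x \<in> tensor_ideal K R R +>\<^bsub>P\<^esub> f" for x
  proof -
    have xP: "x \<in> carrier P" by (rule T.a_elemrcos_carrier[OF f x])
    have "x \<ominus>\<^bsub>P\<^esub> f \<in> tensor_ideal K R R" using x T.coset_mem_iff[OF f xP] by (rule iffD1[rotated])
    then have "x - f \<in> diag_ideal {\<zero>}"
      unfolding tp.pairs_minus[OF xP f] by (rule subsetD[OF tensor_ideal_diag[OF zeroideal]])
    then have "pairs_mult R (x - f) = \<zero>" using pairs_mult_diag[OF zeroideal] by blast
    then show ?thesis
      unfolding pairs_mult_diff[OF xP f]
      by (rule minus_eq_zeroD[OF pairs_mult_closed[OF xP] pairs_mult_closed[OF f]])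
  qed
  moreover have "f \<in> tensor_ideal K R R +>\<^bsub>P\<^esub> f" by (rule T.a_rcos_self[OF f])
  ultimately have "pairs_mult R ` (tensor_ideal K R R +>\<^bsub>P\<^esub> f) = {pairs_mult R f}" by blast
  then show ?thesis by (simp add: tensor_mult_def)
qed

end


section \<open>Representatives of elements of R/I \<otimes> R/I\<close>

context tensor_square
begin

abbreviation "Q \<equiv> tensor_ring K R R"

text \<open>The class of a combination of pairs in R/I \<otimes> R/I, written as a coset of cosets
  so that it matches the components of the completed tensor product.\<close>

definition proj :: "'b set \<Rightarrow> ('b \<times> 'b \<Rightarrow>\<^sub>0 int) \<Rightarrow> ('b \<times> 'b \<Rightarrow>\<^sub>0 int) set set"
  where "proj I f = tensor_nbhd K R R I I +>\<^bsub>Q\<^esub> (tensor_ideal K R R +>\<^bsub>P\<^esub> f)"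

lemma coset_hom: "ring_hom_ring P Q (\<lambda>f. tensor_ideal K R R +>\<^bsub>P\<^esub> f)"
  unfolding tensor_ring_def by (rule ideal.rcos_ring_hom_ring[OF tp.tensor_ideal_ideal])

lemma coset_closed: "f \<in> carrier P \<Longrightarrow> tensor_ideal K R R +>\<^bsub>P\<^esub> f \<in> carrier Q"
  unfolding tp.tensor_carrier by (rule imageI)

lemma coset_mult:
  assumes "f \<in> carrier P" "f' \<in> carrier P"
  shows "tensor_ideal K R R +>\<^bsub>P\<^esub> (f \<otimes>\<^bsub>P\<^esub> f') =
    (tensor_ideal K R R +>\<^bsub>P\<^esub> f) \<otimes>\<^bsub>Q\<^esub> (tensor_ideal K R R +>\<^bsub>P\<^esub> f')"
  by (rule ring_hom_mult[OF ring_hom_ring.homh[OF coset_hom] assms])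

lemma coset_diff:
  assumes "f \<in> carrier P" "f' \<in> carrier P"
  shows "tensor_ideal K R R +>\<^bsub>P\<^esub> (f - f') =
    (tensor_ideal K R R +>\<^bsub>P\<^esub> f) \<ominus>\<^bsub>Q\<^esub> (tensor_ideal K R R +>\<^bsub>P\<^esub> f')"
proof -
  interpret Q: cring Q by (rule tp.tensor_cring)
  let ?h = "\<lambda>f. tensor_ideal K R R +>\<^bsub>P\<^esub> f"
  have d: "f - f' \<in> carrier P" by (rule tp.pairs_diff_closed[OF assms])
  have "(f - f') \<oplus>\<^bsub>P\<^esub> f' = f" by simp
  then have "?h f = ?h (f - f') \<oplus>\<^bsub>Q\<^esub> ?h f'"
    using ring_hom_add[OF ring_hom_ring.homh[OF coset_hom] d assms(2)] by simp
  moreover have "(x \<oplus>\<^bsub>Q\<^esub> y) \<ominus>\<^bsub>Q\<^esub> y = x" if "x \<in> carrier Q" "y \<in> carrier Q" for x y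
    using that by (simp add: a_minus_def Q.a_assoc Q.r_neg)
  ultimately show ?thesis
    using coset_closed[OF d] coset_closed[OF assms(2)] by simp
qed

text \<open>The element 1 \<otimes> a - a \<otimes> 1, one of the standard generators of the kernel
  of multiplication.\<close>

definition diag_elem :: "'b \<Rightarrow> ('b \<times> 'b \<Rightarrow>\<^sub>0 int)"
  where "diag_elem a = frag_of (\<one>, a) - frag_of (a, \<one>)"

lemma diag_elem_closed: "a \<in> carrier R \<Longrightarrow> diag_elem a \<in> carrier P"
  unfolding diag_elem_def by (rule tp.pairs_diff_closed) simp_all

lemma pairs_mult_diag_elem:
  assumes "a \<in> carrier R"
  shows "pairs_mult R (diag_elem a) = \<zero>"
  unfolding diag_elem_def
  by (subst pairs_mult_diff) (use assms in \<open>simp_all add: pairs_mult_of a_minus_def r_neg\<close>)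

context
  fixes I assumes I: "ideal I R"
begin

interpretation I: ideal I R by (rule I)
interpretation Q: cring Q by (rule tp.tensor_cring)

lemma nbhd_ideal: "ideal (tensor_nbhd K R R I I) Q"
  by (rule tp.tensor_nbhd_ideal[OF I.a_subset I.a_subset])

lemma proj_surj:
  assumes "X \<in> carrier (Q Quot tensor_nbhd K R R I I)"
  shows "\<exists>f\<in>carrier P. X = proj I f"
  using assms unfolding FactRing_def A_RCOSETS_def' tp.tensor_carrier proj_def by auto

lemma proj_mult:
  assumes "f \<in> carrier P" "f' \<in> carrier P"
  shows "proj I (f \<otimes>\<^bsub>P\<^esub> f') = proj I f \<otimes>\<^bsub>Q Quot tensor_nbhd K R R I I\<^esub> proj I f'"
  unfolding proj_def coset_mult[OF assms]
  by (rule ring_hom_mult[OF ideal.rcos_ring_hom[OF nbhd_ideal] coset_closed[OF assms(1)]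
        coset_closed[OF assms(2)]])

text \<open>Turns an equation between components of the completed tensor product into congruences
  modulo \<open>I\<close> that can be read off with any admissible functional.\<close>

lemma proj_eq_diag:
  assumes f: "f \<in> carrier P" "f' \<in> carrier P" and eq: "proj I f = proj I f'"
  shows "f - f' \<in> diag_ideal I"
proof -
  interpret T: ideal "tensor_ideal K R R" P by (rule tp.tensor_ideal_ideal)
  have "tensor_ideal K R R +>\<^bsub>P\<^esub> (f - f') \<in> tensor_nbhd K R R I I"
    unfolding coset_diff[OF f]
    by (rule iffD1[OF ideal.coset_eq_iff[OF nbhd_ideal coset_closed[OF f(1)] coset_closed[OF f(2)]]
          eq[unfolded proj_def]])
  then have "tensor_ideal K R R +>\<^bsub>P\<^esub> (f - f') \<subseteq> diag_ideal I"
    by (rule tensor_nbhd_diag[OF I])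
  then show ?thesis
    by (rule subsetD) (rule T.a_rcos_self[OF tp.pairs_diff_closed[OF f]])
qed

lemma mem_proj:
  assumes f: "f \<in> carrier P" and t: "t \<in> proj I f"
  shows "\<exists>f'\<in>carrier P. t = tensor_ideal K R R +>\<^bsub>P\<^esub> f' \<and> f' - f \<in> diag_ideal I"
proof -
  interpret N: ideal "tensor_nbhd K R R I I" Q by (rule nbhd_ideal)
  have tQ: "t \<in> carrier Q"
    by (rule N.a_elemrcos_carrier[OF coset_closed[OF f] t[unfolded proj_def]])
  then obtain f' where f': "f' \<in> carrier P" "t = tensor_ideal K R R +>\<^bsub>P\<^esub> f'"
    unfolding tp.tensor_carrier by (rule imageE)
  have "proj I f' = proj I f"
    unfolding proj_def f'(2)[symmetric]
    by (rule N.a_repr_independence'[OF t[unfolded proj_def] coset_closed[OF f], symmetric])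
  then have "f' - f \<in> diag_ideal I" by (rule proj_eq_diag[OF f'(1) f])
  then show ?thesis using f' by blast
qed

end

end

section \<open>The diagonal in the completed tensor square\<close>

locale formal_tensor_square = tensor_square K R + formal_cring R T
  for K :: "('a, 'k) ring_scheme" and R :: "('a, 'b, 'm) module_scheme" (structure)
    and T :: "'b topology"
begin

abbreviation "CT \<equiv> completed_tensor_ring K R T R T"

definition "nbhds = {tensor_nbhd K R R I J | I J. I \<in> OI \<and> J \<in> OI}"

lemma completed_tensor_ring_eq: "CT = limit_ring Q nbhds"
  by (simp add: completed_tensor_ring_def nbhds_def)

lemma nbhds_mem: "I \<in> OI \<Longrightarrow> tensor_nbhd K R R I I \<in> nbhds"
  unfolding nbhds_def by blast

lemma nbhds_ideal: "N \<in> nbhds \<Longrightarrow> ideal N Q"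
  unfolding nbhds_def using tp.tensor_nbhd_ideal additive_subgroup.a_subset[OF ideal.axioms(1)[OF OI_ideal]] by blast

lemma component:
  assumes c: "c \<in> carrier CT" and I: "I \<in> OI"
  shows "\<exists>f\<in>carrier P. c (tensor_nbhd K R R I I) = proj I f"
proof (rule proj_surj[OF OI_ideal[OF I]])
  have "c \<in> (\<Pi>\<^sub>E N\<in>nbhds. carrier (Q Quot N))"
    using c by (simp add: completed_tensor_ring_eq limit_ring_def)
  then show "c (tensor_nbhd K R R I I) \<in> carrier (Q Quot tensor_nbhd K R R I I)"
    using nbhds_mem[OF I] by (rule PiE_mem)
qed

lemma component_mono:
  assumes c: "c \<in> carrier CT" and I: "I \<in> OI" "I' \<in> OI" "I \<subseteq> I'"
  shows "c (tensor_nbhd K R R I I) \<subseteq> c (tensor_nbhd K R R I' I')"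
proof -
  have "\<forall>N\<in>nbhds. \<forall>N'\<in>nbhds. N \<subseteq> N' \<longrightarrow> c N \<subseteq> c N'"
    using c by (simp add: completed_tensor_ring_eq limit_ring_def)
  then show ?thesis
    using nbhds_mem[OF I(1)] nbhds_mem[OF I(2)] tp.tensor_nbhd_mono[OF I(3) I(3)] by blast
qed

lemma component_tensor_mult:
  assumes I: "I \<in> OI" and f: "f \<in> carrier P" and t: "t \<in> proj I f"
  shows "tensor_mult R t \<in> carrier R" "tensor_mult R t \<ominus> pairs_mult R f \<in> I"
proof -
  obtain f' where f': "f' \<in> carrier P" "t = tensor_ideal K R R +>\<^bsub>P\<^esub> f'" "f' - f \<in> diag_ideal I"
    using mem_proj[OF OI_ideal[OF I] f t] by blast
  show "tensor_mult R t \<in> carrier R"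
    unfolding f'(2) tensor_mult_coset[OF f'(1)] by (rule pairs_mult_closed[OF f'(1)])
  show "tensor_mult R t \<ominus> pairs_mult R f \<in> I"
    unfolding f'(2) tensor_mult_coset[OF f'(1)] pairs_mult_diff[OF f'(1) f, symmetric]
    by (rule pairs_mult_diag[OF OI_ideal[OF I] f'(3)])
qed

lemma cosets_meet:
  assumes I: "ideal I R" and x: "x \<in> carrier R" "y \<in> carrier R" "z \<in> carrier R"
    and "z \<ominus> x \<in> I" "z \<ominus> y \<in> I"
  shows "x \<ominus> y \<in> I"
proof -
  interpret I: ideal I R by fact
  have "(z \<ominus> y) \<ominus> (z \<ominus> x) = x \<ominus> y" using x by algebra
  then show ?thesis using I.diff_mem[OF assms(6,5)] by simp
qed

text \<open>Justifies the definite description in \<open>diagonal_map\<close>. Representatives of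
  the components at (I, I) multiply out to a compatible family modulo the open ideals; completeness
  gives existence, separatedness gives uniqueness.\<close>

lemma diagonal_map_ex1:
  assumes c: "c \<in> carrier CT"
  shows "\<exists>!r. r \<in> carrier R \<and>
    (\<forall>I\<in>OI. \<forall>t\<in>c (tensor_nbhd K R R I I). tensor_mult R t \<in> I +> r)"
proof -
  obtain F where F: "\<And>I. I \<in> OI \<Longrightarrow> F I \<in> carrier P"
    "\<And>I. I \<in> OI \<Longrightarrow> c (tensor_nbhd K R R I I) = proj I (F I)"
    using component[OF c] by metis
  have FR: "pairs_mult R (F I) \<in> carrier R" if "I \<in> OI" for I
    by (rule pairs_mult_closed[OF F(1)[OF that]])
  have self: "tensor_ideal K R R +>\<^bsub>P\<^esub> F I \<in> c (tensor_nbhd K R R I I)" if I: "I \<in> OI" for I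
    unfolding F(2)[OF I] proj_def
    by (rule ideal.coset_self[OF nbhd_ideal[OF OI_ideal[OF I]] coset_closed[OF F(1)[OF I]]])
  \<comment> \<open>All members of one component have the same product modulo \<open>I\<close>, so
    the condition on every t reduces to one on the chosen representative.\<close>
  have iff: "tensor_mult R t \<in> I +> r \<longleftrightarrow> pairs_mult R (F I) \<ominus> r \<in> I"
    if I: "I \<in> OI" and t: "t \<in> c (tensor_nbhd K R R I I)" and r: "r \<in> carrier R" for I t r
  proof -
    interpret I: ideal I R by (rule OI_ideal[OF I])
    have t': "t \<in> proj I (F I)" using t F(2)[OF I] by simp
    note ct = component_tensor_mult[OF I F(1)[OF I] t']
    have "(tensor_mult R t \<ominus> pairs_mult R (F I)) \<oplus> (pairs_mult R (F I) \<ominus> r) = tensor_mult R t \<ominus> r"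
      "(tensor_mult R t \<ominus> r) \<ominus> (tensor_mult R t \<ominus> pairs_mult R (F I)) = pairs_mult R (F I) \<ominus> r"
      using ct(1) FR[OF I] r by algebra+
    then have "tensor_mult R t \<ominus> r \<in> I \<longleftrightarrow> pairs_mult R (F I) \<ominus> r \<in> I"
      using ct(2) I.a_closed I.diff_mem by metis
    then show ?thesis using I.coset_mem_iff[OF r ct(1)] by simp
  qed
  have "\<exists>r\<in>carrier R. \<forall>I\<in>OI. pairs_mult R (F I) \<ominus> r \<in> I"
  proof (rule complete[OF FR])
    fix I I' assume I: "I \<in> OI" "I' \<in> OI" "I \<subseteq> I'"
    \<comment> \<open>The representative at the smaller ideal also represents the component at the
      larger one, and \<open>iff\<close> then compares its product with that of the chosen
      representative there.\<close>
    have s: "tensor_ideal K R R +>\<^bsub>P\<^esub> F I \<in> c (tensor_nbhd K R R I' I')"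
      using self[OF I(1)] component_mono[OF c I] by (rule subsetD[rotated])
    have z: "\<zero> \<in> I'" "pairs_mult R (F I) \<ominus> pairs_mult R (F I) = \<zero>"
      using zero_in_OI[OF I(2)] FR[OF I(1)] by (simp_all add: a_minus_def r_neg)
    have "pairs_mult R (F I') \<ominus> pairs_mult R (F I) \<in> I'"
      using iff[OF I(2) s FR[OF I(1)]] ideal.coset_mem_iff[OF OI_ideal[OF I(2)] FR[OF I(1)] FR[OF I(1)]]
      unfolding tensor_mult_coset[OF F(1)[OF I(1)]] using z by simp
    moreover have "\<ominus> (pairs_mult R (F I') \<ominus> pairs_mult R (F I)) = pairs_mult R (F I) \<ominus> pairs_mult R (F I')"
      using FR[OF I(1)] FR[OF I(2)] by algebra
    ultimately show "pairs_mult R (F I) \<ominus> pairs_mult R (F I') \<in> I'"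
      using additive_subgroup.a_inv_closed[OF ideal.axioms(1)[OF OI_ideal[OF I(2)]]] by metis
  qed
  then obtain r where r: "r \<in> carrier R" "\<And>I. I \<in> OI \<Longrightarrow> pairs_mult R (F I) \<ominus> r \<in> I" by blast
  show ?thesis
  proof (intro ex1I conjI)
    show "r \<in> carrier R" by (rule r(1))
    show "\<forall>I\<in>OI. \<forall>t\<in>c (tensor_nbhd K R R I I). tensor_mult R t \<in> I +> r"
      using iff[OF _ _ r(1)] r(2) by blast
    fix s assume s: "s \<in> carrier R \<and>
      (\<forall>I\<in>OI. \<forall>t\<in>c (tensor_nbhd K R R I I). tensor_mult R t \<in> I +> s)"
    then have sR: "s \<in> carrier R" by simp
    have "s \<ominus> r = \<zero>"
    proof (rule separated)
      show "s \<ominus> r \<in> carrier R" using sR r(1) by simp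
      fix I assume I: "I \<in> OI"
      have "tensor_mult R (tensor_ideal K R R +>\<^bsub>P\<^esub> F I) \<in> I +> s"
        using s self[OF I] I by blast
      then have "pairs_mult R (F I) \<ominus> s \<in> I"
        using iff[OF I self[OF I] sR] by simp
      then show "s \<ominus> r \<in> I"
        by (rule cosets_meet[OF OI_ideal[OF I] sR r(1) FR[OF I] _ r(2)[OF I]])
    qed
    then show "s = r" by (rule minus_eq_zeroD[OF sR r(1)])
  qed
qed

lemma diagonal_map_eqI:
  assumes "c \<in> carrier CT" "r \<in> carrier R"
    and "\<And>I t. I \<in> OI \<Longrightarrow> t \<in> c (tensor_nbhd K R R I I) \<Longrightarrow> tensor_mult R t \<in> I +> r"
  shows "diagonal_map K R T c = r"
  unfolding diagonal_map_def by (rule the1_equality[OF diagonal_map_ex1]) (use assms in auto)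

lemma diagonal_mapD:
  assumes c: "c \<in> carrier CT" "diagonal_map K R T c = \<zero>" and I: "I \<in> OI"
    and f: "f \<in> carrier P" "c (tensor_nbhd K R R I I) = proj I f"
  shows "pairs_mult R f \<in> I"
proof -
  have all: "\<forall>I\<in>OI. \<forall>t\<in>c (tensor_nbhd K R R I I). tensor_mult R t \<in> I +> \<zero>"
    using theI'[OF diagonal_map_ex1[OF c(1)]] c(2) unfolding diagonal_map_def by simp
  have "tensor_ideal K R R +>\<^bsub>P\<^esub> f \<in> c (tensor_nbhd K R R I I)"
    unfolding f(2) proj_def
    by (rule ideal.coset_self[OF nbhd_ideal[OF OI_ideal[OF I]] coset_closed[OF f(1)]])
  then have "tensor_mult R (tensor_ideal K R R +>\<^bsub>P\<^esub> f) \<in> I +> \<zero>" using all I by blast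
  then have "pairs_mult R f \<ominus> \<zero> \<in> I"
    unfolding tensor_mult_coset[OF f(1)]
    by (rule iffD1[OF ideal.coset_mem_iff[OF OI_ideal[OF I] zero_closed pairs_mult_closed[OF f(1)]]])
  then show ?thesis using pairs_mult_closed[OF f(1)] by (simp add: a_minus_def)
qed

text \<open>Every component is represented by the same 1 \<otimes> a - a \<otimes> 1, whose product
  is exactly zero and hence zero modulo every open ideal.\<close>

lemma diag_elem_in_diagonal:
  assumes a: "a \<in> carrier R"
  shows "(\<lambda>N\<in>nbhds. N +>\<^bsub>Q\<^esub> (tensor_ideal K R R +>\<^bsub>P\<^esub> diag_elem a)) \<in> diagonal_ideal K R T"
proof -
  define x where "x = tensor_ideal K R R +>\<^bsub>P\<^esub> diag_elem a"
  define c where "c = (\<lambda>N\<in>nbhds. N +>\<^bsub>Q\<^esub> x)"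
  have xQ: "x \<in> carrier Q" unfolding x_def by (rule coset_closed[OF diag_elem_closed[OF a]])
  have c: "c \<in> carrier CT"
    unfolding completed_tensor_ring_eq limit_ring_def partial_object.simps
  proof (intro CollectI conjI ballI impI)
    show "c \<in> (\<Pi>\<^sub>E N\<in>nbhds. carrier (Q Quot N))"
    proof (rule PiE_I)
      fix N assume N: "N \<in> nbhds"
      show "c N \<in> carrier (Q Quot N)"
        using N xQ by (auto simp: c_def FactRing_def A_RCOSETS_def')
    qed (simp add: c_def)
    fix N N' assume "N \<in> nbhds" "N' \<in> nbhds" "N \<subseteq> N'"
    then show "c N \<subseteq> c N'" unfolding c_def by (auto simp: a_r_coset_def')
  qed
  have "diagonal_map K R T c = \<zero>"
  proof (rule diagonal_map_eqI[OF c zero_closed])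
    fix I t assume I: "I \<in> OI" and "t \<in> c (tensor_nbhd K R R I I)"
    then have t: "t \<in> proj I (diag_elem a)"
      using nbhds_mem[OF I] by (simp add: c_def x_def proj_def)
    note ct = component_tensor_mult[OF I diag_elem_closed[OF a] t]
    show "tensor_mult R t \<in> I +> \<zero>"
      using ideal.coset_mem_iff[OF OI_ideal[OF I] zero_closed ct(1)] ct(2)
      unfolding pairs_mult_diag_elem[OF a] by (rule iffD2)
  qed
  then show ?thesis
    using c unfolding diagonal_ideal_def a_kernel_def' c_def x_def by simp
qed

text \<open>\<open>D\<close> represents the component at \<open>I\<close> of a generator of the
  diagonal ideal. Its product is in \<open>I\<close> because the generator itself lies on the
  diagonal; the factors \<open>U\<close> are components of the factors by which the constant
  families of \<open>diag_elem a\<close> are multiples of the generator.\<close>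

lemma diagonal_generator:
  assumes gen: "generated_by_regular CT (diagonal_ideal K R T)" and I: "I \<in> OI"
  shows "\<exists>D\<in>carrier P. pairs_mult R D \<in> I \<and>
    (\<forall>a\<in>carrier R. \<exists>U\<in>carrier P. diag_elem a - U \<otimes>\<^bsub>P\<^esub> D \<in> diag_ideal I)"
proof -
  let ?N = "tensor_nbhd K R R I I"
  have NI: "?N \<in> nbhds" by (rule nbhds_mem[OF I])
  obtain d where d: "d \<in> carrier CT" "diagonal_ideal K R T = PIdl\<^bsub>CT\<^esub> d"
    using gen unfolding generated_by_regular_def regular_element_def by blast
  have dE: "d \<in> (\<Pi>\<^sub>E N\<in>nbhds. carrier (Q Quot N))"
    using d(1) by (simp add: completed_tensor_ring_eq limit_ring_def)
  \<comment> \<open>The principal ideal consists of the multiples of \<open>d\<close>, so that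
    \<open>d\<close> belongs to it requires the unit and its law. Both are checked componentwise in
    the limit.\<close>
  have one: "\<one>\<^bsub>CT\<^esub> \<in> carrier CT"
    unfolding completed_tensor_ring_eq limit_ring_def partial_object.simps monoid.simps
  proof (intro CollectI conjI ballI impI)
    show "(\<lambda>N\<in>nbhds. \<one>\<^bsub>Q Quot N\<^esub>) \<in> (\<Pi>\<^sub>E N\<in>nbhds. carrier (Q Quot N))"
    proof (rule PiE_I)
      fix N assume N: "N \<in> nbhds"
      interpret QN: ring "Q Quot N" by (rule ideal.quotient_is_ring[OF nbhds_ideal[OF N]])
      show "(\<lambda>N\<in>nbhds. \<one>\<^bsub>Q Quot N\<^esub>) N \<in> carrier (Q Quot N)"
        unfolding restrict_apply'[OF N] by (rule QN.one_closed)
    qed simp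
    fix N N' assume "N \<in> nbhds" "N' \<in> nbhds" "N \<subseteq> N'"
    then show "(\<lambda>N\<in>nbhds. \<one>\<^bsub>Q Quot N\<^esub>) N \<subseteq> (\<lambda>N\<in>nbhds. \<one>\<^bsub>Q Quot N\<^esub>) N'"
      by (auto simp: FactRing_def a_r_coset_def')
  qed
  have "\<one>\<^bsub>CT\<^esub> \<otimes>\<^bsub>CT\<^esub> d = d"
  proof
    fix N
    show "(\<one>\<^bsub>CT\<^esub> \<otimes>\<^bsub>CT\<^esub> d) N = d N"
    proof (cases "N \<in> nbhds")
      case True
      interpret QN: ring "Q Quot N" by (rule ideal.quotient_is_ring[OF nbhds_ideal[OF True]])
      show ?thesis
        using True QN.l_one[OF PiE_mem[OF dE True]]
        by (simp add: completed_tensor_ring_eq limit_ring_def)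
    next
      case False
      then show ?thesis using PiE_arb[OF dE False]
        by (simp add: completed_tensor_ring_eq limit_ring_def)
    qed
  qed
  then have "d \<in> diagonal_ideal K R T"
    unfolding d(2) cgenideal_def using one by (intro CollectI exI[of _ "\<one>\<^bsub>CT\<^esub>"]) simp
  then have d0: "diagonal_map K R T d = \<zero>"
    unfolding diagonal_ideal_def a_kernel_def' by simp
  obtain D where D: "D \<in> carrier P" "d ?N = proj I D" using component[OF d(1) I] by blast
  have "\<exists>U\<in>carrier P. diag_elem a - U \<otimes>\<^bsub>P\<^esub> D \<in> diag_ideal I" if a: "a \<in> carrier R" for a
  proof -
    let ?c = "\<lambda>N\<in>nbhds. N +>\<^bsub>Q\<^esub> (tensor_ideal K R R +>\<^bsub>P\<^esub> diag_elem a)"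
    have "?c \<in> PIdl\<^bsub>CT\<^esub> d" using diag_elem_in_diagonal[OF a] d(2) by simp
    then obtain x where x: "x \<in> carrier CT" "?c = x \<otimes>\<^bsub>CT\<^esub> d" unfolding cgenideal_def by blast
    obtain U where U: "U \<in> carrier P" "x ?N = proj I U" using component[OF x(1) I] by blast
    have "?c ?N = proj I (diag_elem a)"
      unfolding restrict_apply'[OF NI] proj_def ..
    moreover have "(x \<otimes>\<^bsub>CT\<^esub> d) ?N = x ?N \<otimes>\<^bsub>Q Quot ?N\<^esub> d ?N"
      using NI by (simp add: completed_tensor_ring_eq limit_ring_def)
    ultimately have "proj I (diag_elem a) = proj I (U \<otimes>\<^bsub>P\<^esub> D)"
      unfolding proj_mult[OF OI_ideal[OF I] U(1) D(1)] U(2)[symmetric] D(2)[symmetric]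
      using fun_cong[OF x(2), of ?N] by simp
    then have "diag_elem a - U \<otimes>\<^bsub>P\<^esub> D \<in> diag_ideal I"
      by (rule proj_eq_diag[OF OI_ideal[OF I] diag_elem_closed[OF a] tp.pairs_times_closed[OF U(1) D(1)]])
    then show ?thesis using U(1) by blast
  qed
  then show ?thesis using D(1) diagonal_mapD[OF d(1) d0 I D] by blast
qed

end


section \<open>Dual bases of cyclic projective modules\<close>


definition free_basis :: "('a, 'm) ring_scheme \<Rightarrow> 'i set \<Rightarrow> 'i \<Rightarrow> 'i \<Rightarrow> 'a"
  where "free_basis K I s = (\<lambda>i\<in>I. if i = s then \<one>\<^bsub>K\<^esub> else \<zero>\<^bsub>K\<^esub>)"

lemma free_module_simps:
  "f \<in> carrier (free_module K I) \<longleftrightarrow> f \<in> I \<rightarrow>\<^sub>E carrier K \<and> finite {i \<in> I. f i \<noteq> \<zero>\<^bsub>K\<^esub>}"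
  "f \<oplus>\<^bsub>free_module K I\<^esub> g = (\<lambda>i\<in>I. f i \<oplus>\<^bsub>K\<^esub> g i)"
  "c \<odot>\<^bsub>free_module K I\<^esub> f = (\<lambda>i\<in>I. c \<otimes>\<^bsub>K\<^esub> f i)"
  "\<zero>\<^bsub>free_module K I\<^esub> = (\<lambda>i\<in>I. \<zero>\<^bsub>K\<^esub>)"
  by (simp_all add: free_module_def)

context cring
begin

lemma free_zero_closed: "\<zero>\<^bsub>free_module R I\<^esub> \<in> carrier (free_module R I)"
  by (auto simp: free_module_simps)

lemma free_basis_closed: "s \<in> I \<Longrightarrow> free_basis R I s \<in> carrier (free_module R I)"
  by (auto simp: free_module_simps free_basis_def intro: finite_subset[of _ "{s}"])

lemma free_smult_closed:
  assumes "c \<in> carrier R" "f \<in> carrier (free_module R I)"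
  shows "c \<odot>\<^bsub>free_module R I\<^esub> f \<in> carrier (free_module R I)"
proof -
  have "{i \<in> I. (c \<odot>\<^bsub>free_module R I\<^esub> f) i \<noteq> \<zero>} \<subseteq> {i \<in> I. f i \<noteq> \<zero>}"
    using assms by (auto simp: free_module_simps)
  then have "finite {i \<in> I. (c \<odot>\<^bsub>free_module R I\<^esub> f) i \<noteq> \<zero>}"
    by (rule finite_subset) (use assms in \<open>simp add: free_module_simps\<close>)
  moreover have "c \<odot>\<^bsub>free_module R I\<^esub> f \<in> I \<rightarrow>\<^sub>E carrier R"
    using assms by (auto simp: free_module_simps)
  ultimately show ?thesis by (simp only: free_module_simps(1) simp_thms)
qed

text \<open>The steps add only basis vectors from the support of the given \<open>f\<close>, so what
  is known about that support remains available throughout the induction.\<close>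

lemma free_module_induct [consumes 1, case_names zero step]:
  assumes f: "f \<in> carrier (free_module R I)"
    and zero: "Q \<zero>\<^bsub>free_module R I\<^esub>"
    and step: "\<And>g c s. g \<in> carrier (free_module R I) \<Longrightarrow> c \<in> carrier R \<Longrightarrow> s \<in> I \<Longrightarrow> f s \<noteq> \<zero> \<Longrightarrow>
      Q g \<Longrightarrow> Q (g \<oplus>\<^bsub>free_module R I\<^esub> c \<odot>\<^bsub>free_module R I\<^esub> free_basis R I s)"
  shows "Q f"
proof -
  have fI: "\<And>i. i \<in> I \<Longrightarrow> f i \<in> carrier R" "f \<in> extensional I" "finite {i \<in> I. f i \<noteq> \<zero>}"
    using f by (auto simp: free_module_simps PiE_iff)
  define r where "r S = (\<lambda>i\<in>I. if i \<in> S then f i else \<zero>)" for S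
  have rc: "r S \<in> carrier (free_module R I)" if "finite S" for S
    using fI that by (auto simp: free_module_simps r_def intro: finite_subset[of _ S])
  have "Q (r S)" if "finite S" "S \<subseteq> {i \<in> I. f i \<noteq> \<zero>}" for S
    using that
  proof (induction S)
    case empty
    have "r {} = \<zero>\<^bsub>free_module R I\<^esub>" by (auto simp: r_def free_module_simps fun_eq_iff)
    then show ?case using zero by simp
  next
    case (insert s S)
    have "r (insert s S) = r S \<oplus>\<^bsub>free_module R I\<^esub> f s \<odot>\<^bsub>free_module R I\<^esub> free_basis R I s"
      using insert fI by (auto simp: r_def free_module_simps free_basis_def fun_eq_iff)
    then show ?case
      using step[of "r S" "f s" s] insert rc fI(1) by auto
  qed
  moreover have "r {i \<in> I. f i \<noteq> \<zero>} = f"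
    using fI(2) by (auto simp: r_def fun_eq_iff extensional_def)
  ultimately show ?thesis using fI(3) by (metis order_refl)
qed

end

section \<open>Coordinates on the quotient R/J\<close>

context tensor_square
begin

lemma module_hom_zero:
  assumes "g \<in> module_hom K R R"
  shows "g \<zero> = \<zero>"
proof -
  have "g (\<zero>\<^bsub>K\<^esub> \<odot>\<^bsub>R\<^esub> \<zero>) = \<zero>\<^bsub>K\<^esub> \<odot>\<^bsub>R\<^esub> g \<zero>"
    by (rule module_homD(3)[OF assms A.R.zero_closed zero_closed])
  then show ?thesis using module_homD(1)[OF assms zero_closed] by simp
qed

lemma module_hom_finsum:
  assumes g: "g \<in> module_hom K R R" and f: "f \<in> S \<rightarrow> carrier R"
  shows "g (\<Oplus>i\<in>S. f i) = (\<Oplus>i\<in>S. g (f i))"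
  using f
proof (induction S rule: infinite_finite_induct)
  case (insert x S)
  then have "f \<in> S \<rightarrow> carrier R" "f x \<in> carrier R" "(\<lambda>i. g (f i)) \<in> S \<rightarrow> carrier R" "g (f x) \<in> carrier R"
    using module_homD(1)[OF g] by auto
  then show ?case
    using insert by (simp add: finsum_insert module_homD(2)[OF g])
qed (simp_all add: finsum_infinite module_hom_zero[OF g])

context
  fixes J assumes J: "ideal J R"
begin

interpretation J: ideal J R by (rule J)

abbreviation "M \<equiv> quot_algebra R J"

lemma quot_carrier: "X \<in> carrier M \<longleftrightarrow> (\<exists>x\<in>carrier R. X = J +> x)"
  by (auto simp: quot_algebra_def FactRing_def A_RCOSETS_def')

lemma quot_add:
  assumes "x \<in> carrier R" "y \<in> carrier R"
  shows "(J +> x) \<oplus>\<^bsub>M\<^esub> (J +> y) = J +> (x \<oplus> y)"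
  using J.a_rcos_sum[OF assms] by (simp add: quot_algebra_def FactRing_def)

lemma ideal_smult_closed:
  assumes "k \<in> carrier K" "x \<in> J"
  shows "k \<odot>\<^bsub>R\<^esub> x \<in> J"
proof -
  have "k \<odot>\<^bsub>R\<^esub> x = (k \<odot>\<^bsub>R\<^esub> \<one>) \<otimes> x"
    using assms J.Icarr by (simp add: A.smult_assoc2)
  then show ?thesis using J.I_l_closed[OF assms(2), of "k \<odot>\<^bsub>R\<^esub> \<one>"] assms(1) by simp
qed

lemma quot_smult:
  assumes k: "k \<in> carrier K" and x: "x \<in> carrier R"
  shows "k \<odot>\<^bsub>M\<^esub> (J +> x) = J +> (k \<odot>\<^bsub>R\<^esub> x)"
proof -
  have "J +> (k \<odot>\<^bsub>R\<^esub> z) = J +> (k \<odot>\<^bsub>R\<^esub> x)" if z: "z \<in> J +> x" for z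
  proof -
    have zR: "z \<in> carrier R" by (rule J.a_elemrcos_carrier[OF x z])
    have "z \<ominus> x \<in> J" using z J.coset_mem_iff[OF x zR] by simp
    then have "k \<odot>\<^bsub>R\<^esub> (z \<ominus> x) \<in> J" by (rule ideal_smult_closed[OF k])
    moreover have "k \<odot>\<^bsub>R\<^esub> (z \<ominus> x) = k \<odot>\<^bsub>R\<^esub> z \<ominus> k \<odot>\<^bsub>R\<^esub> x"
      using k zR x by (simp add: a_minus_def A.smult_r_distr A.smult_r_minus)
    ultimately show ?thesis
      using J.coset_eq_iff[of "k \<odot>\<^bsub>R\<^esub> z" "k \<odot>\<^bsub>R\<^esub> x"] k zR x by simp
  qed
  then have "(\<Union>z\<in>J +> x. J +> (k \<odot>\<^bsub>R\<^esub> z)) = J +> (k \<odot>\<^bsub>R\<^esub> x)"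
    by (intro UN_constant_eq[OF J.coset_self[OF x]] ballI)
  then show ?thesis by (simp add: quot_algebra_def)
qed

text \<open>The index set \<open>I\<close> may be infinite. The images of the finitely many
  generators have finite supports, and sums and multiples create no support outside their
  union.\<close>

lemma fg_projective_support:
  assumes h: "h \<in> module_hom K (free_module K {..<n::nat}) M"
      "h ` carrier (free_module K {..<n}) = carrier M"
    and i: "i \<in> module_hom K M (free_module K I)"
  shows "\<exists>S. finite S \<and> S \<subseteq> I \<and> (\<forall>X\<in>carrier M. \<forall>s\<in>I. i X s \<noteq> \<zero>\<^bsub>K\<^esub> \<longrightarrow> s \<in> S)"
proof -
  define supp where "supp f = {s \<in> I. f s \<noteq> \<zero>\<^bsub>K\<^esub>}" for f
  define S where "S = (\<Union>b<n. supp (i (h (free_basis K {..<n} b))))"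
  let ?F = "free_module K {..<n}"
  have hF: "h f \<in> carrier M" if "f \<in> carrier ?F" for f using module_homD(1)[OF h(1) that] .
  have iF: "i X \<in> carrier (free_module K I)" if "X \<in> carrier M" for X using module_homD(1)[OF i that] .
  have iK: "i X s \<in> carrier K" if "X \<in> carrier M" "s \<in> I" for X s
    using iF[OF that(1)] that(2) by (auto simp: free_module_simps)
  have bF: "free_basis K {..<n} b \<in> carrier ?F" if "b < n" for b
    using that by (intro A.R.free_basis_closed) simp
  have "finite S"
    using iF[OF hF[OF bF]] by (auto simp: S_def supp_def free_module_simps)
  have "supp (i (h f)) \<subseteq> S" if f: "f \<in> carrier ?F" for f
    using f
  proof (induction f rule: A.R.free_module_induct)
    case zero
    let ?z = "\<zero>\<^bsub>?F\<^esub>"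
    have z: "?z \<in> carrier ?F" by (rule A.R.free_zero_closed)
    \<comment> \<open>\<open>module_hom\<close> speaks of sums and multiples only, so the zero
      vector is written as zero times itself and homogeneity is applied.\<close>
    have "i (h (\<zero>\<^bsub>K\<^esub> \<odot>\<^bsub>?F\<^esub> ?z)) = \<zero>\<^bsub>K\<^esub> \<odot>\<^bsub>free_module K I\<^esub> i (h ?z)"
      using module_homD(3)[OF h(1) A.R.zero_closed z] module_homD(3)[OF i A.R.zero_closed hF[OF z]] by simp
    moreover have "\<zero>\<^bsub>K\<^esub> \<odot>\<^bsub>?F\<^esub> ?z = ?z" by (simp add: free_module_simps restrict_def fun_eq_iff)
    ultimately have eq: "i (h ?z) = \<zero>\<^bsub>K\<^esub> \<odot>\<^bsub>free_module K I\<^esub> i (h ?z)" by simp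
    have "i (h ?z) s = \<zero>\<^bsub>K\<^esub>" if s: "s \<in> I" for s
    proof -
      have "i (h ?z) s = (\<zero>\<^bsub>K\<^esub> \<odot>\<^bsub>free_module K I\<^esub> i (h ?z)) s" using eq by (rule fun_cong)
      also have "\<dots> = \<zero>\<^bsub>K\<^esub>" using s iK[OF hF[OF z] s] by (simp add: free_module_simps(3))
      finally show ?thesis .
    qed
    then show ?case by (auto simp: supp_def)
  next
    case (step g c b)
    have b: "b < n" using step.hyps by simp
    let ?B = "free_basis K {..<n} b"
    have cB: "c \<odot>\<^bsub>?F\<^esub> ?B \<in> carrier ?F" by (rule A.R.free_smult_closed[OF step.hyps(2) bF[OF b]])
    have "i (h (g \<oplus>\<^bsub>?F\<^esub> c \<odot>\<^bsub>?F\<^esub> ?B)) =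
        i (h g) \<oplus>\<^bsub>free_module K I\<^esub> c \<odot>\<^bsub>free_module K I\<^esub> i (h ?B)"
      unfolding module_homD(2)[OF h(1) step.hyps(1) cB]
      unfolding module_homD(2)[OF i hF[OF step.hyps(1)] hF[OF cB]]
      unfolding module_homD(3)[OF h(1) step.hyps(2) bF[OF b]]
      unfolding module_homD(3)[OF i step.hyps(2) hF[OF bF[OF b]]] ..
    then have "i (h (g \<oplus>\<^bsub>?F\<^esub> c \<odot>\<^bsub>?F\<^esub> ?B)) s = i (h g) s \<oplus>\<^bsub>K\<^esub> c \<otimes>\<^bsub>K\<^esub> i (h ?B) s" if "s \<in> I" for s
      using that by (simp only: free_module_simps(2,3) restrict_apply')
    then have "supp (i (h (g \<oplus>\<^bsub>?F\<^esub> c \<odot>\<^bsub>?F\<^esub> ?B))) \<subseteq> supp (i (h g)) \<union> supp (i (h ?B))"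
      using step.hyps(2) unfolding supp_def by (auto simp del: free_module_simps)
    then show ?case using step.IH b by (auto simp: S_def)
  qed
  then have "supp (i X) \<subseteq> S" if X: "X \<in> carrier M" for X
    using X unfolding h(2)[symmetric] by (elim imageE) (simp only:)
  moreover have "S \<subseteq> I" by (auto simp: S_def supp_def)
  ultimately show ?thesis
    using \<open>finite S\<close> by (intro exI[of _ S]) (auto simp: supp_def)
qed

text \<open>A linear map on a free module is determined by its values on the basis. The sum runs
  over a fixed finite \<open>S\<close> containing the support, which makes the number of coordinates
  independent of \<open>f\<close>.\<close>

lemma free_hom_expansion:
  assumes p: "p \<in> module_hom K (free_module K I) M"
    and a: "\<And>s. s \<in> S \<Longrightarrow> a s \<in> carrier R" "\<And>s. s \<in> S \<Longrightarrow> p (free_basis K I s) = J +> a s"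
    and S: "finite S" "S \<subseteq> I"
    and f: "f \<in> carrier (free_module K I)" "\<And>s. s \<in> I \<Longrightarrow> f s \<noteq> \<zero>\<^bsub>K\<^esub> \<Longrightarrow> s \<in> S"
  shows "p f = J +> (\<Oplus>s\<in>S. f s \<odot>\<^bsub>R\<^esub> a s)"
  using f(1)
proof (induction f rule: A.R.free_module_induct)
  case zero
  let ?z = "\<zero>\<^bsub>free_module K I\<^esub>"
  have z: "?z \<in> carrier (free_module K I)" by (rule A.R.free_zero_closed)
  obtain x where x: "x \<in> carrier R" "p ?z = J +> x"
    using module_homD(1)[OF p z] quot_carrier by blast
  have "\<zero>\<^bsub>K\<^esub> \<odot>\<^bsub>free_module K I\<^esub> ?z = ?z" by (simp add: free_module_simps restrict_def fun_eq_iff)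
  then have "p ?z = \<zero>\<^bsub>K\<^esub> \<odot>\<^bsub>M\<^esub> (J +> x)"
    using module_homD(3)[OF p A.R.zero_closed z] x(2) by simp
  also have "\<dots> = J +> \<zero>" using quot_smult[OF A.R.zero_closed x(1)] x(1) by simp
  finally have pz: "p ?z = J +> \<zero>" .
  have "(\<Oplus>s\<in>S. ?z s \<odot>\<^bsub>R\<^esub> a s) = (\<Oplus>s\<in>S. \<zero>)"
    by (rule finsum_cong') (use a(1) S in \<open>auto simp: free_module_simps\<close>)
  then show ?case using pz by (simp add: finsum_zero)
next
  case (step g c t)
  let ?F = "free_module K I"
  have t: "t \<in> S" by (rule f(2)[OF step.hyps(3,4)])
  have bF: "free_basis K I t \<in> carrier ?F" by (rule A.R.free_basis_closed[OF step.hyps(3)])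
  have cB: "c \<odot>\<^bsub>?F\<^esub> free_basis K I t \<in> carrier ?F"
    by (rule A.R.free_smult_closed[OF step.hyps(2) bF])
  have gK: "g s \<in> carrier K" if "s \<in> S" for s
    using step.hyps(1) that S(2) by (auto simp: free_module_simps)
  have gR: "(\<lambda>s. g s \<odot>\<^bsub>R\<^esub> a s) \<in> S \<rightarrow> carrier R" using gK a(1) by auto
  have ct: "c \<odot>\<^bsub>R\<^esub> a t \<in> carrier R" using step.hyps(2) a(1)[OF t] by simp
  have "p (g \<oplus>\<^bsub>?F\<^esub> c \<odot>\<^bsub>?F\<^esub> free_basis K I t) = J +> ((\<Oplus>s\<in>S. g s \<odot>\<^bsub>R\<^esub> a s) \<oplus> c \<odot>\<^bsub>R\<^esub> a t)"
    unfolding module_homD(2)[OF p step.hyps(1) cB] module_homD(3)[OF p step.hyps(2) bF] step.IH a(2)[OF t]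
      quot_smult[OF step.hyps(2) a(1)[OF t]] by (rule quot_add[OF finsum_closed[OF gR] ct])
  also have "c \<odot>\<^bsub>R\<^esub> a t = (\<Oplus>s\<in>S. if t = s then c \<odot>\<^bsub>R\<^esub> a s else \<zero>)"
    by (rule finsum_singleton[OF t S(1), symmetric]) (use step.hyps(2) a(1) in auto)
  also have "(\<Oplus>s\<in>S. g s \<odot>\<^bsub>R\<^esub> a s) \<oplus> \<dots> =
      (\<Oplus>s\<in>S. g s \<odot>\<^bsub>R\<^esub> a s \<oplus> (if t = s then c \<odot>\<^bsub>R\<^esub> a s else \<zero>))"
    by (rule finsum_addf[symmetric]) (use gR step.hyps(2) a(1) in auto)
  also have "\<dots> = (\<Oplus>s\<in>S. (g \<oplus>\<^bsub>?F\<^esub> c \<odot>\<^bsub>?F\<^esub> free_basis K I t) s \<odot>\<^bsub>R\<^esub> a s)"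
    by (rule finsum_cong')
      (use gK step.hyps(2) a(1) S(2) in \<open>auto simp: free_module_simps(2,3) free_basis_def A.smult_l_distr subset_iff\<close>)
  finally show ?case .
qed

text \<open>The dual basis lemma for R/J, pulled back to \<open>R\<close>. The functionals take
  values in \<open>R\<close> instead of \<open>K\<close>, so that matrices over \<open>R\<close> can
  be formed from them; the second clause records that these values still behave like
  scalars.\<close>

lemma dual_basis:
  assumes fg: "fg_module K M" and proj: "projective_module K M"
  shows "\<exists>(n::nat) a \<psi>. (\<forall>s<n. a s \<in> carrier R \<and> \<psi> s \<in> module_hom K R R \<and> (\<forall>j\<in>J. \<psi> s j = \<zero>)) \<and>
    (\<forall>s<n. \<forall>t<n. \<forall>x\<in>carrier R. \<forall>y\<in>carrier R. \<psi> s (\<psi> t x \<otimes> y) = \<psi> t x \<otimes> \<psi> s y) \<and>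
    (\<forall>x\<in>carrier R. x \<ominus> (\<Oplus>s\<in>{..<n}. \<psi> s x \<otimes> a s) \<in> J)"
proof -
  obtain n h where nh: "h \<in> module_hom K (free_module K {..<n::nat}) M \<and>
      h ` carrier (free_module K {..<n}) = carrier M"
    using conjunct2[OF fg[unfolded fg_module_def]] by (elim exE) (rule that)
  note h = conjunct1[OF nh] conjunct2[OF nh]
  obtain I :: "'b set set" and i p where ip: "i \<in> module_hom K M (free_module K I) \<and>
      p \<in> module_hom K (free_module K I) M \<and> (\<forall>X\<in>carrier M. p (i X) = X)"
    using conjunct2[OF proj[unfolded projective_module_def]] by (elim exE) (rule that)
  note i = conjunct1[OF ip] and p = conjunct1[OF conjunct2[OF ip]]
    and pi = bspec[OF conjunct2[OF conjunct2[OF ip]]]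
  obtain S where S: "finite S" "S \<subseteq> I" "\<And>X s. X \<in> carrier M \<Longrightarrow> s \<in> I \<Longrightarrow> i X s \<noteq> \<zero>\<^bsub>K\<^esub> \<Longrightarrow> s \<in> S"
    using fg_projective_support[OF h i] by blast
  have "\<exists>a. a \<in> carrier R \<and> p (free_basis K I s) = J +> a" if "s \<in> S" for s
    using module_homD(1)[OF p A.R.free_basis_closed[of s I]] that S(2) quot_carrier by blast
  then obtain a where a: "\<And>s. s \<in> S \<Longrightarrow> a s \<in> carrier R" "\<And>s. s \<in> S \<Longrightarrow> p (free_basis K I s) = J +> a s"
    by metis
  define c where "c s x = i (J +> x) s" for s x
  have JM: "J +> x \<in> carrier M" if "x \<in> carrier R" for x using that quot_carrier by blast
  have cK: "c s x \<in> carrier K" if "s \<in> S" "x \<in> carrier R" for s x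
    using module_homD(1)[OF i JM[OF that(2)]] that(1) S(2) by (auto simp: c_def free_module_simps)
  have c_add: "c s (x \<oplus> y) = c s x \<oplus>\<^bsub>K\<^esub> c s y" if "s \<in> S" "x \<in> carrier R" "y \<in> carrier R" for s x y
    using module_homD(2)[OF i JM[OF that(2)] JM[OF that(3)]] that(1) S(2)
    unfolding quot_add[OF that(2,3)] by (auto simp: c_def free_module_simps)
  have c_smult: "c s (k \<odot>\<^bsub>R\<^esub> x) = k \<otimes>\<^bsub>K\<^esub> c s x" if "s \<in> S" "k \<in> carrier K" "x \<in> carrier R" for s k x
    using module_homD(3)[OF i that(2) JM[OF that(3)]] that(1) S(2)
    unfolding quot_smult[OF that(2,3)] by (auto simp: c_def free_module_simps)
  \<comment> \<open>The coordinate in \<open>K\<close> is carried into \<open>R\<close> along the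
    structure map of the algebra.\<close>
  define \<psi> where "\<psi> s x = c s x \<odot>\<^bsub>R\<^esub> \<one>" for s x
  have \<psi>_hom: "\<psi> s \<in> module_hom K R R" if s: "s \<in> S" for s
    unfolding module_hom_def \<psi>_def
    by (intro CollectI conjI ballI funcsetI)
      (simp_all add: cK[OF s] c_add[OF s] c_smult[OF s] A.smult_l_distr A.smult_assoc1)
  have \<psi>_kill: "\<psi> s j = \<zero>" if s: "s \<in> S" and j: "j \<in> J" for s j
  proof -
    have "J +> j = J +> \<zero>"
      using J.coset_eq_iff[OF J.Icarr[OF j] zero_closed] J.Icarr[OF j] j by (simp add: a_minus_def)
    then have "\<psi> s j = \<psi> s \<zero>" by (simp add: \<psi>_def c_def)
    then show ?thesis using module_hom_zero[OF \<psi>_hom[OF s]] by simp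
  qed
  have \<psi>_lin: "\<psi> s (\<psi> t x \<otimes> y) = \<psi> t x \<otimes> \<psi> s y"
    if "s \<in> S" "t \<in> S" "x \<in> carrier R" "y \<in> carrier R" for s t x y
  proof -
    have e: "\<psi> t x \<otimes> z = c t x \<odot>\<^bsub>R\<^esub> z" if z: "z \<in> carrier R" for z
      using A.smult_assoc2[OF cK[OF \<open>t \<in> S\<close> \<open>x \<in> carrier R\<close>] one_closed z] z by (simp add: \<psi>_def)
    show ?thesis
      unfolding e[OF that(4)] e[OF module_homD(1)[OF \<psi>_hom[OF that(1)] that(4)]]
      by (rule module_homD(3)[OF \<psi>_hom[OF that(1)] cK[OF that(2,3)] that(4)])
  qed
  have \<psi>_sum: "x \<ominus> (\<Oplus>s\<in>S. \<psi> s x \<otimes> a s) \<in> J" if x: "x \<in> carrier R" for x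
  proof -
    have sR: "(\<lambda>s. \<psi> s x \<otimes> a s) \<in> S \<rightarrow> carrier R"
      using module_homD(1)[OF \<psi>_hom x] a(1) by simp
    have "p (i (J +> x)) = J +> (\<Oplus>s\<in>S. i (J +> x) s \<odot>\<^bsub>R\<^esub> a s)"
      by (rule free_hom_expansion[OF p a S(1,2) module_homD(1)[OF i JM[OF x]] S(3)[OF JM[OF x]]])
    also have "(\<Oplus>s\<in>S. i (J +> x) s \<odot>\<^bsub>R\<^esub> a s) = (\<Oplus>s\<in>S. \<psi> s x \<otimes> a s)"
    proof (rule finsum_cong')
      show "(\<lambda>s. \<psi> s x \<otimes> a s) \<in> S \<rightarrow> carrier R" by (rule sR)
      show "i (J +> x) s \<odot>\<^bsub>R\<^esub> a s = \<psi> s x \<otimes> a s" if s: "s \<in> S" for s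
        using A.smult_assoc2[OF cK[OF s x] one_closed a(1)[OF s]] a(1)[OF s] by (simp add: \<psi>_def c_def)
    qed simp
    finally have "J +> x = J +> (\<Oplus>s\<in>S. \<psi> s x \<otimes> a s)" using pi[OF JM[OF x]] by simp
    then show ?thesis
      by (rule iffD1[OF J.coset_eq_iff[OF x finsum_closed[OF sR]]])
  qed
  \<comment> \<open>The finite support is numbered, since matrices are indexed by numbers.\<close>
  obtain e where e: "bij_betw e {0..<card S} S" using ex_bij_betw_nat_finite[OF S(1)] by blast
  have eS: "e k \<in> S" if "k < card S" for k using bij_betwE[OF e] that by simp
  have eR: "(\<Oplus>s\<in>{..<card S}. \<psi> (e s) x \<otimes> a (e s)) = (\<Oplus>s\<in>S. \<psi> s x \<otimes> a s)" if x: "x \<in> carrier R" for x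
  proof -
    have S': "S = e ` {..<card S}" "inj_on e {..<card S}"
      using e by (simp_all add: bij_betw_def lessThan_atLeast0)
    have "(\<Oplus>s\<in>S. \<psi> s x \<otimes> a s) = (\<Oplus>s\<in>e ` {..<card S}. \<psi> s x \<otimes> a s)"
      by (rule arg_cong[OF S'(1)])
    also have "\<dots> = (\<Oplus>s\<in>{..<card S}. \<psi> (e s) x \<otimes> a (e s))"
      by (rule finsum_reindex[OF _ S'(2)]) (use eS module_homD(1)[OF \<psi>_hom x] a(1) in auto)
    finally show ?thesis by (rule sym)
  qed
  show ?thesis
  proof (rule exI[of _ "card S"], rule exI[of _ "\<lambda>k. a (e k)"], rule exI[of _ "\<lambda>k. \<psi> (e k)"],
      intro conjI allI impI ballI)
    fix x assume x: "x \<in> carrier R"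
    show "x \<ominus> (\<Oplus>s\<in>{..<card S}. \<psi> (e s) x \<otimes> a (e s)) \<in> J"
      unfolding eR[OF x] by (rule \<psi>_sum[OF x])
  next
    fix s t x y assume st: "s < card S" "t < card S" and xy: "x \<in> carrier R" "y \<in> carrier R"
    show "\<psi> (e s) (\<psi> (e t) x \<otimes> y) = \<psi> (e t) x \<otimes> \<psi> (e s) y"
      by (rule \<psi>_lin[OF eS[OF st(1)] eS[OF st(2)] xy])
  next
    fix s assume s: "s < card S"
    show "a (e s) \<in> carrier R" by (rule a(1)[OF eS[OF s]])
    show "\<psi> (e s) \<in> module_hom K R R" by (rule \<psi>_hom[OF eS[OF s]])
    show "\<psi> (e s) j = \<zero>" if "j \<in> J" for j by (rule \<psi>_kill[OF eS[OF s] that])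
  qed
qed

end

end


section \<open>Principality of weak divisors\<close>


context tensor_square
begin

lemma pairs_mult_mult_of:
  assumes ab: "a \<in> carrier R" "b \<in> carrier R" and f: "f \<in> carrier P"
  shows "pairs_mult R (f \<otimes>\<^bsub>P\<^esub> frag_of (a, b)) = pairs_mult R f \<otimes> (a \<otimes> b)"
  using f
proof (induction f rule: tp.pairs_induct)
  case zero
  show ?case using ab by (simp add: pairs_mult_eq_tensor_eval tensor_eval_zero)
next
  case (of x y)
  have "(x \<otimes> a) \<otimes> (y \<otimes> b) = (x \<otimes> y) \<otimes> (a \<otimes> b)" using of ab by algebra
  then show ?case using of ab by (simp add: pairs_mult_of)
next
  case (diff f f')
  have abP: "frag_of (a, b) \<in> carrier P" using ab by simp
  have "(u \<ominus> v) \<otimes> w = u \<otimes> w \<ominus> v \<otimes> w" if "u \<in> carrier R" "v \<in> carrier R" "w \<in> carrier R" for u v w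
    using that by algebra
  then show ?case
    unfolding tp.pairs_times_diff_left pairs_mult_diff[OF diff.hyps]
      pairs_mult_diff[OF tp.pairs_times_closed[OF diff.hyps(1) abP] tp.pairs_times_closed[OF diff.hyps(2) abP]]
      diff.IH
    using pairs_mult_closed[OF diff.hyps(1)] pairs_mult_closed[OF diff.hyps(2)] ab by simp
qed

lemma finsum_minus:
  assumes "f \<in> A \<rightarrow> carrier R" "g \<in> A \<rightarrow> carrier R"
  shows "(\<Oplus>i\<in>A. f i \<ominus> g i) = (\<Oplus>i\<in>A. f i) \<ominus> (\<Oplus>i\<in>A. g i)"
proof -
  have m: "(\<lambda>i. f i \<ominus> g i) \<in> A \<rightarrow> carrier R" using assms by auto
  have "(\<Oplus>i\<in>A. f i \<ominus> g i) \<oplus> (\<Oplus>i\<in>A. g i) = (\<Oplus>i\<in>A. (f i \<ominus> g i) \<oplus> g i)"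
    by (rule finsum_addf[OF m assms(2), symmetric])
  also have "\<dots> = (\<Oplus>i\<in>A. f i)"
    by (rule finsum_cong') (use assms in \<open>auto simp: a_minus_def a_assoc l_neg Pi_iff\<close>)
  finally have e: "(\<Oplus>i\<in>A. f i \<ominus> g i) \<oplus> (\<Oplus>i\<in>A. g i) = (\<Oplus>i\<in>A. f i)" .
  have "u = v \<ominus> w" if "u \<oplus> w = v" "u \<in> carrier R" "w \<in> carrier R" for u v w
    using that by (auto simp: a_minus_def a_assoc r_neg)
  then show ?thesis using e finsum_closed[OF m] finsum_closed[OF assms(2)] by blast
qed

end

section \<open>Multiplication on R \<otimes> R/J in coordinates\<close>

locale cyclic_dual_basis = tensor_square K R + J: ideal J R
  for K :: "('a, 'k) ring_scheme" and R :: "('a, 'b, 'm) module_scheme" (structure) and J +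
  fixes n :: nat and a :: "nat \<Rightarrow> 'b" and \<psi> :: "nat \<Rightarrow> 'b \<Rightarrow> 'b"
  assumes a_closed: "\<And>s. s < n \<Longrightarrow> a s \<in> carrier R"
    and \<psi>_hom: "\<And>s. s < n \<Longrightarrow> \<psi> s \<in> module_hom K R R"
    and \<psi>_kill: "\<And>s j. s < n \<Longrightarrow> j \<in> J \<Longrightarrow> \<psi> s j = \<zero>"
    and \<psi>_lin: "\<And>s t x y. s < n \<Longrightarrow> t < n \<Longrightarrow> x \<in> carrier R \<Longrightarrow> y \<in> carrier R \<Longrightarrow>
      \<psi> s (\<psi> t x \<otimes> y) = \<psi> t x \<otimes> \<psi> s y"
    and dual: "\<And>x. x \<in> carrier R \<Longrightarrow> x \<ominus> (\<Oplus>s\<in>{..<n}. \<psi> s x \<otimes> a s) \<in> J"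
begin

text \<open>As \<open>\<psi> s\<close> kills \<open>J\<close>, this is the s-th coordinate on R
  \<otimes> R/J, linear over the left factor, pulled back to combinations of pairs.\<close>

abbreviation E :: "nat \<Rightarrow> ('b \<times> 'b \<Rightarrow>\<^sub>0 int) \<Rightarrow> 'b"
  where "E s \<equiv> tensor_eval R (\<psi> s)"

lemma \<psi>_closed: "s < n \<Longrightarrow> x \<in> carrier R \<Longrightarrow> \<psi> s x \<in> carrier R"
  by (rule module_homD(1)[OF \<psi>_hom])

lemma \<psi>_fun: "s < n \<Longrightarrow> \<psi> s \<in> carrier R \<rightarrow> carrier R"
  by (rule module_hom_funcset[OF \<psi>_hom])

lemma E_closed: "s < n \<Longrightarrow> f \<in> carrier P \<Longrightarrow> E s f \<in> carrier R"
  by (rule tensor_eval_closed[OF \<psi>_fun])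

lemma E_of: "s < n \<Longrightarrow> x \<in> carrier R \<Longrightarrow> y \<in> carrier R \<Longrightarrow> E s (frag_of (x, y)) = x \<otimes> \<psi> s y"
  by (rule tensor_eval_of[OF \<psi>_fun])

lemma E_diff: "s < n \<Longrightarrow> f \<in> carrier P \<Longrightarrow> g \<in> carrier P \<Longrightarrow> E s (f - g) = E s f \<ominus> E s g"
  by (rule tensor_eval_diff[OF \<psi>_fun])

lemma dual_sum_closed: "x \<in> carrier R \<Longrightarrow> (\<Oplus>s\<in>{..<n}. \<psi> s x \<otimes> a s) \<in> carrier R"
  by (rule finsum_closed) (auto simp: \<psi>_closed a_closed)

lemma \<psi>_cong:
  assumes s: "s < n" and xy: "x \<in> carrier R" "y \<in> carrier R" "x \<ominus> y \<in> J"
  shows "\<psi> s x = \<psi> s y"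
proof -
  have "x = (x \<ominus> y) \<oplus> y" using xy(1,2) by algebra
  then have "\<psi> s x = \<psi> s (x \<ominus> y) \<oplus> \<psi> s y"
    using module_homD(2)[OF \<psi>_hom[OF s], of "x \<ominus> y" y] xy(1,2) by simp
  then show ?thesis using \<psi>_kill[OF s xy(3)] \<psi>_closed[OF s xy(2)] by simp
qed

text \<open>
  Under the identification of \<open>R \<otimes> R/J\<close> with a summand of \<open>R\<^sup>n\<close>, multiplication by \<open>f\<close> has the matrix
  \<open>E s (f (1 \<otimes> a t))\<close>, and \<open>g\<close> has the coordinates \<open>E t g\<close>.
\<close>

lemma matrix_mult:
  assumes s: "s < n" and f: "f \<in> carrier P" and g: "g \<in> carrier P"
  shows "(\<Oplus>t\<in>{..<n}. E s (f \<otimes>\<^bsub>P\<^esub> frag_of (\<one>, a t)) \<otimes> E t g) = E s (f \<otimes>\<^bsub>P\<^esub> g)"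
proof -
  have oneP: "frag_of (\<one>, a t) \<in> carrier P" if "t < n" for t
    using a_closed[OF that] by simp
  have fa: "f \<otimes>\<^bsub>P\<^esub> frag_of (\<one>, a t) \<in> carrier P" if "f \<in> carrier P" "t < n" for f t
    by (rule tp.pairs_times_closed[OF that(1) oneP[OF that(2)]])
  \<comment> \<open>The case of two pairs. The scalar-like \<open>\<psi> t x'\<close> moves inside
    \<open>\<psi> s\<close>, where the dual basis sums up to x' modulo \<open>J\<close>, and
    \<open>\<psi> s\<close> does not see elements of \<open>J\<close>.\<close>
  have base: "(\<Oplus>t\<in>{..<n}. (r \<otimes> \<psi> s (x \<otimes> a t)) \<otimes> (r' \<otimes> \<psi> t x')) = (r \<otimes> r') \<otimes> \<psi> s (x \<otimes> x')"
    if c: "r \<in> carrier R" "x \<in> carrier R" "r' \<in> carrier R" "x' \<in> carrier R" for r x r' x'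
  proof -
    have "(\<Oplus>t\<in>{..<n}. (r \<otimes> \<psi> s (x \<otimes> a t)) \<otimes> (r' \<otimes> \<psi> t x')) =
        (\<Oplus>t\<in>{..<n}. (r \<otimes> r') \<otimes> \<psi> s (\<psi> t x' \<otimes> (x \<otimes> a t)))"
    proof (rule finsum_cong')
      show "(\<lambda>t. (r \<otimes> r') \<otimes> \<psi> s (\<psi> t x' \<otimes> (x \<otimes> a t))) \<in> {..<n} \<rightarrow> carrier R"
        using c s a_closed by (auto intro!: \<psi>_closed)
      fix t assume "t \<in> {..<n}"
      then have t: "t < n" by simp
      have xa: "x \<otimes> a t \<in> carrier R" using c a_closed[OF t] by simp
      have "\<psi> s (x \<otimes> a t) \<in> carrier R" "\<psi> t x' \<in> carrier R"
        using \<psi>_closed s t c xa by auto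
      then show "(r \<otimes> \<psi> s (x \<otimes> a t)) \<otimes> (r' \<otimes> \<psi> t x') = (r \<otimes> r') \<otimes> \<psi> s (\<psi> t x' \<otimes> (x \<otimes> a t))"
        unfolding \<psi>_lin[OF s t c(4) xa] using c(1,3) by (simp add: m_ac)
    qed simp
    also have "\<dots> = (r \<otimes> r') \<otimes> (\<Oplus>t\<in>{..<n}. \<psi> s (\<psi> t x' \<otimes> (x \<otimes> a t)))"
      by (rule finsum_rdistr[symmetric]) (use c s a_closed in \<open>auto intro!: \<psi>_closed\<close>)
    also have "(\<Oplus>t\<in>{..<n}. \<psi> s (\<psi> t x' \<otimes> (x \<otimes> a t))) = \<psi> s (\<Oplus>t\<in>{..<n}. \<psi> t x' \<otimes> (x \<otimes> a t))"
      by (rule module_hom_finsum[OF \<psi>_hom[OF s], symmetric])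
        (use c a_closed in \<open>auto intro!: \<psi>_closed\<close>)
    also have "(\<Oplus>t\<in>{..<n}. \<psi> t x' \<otimes> (x \<otimes> a t)) = (\<Oplus>t\<in>{..<n}. x \<otimes> (\<psi> t x' \<otimes> a t))"
      by (rule finsum_cong') (use c a_closed in \<open>auto intro!: \<psi>_closed m_lcomm\<close>)
    also have "\<dots> = x \<otimes> (\<Oplus>t\<in>{..<n}. \<psi> t x' \<otimes> a t)"
      by (rule finsum_rdistr[symmetric]) (use c a_closed in \<open>auto intro!: \<psi>_closed\<close>)
    also have "\<psi> s \<dots> = \<psi> s (x \<otimes> x')"
    proof (rule \<psi>_cong[OF s, symmetric])
      have "x \<otimes> x' \<ominus> x \<otimes> (\<Oplus>t\<in>{..<n}. \<psi> t x' \<otimes> a t) = x \<otimes> (x' \<ominus> (\<Oplus>t\<in>{..<n}. \<psi> t x' \<otimes> a t))"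
        by (rule mult_minus_distr[OF c(2,4) dual_sum_closed[OF c(4)], symmetric])
      then show "x \<otimes> x' \<ominus> x \<otimes> (\<Oplus>t\<in>{..<n}. \<psi> t x' \<otimes> a t) \<in> J"
        using J.I_l_closed[OF dual[OF c(4)] c(2)] by simp
    qed (use c dual_sum_closed[OF c(4)] in simp_all)
    finally show ?thesis .
  qed
  have mm: "(u \<ominus> v) \<otimes> w = u \<otimes> w \<ominus> v \<otimes> w" if "u \<in> carrier R" "v \<in> carrier R" "w \<in> carrier R" for u v w
    using that by algebra
  show ?thesis
    using f
  proof (induction f rule: tp.pairs_induct)
    case zero
    have "(\<Oplus>t\<in>{..<n}. E s (0 \<otimes>\<^bsub>P\<^esub> frag_of (\<one>, a t)) \<otimes> E t g) = (\<Oplus>t\<in>{..<n}. \<zero>)"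
      by (rule finsum_cong') (use E_closed[OF _ g] in \<open>auto simp: tensor_eval_zero\<close>)
    then show ?case by (simp add: tensor_eval_zero finsum_zero)
  next
    case rx: (of r x)
    have rxP: "frag_of (r, x) \<in> carrier P" using rx by simp
    show ?case
      using g
    proof (induction g rule: tp.pairs_induct)
      case zero
      have "(\<Oplus>t\<in>{..<n}. E s (frag_of (r, x) \<otimes>\<^bsub>P\<^esub> frag_of (\<one>, a t)) \<otimes> E t 0) = (\<Oplus>t\<in>{..<n}. \<zero>)"
        by (rule finsum_cong') (use E_closed[OF s fa[OF rxP]] in \<open>auto simp: tensor_eval_zero\<close>)
      then show ?case by (simp add: tensor_eval_zero finsum_zero)
    next
      case (of r' x')
      have "(\<Oplus>t\<in>{..<n}. E s (frag_of (r, x) \<otimes>\<^bsub>P\<^esub> frag_of (\<one>, a t)) \<otimes> E t (frag_of (r', x'))) =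
          (\<Oplus>t\<in>{..<n}. (r \<otimes> \<psi> s (x \<otimes> a t)) \<otimes> (r' \<otimes> \<psi> t x'))"
        by (rule finsum_cong') (use rx of s a_closed in \<open>auto simp: E_of intro!: \<psi>_closed\<close>)
      also have "\<dots> = (r \<otimes> r') \<otimes> \<psi> s (x \<otimes> x')" by (rule base[OF rx of])
      finally show ?case using rx of s by (simp add: E_of)
    next
      case (diff g g')
      have fE: "E s (frag_of (r, x) \<otimes>\<^bsub>P\<^esub> frag_of (\<one>, a t)) \<in> carrier R" if "t < n" for t
        by (rule E_closed[OF s fa[OF rxP that]])
      have "(\<Oplus>t\<in>{..<n}. E s (frag_of (r, x) \<otimes>\<^bsub>P\<^esub> frag_of (\<one>, a t)) \<otimes> E t (g - g')) =
          (\<Oplus>t\<in>{..<n}. E s (frag_of (r, x) \<otimes>\<^bsub>P\<^esub> frag_of (\<one>, a t)) \<otimes> E t g \<ominus>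
            E s (frag_of (r, x) \<otimes>\<^bsub>P\<^esub> frag_of (\<one>, a t)) \<otimes> E t g')"
      proof (rule finsum_cong')
        fix t assume "t \<in> {..<n}"
        then have t: "t < n" by simp
        show "E s (frag_of (r, x) \<otimes>\<^bsub>P\<^esub> frag_of (\<one>, a t)) \<otimes> E t (g - g') =
            E s (frag_of (r, x) \<otimes>\<^bsub>P\<^esub> frag_of (\<one>, a t)) \<otimes> E t g \<ominus>
            E s (frag_of (r, x) \<otimes>\<^bsub>P\<^esub> frag_of (\<one>, a t)) \<otimes> E t g'"
          unfolding E_diff[OF t diff.hyps]
          by (rule mult_minus_distr[OF fE[OF t] E_closed[OF t diff.hyps(1)] E_closed[OF t diff.hyps(2)]])
      qed (use fE E_closed diff.hyps in \<open>auto simp del: tp.pairs_simps\<close>)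
      also have "\<dots> = E s (frag_of (r, x) \<otimes>\<^bsub>P\<^esub> g) \<ominus> E s (frag_of (r, x) \<otimes>\<^bsub>P\<^esub> g')"
        unfolding diff.IH[symmetric]
        by (rule finsum_minus) (use fE E_closed diff.hyps in \<open>auto simp del: tp.pairs_simps\<close>)
      finally show ?case
        unfolding tp.pairs_times_diff_right
          E_diff[OF s tp.pairs_times_closed[OF rxP diff.hyps(1)] tp.pairs_times_closed[OF rxP diff.hyps(2)]] .
    qed
  next
    case (diff f f')
    have fE: "E s (f \<otimes>\<^bsub>P\<^esub> frag_of (\<one>, a t)) \<in> carrier R" "E s (f' \<otimes>\<^bsub>P\<^esub> frag_of (\<one>, a t)) \<in> carrier R"
      "E t g \<in> carrier R" if "t < n" for t
      by (rule E_closed[OF s fa[OF diff.hyps(1) that]], rule E_closed[OF s fa[OF diff.hyps(2) that]],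
          rule E_closed[OF that g])
    have "(\<Oplus>t\<in>{..<n}. E s ((f - f') \<otimes>\<^bsub>P\<^esub> frag_of (\<one>, a t)) \<otimes> E t g) =
        (\<Oplus>t\<in>{..<n}. E s (f \<otimes>\<^bsub>P\<^esub> frag_of (\<one>, a t)) \<otimes> E t g \<ominus>
          E s (f' \<otimes>\<^bsub>P\<^esub> frag_of (\<one>, a t)) \<otimes> E t g)"
    proof (rule finsum_cong')
      fix t assume "t \<in> {..<n}"
      then have t: "t < n" by simp
      show "E s ((f - f') \<otimes>\<^bsub>P\<^esub> frag_of (\<one>, a t)) \<otimes> E t g =
          E s (f \<otimes>\<^bsub>P\<^esub> frag_of (\<one>, a t)) \<otimes> E t g \<ominus> E s (f' \<otimes>\<^bsub>P\<^esub> frag_of (\<one>, a t)) \<otimes> E t g"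
        unfolding tp.pairs_times_diff_left E_diff[OF s fa[OF diff.hyps(1) t] fa[OF diff.hyps(2) t]]
        by (rule mm[OF fE[OF t]])
    qed (use fE in \<open>auto simp del: tp.pairs_simps\<close>)
    also have "\<dots> = E s (f \<otimes>\<^bsub>P\<^esub> g) \<ominus> E s (f' \<otimes>\<^bsub>P\<^esub> g)"
      unfolding diff.IH[symmetric]
      by (rule finsum_minus) (use fE in \<open>auto simp del: tp.pairs_simps\<close>)
    finally show ?case
      unfolding tp.pairs_times_diff_left
        E_diff[OF s tp.pairs_times_closed[OF diff.hyps(1) g] tp.pairs_times_closed[OF diff.hyps(2) g]] .
  qed
qed

text \<open>In coordinates, the multiplication map R \<otimes> R/J -> R/J is the row vector of the
  a_s. This row plays the part of \<phi> in the determinant argument.\<close>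

lemma pairs_mult_expansion:
  assumes f: "f \<in> carrier P"
  shows "pairs_mult R f \<ominus> (\<Oplus>s\<in>{..<n}. a s \<otimes> E s f) \<in> J"
  using f
proof (induction f rule: tp.pairs_induct)
  case zero
  have "(\<Oplus>s\<in>{..<n}. a s \<otimes> E s 0) = (\<Oplus>s\<in>{..<n}. \<zero>)"
    by (rule finsum_cong') (use a_closed in \<open>auto simp: tensor_eval_zero\<close>)
  then show ?case
    using zero_mem[OF J.ideal_axioms]
    by (simp add: pairs_mult_eq_tensor_eval tensor_eval_zero finsum_zero a_minus_def)
next
  case (of r x)
  have "(\<Oplus>s\<in>{..<n}. a s \<otimes> E s (frag_of (r, x))) = (\<Oplus>s\<in>{..<n}. r \<otimes> (\<psi> s x \<otimes> a s))"
    by (rule finsum_cong') (use of a_closed \<psi>_closed in \<open>auto simp: E_of m_ac\<close>)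
  also have "\<dots> = r \<otimes> (\<Oplus>s\<in>{..<n}. \<psi> s x \<otimes> a s)"
    by (rule finsum_rdistr[symmetric]) (use of a_closed \<psi>_closed in auto)
  finally show ?case
    using J.I_l_closed[OF dual[OF of(2)] of(1)] mult_minus_distr[OF of dual_sum_closed[OF of(2)]] of
    by (simp add: pairs_mult_of)
next
  case (diff f f')
  have fE: "a t \<otimes> E t f \<in> carrier R" "a t \<otimes> E t f' \<in> carrier R" if "t < n" for t
    using E_closed[OF that diff.hyps(1)] E_closed[OF that diff.hyps(2)] a_closed[OF that] by simp_all
  have "(\<Oplus>s\<in>{..<n}. a s \<otimes> E s (f - f')) = (\<Oplus>s\<in>{..<n}. a s \<otimes> E s f \<ominus> a s \<otimes> E s f')"
  proof (rule finsum_cong')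
    fix t assume "t \<in> {..<n}"
    then have t: "t < n" by simp
    show "a t \<otimes> E t (f - f') = a t \<otimes> E t f \<ominus> a t \<otimes> E t f'"
      unfolding E_diff[OF t diff.hyps]
      by (rule mult_minus_distr[OF a_closed[OF t] E_closed[OF t diff.hyps(1)] E_closed[OF t diff.hyps(2)]])
  qed (use fE in auto)
  also have "\<dots> = (\<Oplus>s\<in>{..<n}. a s \<otimes> E s f) \<ominus> (\<Oplus>s\<in>{..<n}. a s \<otimes> E s f')"
    by (rule finsum_minus) (use fE in auto)
  finally have e: "(\<Oplus>s\<in>{..<n}. a s \<otimes> E s (f - f')) = \<dots>" .
  have "(u \<ominus> v) \<ominus> (u' \<ominus> v') = (u \<ominus> u') \<ominus> (v \<ominus> v')"
    if "u \<in> carrier R" "v \<in> carrier R" "u' \<in> carrier R" "v' \<in> carrier R" for u v u' v'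
    using that by algebra
  then have "pairs_mult R (f - f') \<ominus> (\<Oplus>s\<in>{..<n}. a s \<otimes> E s (f - f')) =
      (pairs_mult R f \<ominus> (\<Oplus>s\<in>{..<n}. a s \<otimes> E s f)) \<ominus> (pairs_mult R f' \<ominus> (\<Oplus>s\<in>{..<n}. a s \<otimes> E s f'))"
    unfolding e pairs_mult_diff[OF diff.hyps]
    using pairs_mult_closed[OF diff.hyps(1)] pairs_mult_closed[OF diff.hyps(2)] fE
      finsum_closed[of "\<lambda>s. a s \<otimes> E s f" "{..<n}"] finsum_closed[of "\<lambda>s. a s \<otimes> E s f'" "{..<n}"]
    by (simp add: Pi_iff)
  then show ?case using J.diff_mem[OF diff.IH] by simp
qed

end


section \<open>The determinant argument applied to the diagonal\<close>

context cyclic_dual_basis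
begin

text \<open>The data of the cokernel lemma are: \<open>L\<close> the matrix of multiplication by
  \<open>D\<close>, the projection with entries \<open>\<psi> s (a t)\<close>, the row \<phi> of the
  a_t, and e the coordinates \<open>\<psi> s \<one>\<close> of 1 \<otimes> 1. The resulting f is the
  value of a determinant.\<close>

lemma principal_modulo:
  assumes I: "ideal I R" "I \<subseteq> J"
    and D: "D \<in> carrier P" "pairs_mult R D \<in> I"
    and gen: "\<And>x. x \<in> carrier R \<Longrightarrow> \<exists>U\<in>carrier P. diag_elem x - U \<otimes>\<^bsub>P\<^esub> D \<in> diag_ideal I"
  shows "\<exists>f\<in>J. \<forall>j\<in>J. \<exists>g\<in>carrier R. j \<ominus> f \<otimes> g \<in> I"
proof -
  interpret I: ideal I R by (rule I(1))
  \<comment> \<open>A section of the evaluation map, not a homomorphism: ring elements are lifted to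
    indeterminates, and the required relations are verified only after evaluation.\<close>
  define v :: "'b \<Rightarrow> ('b multiset \<Rightarrow>\<^sub>0 int)" where "v = poly_var"
  have v: "poly_eval R (v x) = x" if "x \<in> carrier R" for x using that by (simp add: v_def)
  have fa: "f \<otimes>\<^bsub>P\<^esub> frag_of (\<one>, a t) \<in> carrier P" if "f \<in> carrier P" "t < n" for f t
    by (rule tp.pairs_times_closed[OF that(1)]) (use a_closed[OF that(2)] in simp)
  have one: "frag_of (\<one>, \<one>) \<in> carrier P" by simp
  have one_a: "frag_of (\<one>, a t) \<in> carrier P" if "t < n" for t using a_closed[OF that] by simp
  have EL: "E s (D \<otimes>\<^bsub>P\<^esub> frag_of (\<one>, a t)) \<in> carrier R" if "s < n" "t < n" for s t
    by (rule E_closed[OF that(1) fa[OF D(1) that(2)]])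
  define L where "L s t = v (E s (D \<otimes>\<^bsub>P\<^esub> frag_of (\<one>, a t)))" for s t
  define M where "M s t = v (\<psi> s (a t))" for s t
  have \<psi>a: "\<psi> s (a t) \<in> carrier R" if "s < n" "t < n" for s t
    by (rule \<psi>_closed[OF that(1) a_closed[OF that(2)]])
  have evL: "poly_eval R (\<Sum>k<n. L s k * v (E k g)) = E s (D \<otimes>\<^bsub>P\<^esub> g)"
    if s: "s < n" and g: "g \<in> carrier P" for s g
  proof -
    have "poly_eval R (\<Sum>k<n. L s k * v (E k g)) =
        (\<Oplus>k\<in>{..<n}. E s (D \<otimes>\<^bsub>P\<^esub> frag_of (\<one>, a k)) \<otimes> E k g)"
      unfolding poly_eval_sum
      by (rule finsum_cong') (use EL[OF s] E_closed[OF _ g] in \<open>auto simp: L_def v simp del: tp.pairs_simps\<close>)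
    then show ?thesis using matrix_mult[OF s D(1) g] by simp
  qed
  have evM: "poly_eval R (\<Sum>k<n. M s k * v (E k g)) = E s g"
    if s: "s < n" and g: "g \<in> carrier P" for s g
  proof -
    have e: "E s (frag_of (\<one>, \<one>) \<otimes>\<^bsub>P\<^esub> frag_of (\<one>, a k)) = \<psi> s (a k)" if k: "k < n" for k
      using a_closed[OF k] \<psi>a[OF s k] by (simp add: E_of[OF s])
    have "poly_eval R (\<Sum>k<n. M s k * v (E k g)) =
        (\<Oplus>k\<in>{..<n}. E s (frag_of (\<one>, \<one>) \<otimes>\<^bsub>P\<^esub> frag_of (\<one>, a k)) \<otimes> E k g)"
      unfolding poly_eval_sum
      by (rule finsum_cong') (use \<psi>a[OF s] E_closed[OF _ g] e in \<open>auto simp: M_def v simp del: tp.pairs_simps\<close>)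
    then show ?thesis using matrix_mult[OF s one g] tp.pairs_times_one[OF g] by simp
  qed
  have E_one_a: "E k (frag_of (\<one>, a t)) = \<psi> k (a t)" if "k < n" "t < n" for k t
    using E_of[OF that(1) one_closed a_closed[OF that(2)]] \<psi>a[OF that] by simp
  have M_eq: "M k t = v (E k (frag_of (\<one>, a t)))" if "k < n" "t < n" for k t
    using E_one_a[OF that] by (simp add: M_def)
  have minus_self: "x \<ominus> x = \<zero>" if "x \<in> carrier R" for x using that by (simp add: a_minus_def r_neg)
  have I0: "\<zero> \<in> I" by (rule zero_mem[OF I(1)])
  have solve: "E s (D \<otimes>\<^bsub>P\<^esub> U) \<ominus> E s V \<in> I"
    if s: "s < n" and UV: "U \<in> carrier P" "V \<in> carrier P" and mem: "V - U \<otimes>\<^bsub>P\<^esub> D \<in> diag_ideal I" for s U V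
  proof -
    \<comment> \<open>The functional vanishes on \<open>J\<close>, hence on \<open>I\<close>, so it
      is one of those by which \<open>diag_ideal I\<close> is tested.\<close>
    have "\<psi> s ` I \<subseteq> I" using \<psi>_kill[OF s] I(2) I0 by auto
    then have "E s (V - U \<otimes>\<^bsub>P\<^esub> D) \<in> I" by (rule diag_idealD(1)[OF mem \<psi>_hom[OF s]])
    then have m: "E s V \<ominus> E s (D \<otimes>\<^bsub>P\<^esub> U) \<in> I"
      unfolding E_diff[OF s UV(2) tp.pairs_times_closed[OF UV(1) D(1)]]
      unfolding tp.pairs_times_comm[OF UV(1) D(1)] .
    have "\<ominus> (x \<ominus> y) = y \<ominus> x" if "x \<in> carrier R" "y \<in> carrier R" for x y using that by algebra
    then have "\<ominus> (E s V \<ominus> E s (D \<otimes>\<^bsub>P\<^esub> U)) = E s (D \<otimes>\<^bsub>P\<^esub> U) \<ominus> E s V"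
      using E_closed[OF s UV(2)] E_closed[OF s tp.pairs_times_closed[OF D(1) UV(1)]] by blast
    then show ?thesis
      using additive_subgroup.a_inv_closed[OF I.additive_subgroup_axioms m] by simp
  qed
  have E_diag: "E s (diag_elem x) = \<psi> s x \<ominus> x \<otimes> \<psi> s \<one>" if "s < n" "x \<in> carrier R" for s x
    unfolding diag_elem_def
    using that \<psi>_closed[OF that] by (subst E_diff) (simp_all add: E_of)
  have "\<exists>f\<in>{f. poly_eval R f \<in> J}. \<forall>j\<in>{f. poly_eval R f \<in> J}. \<exists>g. j - f * g \<in> {f. poly_eval R f \<in> I}"
  proof (rule cyclic_cokernel_ideal_principal[where L = L and P = M and \<phi> = "\<lambda>t. v (a t)"
        and e = "\<lambda>s. v (\<psi> s \<one>)" and n = n])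
    show "comm_ring_ideal {f. poly_eval R f \<in> I}" by (rule comm_ring_ideal_poly_eval[OF I(1)])
    show "comm_ring_ideal {f. poly_eval R f \<in> J}" by (rule comm_ring_ideal_poly_eval[OF J.ideal_axioms])
  next
    fix s t assume st: "s < n" "t < n"
    have "poly_eval R (\<Sum>k<n. L s k * M k t) = E s (D \<otimes>\<^bsub>P\<^esub> frag_of (\<one>, a t))"
      using evL[OF st(1) one_a[OF st(2)]] M_eq[OF _ st(2)] by simp
    then show "(\<Sum>k<n. L s k * M k t) - L s t \<in> {f. poly_eval R f \<in> I}"
      using EL[OF st] I0 by (simp add: L_def v minus_self)
    have "poly_eval R (\<Sum>k<n. M s k * M k t) = \<psi> s (a t)"
      using evM[OF st(1) one_a[OF st(2)]] M_eq[OF _ st(2)] E_one_a[OF st] by simp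
    then show "(\<Sum>k<n. M s k * M k t) - M s t \<in> {f. poly_eval R f \<in> I}"
      using \<psi>a[OF st] I0 by (simp add: M_def v minus_self)
  next
    fix t assume t: "t < n"
    \<comment> \<open>Surjectivity: 1 \<otimes> a_t - a_t \<otimes> 1 is a multiple of
      \<open>D\<close>, and its coordinates are those of column t of the projection minus e
      \<phi>_t. The coordinates of the factor \<open>U\<close> are the solution w.\<close>
    obtain U where U: "U \<in> carrier P" "diag_elem (a t) - U \<otimes>\<^bsub>P\<^esub> D \<in> diag_ideal I"
      using gen[OF a_closed[OF t]] by blast
    have dc: "diag_elem (a t) \<in> carrier P" by (rule diag_elem_closed[OF a_closed[OF t]])
    show "\<exists>w. (\<forall>s<n. (\<Sum>k<n. M s k * w k) - w s \<in> {f. poly_eval R f \<in> I}) \<and>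
        (\<forall>s<n. (\<Sum>k<n. L s k * w k) - (M s t - v (\<psi> s \<one>) * v (a t)) \<in> {f. poly_eval R f \<in> I})"
    proof (intro exI[of _ "\<lambda>k. v (E k U)"] conjI allI impI)
      fix s assume s: "s < n"
      show "(\<Sum>k<n. M s k * v (E k U)) - v (E s U) \<in> {f. poly_eval R f \<in> I}"
        using evM[OF s U(1)] E_closed[OF s U(1)] I0 by (simp add: v minus_self)
      have "poly_eval R (M s t - v (\<psi> s \<one>) * v (a t)) = E s (diag_elem (a t))"
        using \<psi>a[OF s t] \<psi>_closed[OF s one_closed] a_closed[OF t]
        by (simp add: M_def v E_diag[OF s a_closed[OF t]] m_comm)
      then show "(\<Sum>k<n. L s k * v (E k U)) - (M s t - v (\<psi> s \<one>) * v (a t)) \<in> {f. poly_eval R f \<in> I}"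
        using solve[OF s U(1) dc U(2)] evL[OF s U(1)] by (simp del: tp.pairs_simps)
    qed
  next
    fix j assume "j \<in> {f. poly_eval R f \<in> J}"
    then have xJ: "poly_eval R j \<in> J" by simp
    define x where "x = poly_eval R j"
    have x: "x \<in> J" "x \<in> carrier R" using xJ J.Icarr by (simp_all add: x_def)
    have dx: "diag_elem x \<in> carrier P" by (rule diag_elem_closed[OF x(2)])
    obtain U where U: "U \<in> carrier P" "diag_elem x - U \<otimes>\<^bsub>P\<^esub> D \<in> diag_ideal I"
      using gen[OF x(2)] by blast
    have zP: "0 \<in> carrier P" by simp
    have nP: "0 - f \<in> carrier P" if "f \<in> carrier P" for f by (rule tp.pairs_diff_closed[OF zP that])
    \<comment> \<open>For x in \<open>J\<close> the term 1 \<otimes> x vanishes in R \<otimes> R/J,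
      so the negative of \<open>diag_elem x\<close> has the coordinates x e of x \<otimes> 1. The
      factor \<open>U\<close> changes sign with it.\<close>
    have "(0 - diag_elem x) - (0 - U) \<otimes>\<^bsub>P\<^esub> D = 0 - (diag_elem x - U \<otimes>\<^bsub>P\<^esub> D)"
      unfolding tp.pairs_times_diff_left by simp
    moreover have "0 - (diag_elem x - U \<otimes>\<^bsub>P\<^esub> D) \<in> diag_ideal I"
      by (rule tp.ideal_diff[OF diag_ideal_ideal[OF I(1)] _ U(2)])
        (simp add: diag_ideal_def tensor_eval_zero I0)
    ultimately have mem: "(0 - diag_elem x) - (0 - U) \<otimes>\<^bsub>P\<^esub> D \<in> diag_ideal I" by (simp only:)
    show "\<exists>w. (\<forall>s<n. (\<Sum>k<n. M s k * w k) - w s \<in> {f. poly_eval R f \<in> I}) \<and>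
        (\<forall>s<n. (\<Sum>k<n. L s k * w k) - j * v (\<psi> s \<one>) \<in> {f. poly_eval R f \<in> I})"
    proof (intro exI[of _ "\<lambda>k. v (E k (0 - U))"] conjI allI impI)
      fix s assume s: "s < n"
      show "(\<Sum>k<n. M s k * v (E k (0 - U))) - v (E s (0 - U)) \<in> {f. poly_eval R f \<in> I}"
        using evM[OF s nP[OF U(1)]] E_closed[OF s nP[OF U(1)]] I0
        by (simp add: v minus_self del: diff_0)
      have "E s (0 - diag_elem x) = \<zero> \<ominus> (\<zero> \<ominus> x \<otimes> \<psi> s \<one>)"
        unfolding E_diff[OF s zP dx] E_diag[OF s x(2)] \<psi>_kill[OF s x(1)] tensor_eval_zero ..
      also have "\<dots> = x \<otimes> \<psi> s \<one>" using x(2) \<psi>_closed[OF s one_closed] by (simp add: a_minus_def)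
      finally have "poly_eval R (j * v (\<psi> s \<one>)) = E s (0 - diag_elem x)"
        using \<psi>_closed[OF s one_closed] by (simp add: v x_def)
      then show "(\<Sum>k<n. L s k * v (E k (0 - U))) - j * v (\<psi> s \<one>) \<in> {f. poly_eval R f \<in> I}"
        using solve[OF s nP[OF U(1)] nP[OF dx] mem] evL[OF s nP[OF U(1)]]
        by (simp del: tp.pairs_simps diff_0)
    qed
  next
    fix t assume t: "t < n"
    have neg: "y \<ominus> x \<in> J" if "x \<ominus> y \<in> J" "x \<in> carrier R" "y \<in> carrier R" for x y
    proof -
      have "\<ominus> (x \<ominus> y) = y \<ominus> x" using that(2,3) by algebra
      then show ?thesis
        using additive_subgroup.a_inv_closed[OF J.additive_subgroup_axioms that(1)] by simp
    qed
    have "poly_eval R (\<Sum>s<n. v (a s) * M s t) = (\<Oplus>s\<in>{..<n}. \<psi> s (a t) \<otimes> a s)"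
      unfolding poly_eval_sum
      by (rule finsum_cong') (use \<psi>a[OF _ t] a_closed in \<open>auto simp: M_def v m_comm\<close>)
    then show "(\<Sum>s<n. v (a s) * M s t) - v (a t) \<in> {f. poly_eval R f \<in> J}"
      using neg[OF dual[OF a_closed[OF t]] a_closed[OF t] dual_sum_closed[OF a_closed[OF t]]] a_closed[OF t]
      by (simp add: v)
    \<comment> \<open>Entry t of the row \<phi> L. Modulo \<open>J\<close> it equals the product of
      D (1 \<otimes> a_t), which is the product of \<open>D\<close>, an element of \<open>I\<close>,
      times a_t.\<close>
    define z where "z = (\<Oplus>s\<in>{..<n}. a s \<otimes> E s (D \<otimes>\<^bsub>P\<^esub> frag_of (\<one>, a t)))"
    define d where "d = pairs_mult R (D \<otimes>\<^bsub>P\<^esub> frag_of (\<one>, a t))"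
    have z: "z \<in> carrier R" unfolding z_def
      by (rule finsum_closed) (use EL[OF _ t] a_closed in \<open>auto simp del: tp.pairs_simps\<close>)
    have "d = pairs_mult R D \<otimes> a t"
      using pairs_mult_mult_of[OF one_closed a_closed[OF t] D(1)] a_closed[OF t] by (simp add: d_def)
    then have dJ: "d \<in> J"
      using J.I_r_closed[OF subsetD[OF I(2) D(2)] a_closed[OF t]] by simp
    have "d \<ominus> z \<in> J" unfolding d_def z_def by (rule pairs_mult_expansion[OF fa[OF D(1) t]])
    from J.diff_mem[OF dJ this] have "d \<ominus> (d \<ominus> z) \<in> J" .
    moreover have "d \<ominus> (d \<ominus> z) = z" using J.Icarr[OF dJ] z by algebra
    ultimately have "z \<in> J" by simp
    moreover have "poly_eval R (\<Sum>s<n. v (a s) * L s t) = z"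
      unfolding poly_eval_sum z_def
      by (rule finsum_cong') (use EL[OF _ t] a_closed in \<open>auto simp: L_def v simp del: tp.pairs_simps\<close>)
    ultimately show "(\<Sum>s<n. v (a s) * L s t) \<in> {f. poly_eval R f \<in> J}" by simp
  next
    have "poly_eval R (\<Sum>s<n. v (a s) * v (\<psi> s \<one>)) = (\<Oplus>s\<in>{..<n}. \<psi> s \<one> \<otimes> a s)"
      unfolding poly_eval_sum
      by (rule finsum_cong') (use \<psi>_closed[OF _ one_closed] a_closed in \<open>auto simp: v m_comm\<close>)
    then show "1 - (\<Sum>s<n. v (a s) * v (\<psi> s \<one>)) \<in> {f. poly_eval R f \<in> J}"
      using dual[OF one_closed] by simp
  qed
  then obtain f where f: "poly_eval R f \<in> J"
      "\<And>j. poly_eval R j \<in> J \<Longrightarrow> \<exists>g. poly_eval R (j - f * g) \<in> I"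
    by auto
  have "\<exists>g\<in>carrier R. j \<ominus> poly_eval R f \<otimes> g \<in> I" if j: "j \<in> J" for j
  proof -
    have "poly_eval R (v j) = j" by (rule v[OF J.Icarr[OF j]])
    then obtain g where "poly_eval R (v j - f * g) \<in> I" using f(2)[of "v j"] j by auto
    then show ?thesis using \<open>poly_eval R (v j) = j\<close> by (intro bexI[of _ "poly_eval R g"]) simp_all
  qed
  then show ?thesis using f(1) by blast
qed

end

section \<open>From a congruence to a regular generator\<close>

lemma (in formal_tensor_square) weak_divisor_generated_by_regular:
  assumes y: "regular_element R y" and op: "\<And>m::nat. openin T (PIdl (y [^] m))"
    and nil: "\<And>I. I \<in> OI \<Longrightarrow> \<exists>m::nat. y [^] m \<in> I"
    and gen: "generated_by_regular CT (diagonal_ideal K R T)"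
    and J: "J \<in> OI" and fg: "fg_module K (quot_algebra R J)" and proj: "projective_module K (quot_algebra R J)"
  shows "generated_by_regular R J"
proof -
  interpret J: ideal J R by (rule OI_ideal[OF J])
  have yR: "y \<in> carrier R" and yreg: "\<And>x. x \<in> carrier R \<Longrightarrow> y \<otimes> x = \<zero> \<Longrightarrow> x = \<zero>"
    using y by (auto simp: regular_element_def)
  obtain m where m: "y [^] (m::nat) \<in> J" using nil[OF J] by (rule exE)
  define Y where "Y = y [^] m"
  have Y: "Y \<in> carrier R" "Y \<in> J" using yR m by (simp_all add: Y_def)
  \<comment> \<open>With the exponent m in place of \<open>Suc m\<close>, the element
    \<open>Y\<close> would be zero modulo \<open>I\<close> and the congruence would say nothing
    about it. The larger exponent also keeps \<open>I\<close> inside \<open>J\<close>.\<close>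
  define I where "I = PIdl (y [^] Suc m)"
  have idI: "ideal I R" unfolding I_def by (rule cgenideal_ideal) (use yR in simp)
  have IO: "I \<in> OI" using idI op[of "Suc m"] by (simp add: open_ideals_def I_def)
  have I_iff: "x \<in> I \<longleftrightarrow> (\<exists>z\<in>carrier R. x = z \<otimes> (Y \<otimes> y))" for x
    by (auto simp: I_def cgenideal_def Y_def)
  have IJ: "I \<subseteq> J"
  proof
    fix x assume "x \<in> I"
    then obtain z where z: "z \<in> carrier R" "x = z \<otimes> (Y \<otimes> y)" unfolding I_iff by blast
    show "x \<in> J" unfolding z(2) by (rule J.I_l_closed[OF J.I_r_closed[OF Y(2) yR] z(1)])
  qed
  obtain n :: nat and a \<psi> where dual: "\<forall>s<n. a s \<in> carrier R \<and> \<psi> s \<in> module_hom K R R \<and> (\<forall>j\<in>J. \<psi> s j = \<zero>)"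
      "\<forall>s<n. \<forall>t<n. \<forall>x\<in>carrier R. \<forall>y\<in>carrier R. \<psi> s (\<psi> t x \<otimes> y) = \<psi> t x \<otimes> \<psi> s y"
      "\<forall>x\<in>carrier R. x \<ominus> (\<Oplus>s\<in>{..<n}. \<psi> s x \<otimes> a s) \<in> J"
    using dual_basis[OF J.ideal_axioms fg proj] by (elim exE conjE) (rule that)
  interpret cyclic_dual_basis K R J n a \<psi>
    by unfold_locales (use dual in auto)
  obtain D where D: "D \<in> carrier P" "pairs_mult R D \<in> I"
      "\<And>x. x \<in> carrier R \<Longrightarrow> \<exists>U\<in>carrier P. diag_elem x - U \<otimes>\<^bsub>P\<^esub> D \<in> diag_ideal I"
    using diagonal_generator[OF gen IO] by blast
  obtain f where f: "f \<in> J" "\<And>j. j \<in> J \<Longrightarrow> \<exists>g\<in>carrier R. j \<ominus> f \<otimes> g \<in> I"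
    using principal_modulo[OF idI IJ D] by blast
  have fR: "f \<in> carrier R" by (rule J.Icarr[OF f(1)])
  have rep: "\<exists>g\<in>carrier R. \<exists>z\<in>carrier R. j = f \<otimes> g \<oplus> Y \<otimes> (y \<otimes> z)" if j: "j \<in> J" for j
  proof -
    obtain g where g: "g \<in> carrier R" "j \<ominus> f \<otimes> g \<in> I" using f(2)[OF j] by blast
    then obtain z where z: "z \<in> carrier R" "j \<ominus> f \<otimes> g = z \<otimes> (Y \<otimes> y)" unfolding I_iff by blast
    have "j = f \<otimes> g \<oplus> (j \<ominus> f \<otimes> g)" using J.Icarr[OF j] fR g(1) by algebra
    also have "\<dots> = f \<otimes> g \<oplus> Y \<otimes> (y \<otimes> z)" unfolding z(2) using fR g(1) z(1) Y(1) yR by algebra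
    finally show ?thesis using g(1) z(1) by blast
  qed
  obtain g z where gz: "g \<in> carrier R" "z \<in> carrier R" "Y = f \<otimes> g \<oplus> Y \<otimes> (y \<otimes> z)"
    using rep[OF Y(2)] by blast
  have yz: "y \<otimes> z \<in> carrier R" using yR gz by simp
  \<comment> \<open>Powers of y enter every open ideal, and a multiple of y inherits this; it is
    what the geometric series needs.\<close>
  have "\<exists>k::nat. (y \<otimes> z) [^] k \<in> I'" if I': "I' \<in> OI" for I'
  proof -
    obtain k where k: "y [^] (k::nat) \<in> I'" using nil[OF I'] by (rule exE)
    have "(y \<otimes> z) [^] k = y [^] k \<otimes> z [^] k" by (rule nat_pow_distrib[OF yR gz(2)])
    then have "(y \<otimes> z) [^] k \<in> I'"
      using ideal.I_r_closed[OF OI_ideal[OF I'] k nat_pow_closed[OF gz(2)]] by simp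
    then show ?thesis by (rule exI)
  qed
  from one_minus_unit[OF yz this] obtain u where u: "u \<in> carrier R" "(\<one> \<ominus> y \<otimes> z) \<otimes> u = \<one>" by blast
  have YfG: "Y = f \<otimes> (g \<otimes> u)"
  proof -
    have "Y \<otimes> (\<one> \<ominus> y \<otimes> z) = Y \<ominus> Y \<otimes> (y \<otimes> z)" using Y(1) yz by algebra
    also have "\<dots> = (f \<otimes> g \<oplus> Y \<otimes> (y \<otimes> z)) \<ominus> Y \<otimes> (y \<otimes> z)" using gz(3) by simp
    also have "\<dots> = f \<otimes> g"
      using fR gz(1) Y(1) yz by (simp add: a_minus_def a_assoc r_neg)
    finally have "(Y \<otimes> (\<one> \<ominus> y \<otimes> z)) \<otimes> u = f \<otimes> g \<otimes> u" by simp
    moreover have "(Y \<otimes> (\<one> \<ominus> y \<otimes> z)) \<otimes> u = Y \<otimes> ((\<one> \<ominus> y \<otimes> z) \<otimes> u)"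
      using Y(1) yz u(1) by (simp add: m_assoc)
    ultimately show ?thesis using u Y(1) fR gz(1) by (simp add: m_assoc)
  qed
  have "J = PIdl f"
  proof
    show "PIdl f \<subseteq> J" by (rule cgenideal_minimal[OF J.ideal_axioms f(1)])
    show "J \<subseteq> PIdl f"
    proof
      fix j assume j: "j \<in> J"
      obtain g' z' where gz': "g' \<in> carrier R" "z' \<in> carrier R" "j = f \<otimes> g' \<oplus> Y \<otimes> (y \<otimes> z')"
        using rep[OF j] by blast
      \<comment> \<open>For a general j the error term is a multiple of \<open>Y\<close>, which is
        by now known to be a multiple of f.\<close>
      have "j = f \<otimes> g' \<oplus> (f \<otimes> (g \<otimes> u)) \<otimes> (y \<otimes> z')" using gz'(3) YfG by simp
      also have "\<dots> = (g' \<oplus> (g \<otimes> u) \<otimes> (y \<otimes> z')) \<otimes> f"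
        using fR gz' gz(1) u(1) yR by algebra
      finally show "j \<in> PIdl f"
        unfolding cgenideal_def using gz' gz(1) u(1) yR by blast
    qed
  qed
  moreover have "regular_element R f"
    unfolding regular_element_def
  proof (intro conjI ballI impI fR)
    fix x assume x: "x \<in> carrier R" "f \<otimes> x = \<zero>"
    have "Y \<otimes> x = (g \<otimes> u) \<otimes> (f \<otimes> x)" unfolding YfG using fR gz(1) u(1) x(1) by algebra
    then have "y [^] m \<otimes> x = \<zero>" using x(2) gz(1) u(1) by (simp add: Y_def)
    then show "x = \<zero>"
    \<comment> \<open>The power of y is stripped off one regular factor at a time.\<close>
    proof (induction m)
      case (Suc m)
      have "y \<otimes> (y [^] m \<otimes> x) = y [^] Suc m \<otimes> x"
        using yR x(1) by (simp add: m_ac)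
      then show ?case using Suc yreg[of "y [^] m \<otimes> x"] yR x(1) by simp
    qed (use x in simp)
  qed
  ultimately show ?thesis unfolding generated_by_regular_def by blast
qed

theorem proposition14p15:
  fixes K :: "('a, 'k) ring_scheme"
    and R :: "('a, 'b, 'm) module_scheme"
    and T :: "'b topology"
    and J :: "'b set"
  assumes "formal_multicurve K R T"
    and "weak_divisor K R T J"
  shows "divisor K R T J"
proof -
  have alg: "algebra K R" and formal: "formal_ring R T"
    and gen: "generated_by_regular (completed_tensor_ring K R T R T) (diagonal_ideal K R T)"
    using assms(1) by (simp_all add: formal_multicurve_def)
  obtain y where y: "regular_element R y"
      "\<And>m::nat. openin T (PIdl\<^bsub>R\<^esub> (y [^]\<^bsub>R\<^esub> m))"
      "homeomorphic_map T (limit_topology R {PIdl\<^bsub>R\<^esub> (y [^]\<^bsub>R\<^esub> m) | m::nat. True})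
         (limit_map R {PIdl\<^bsub>R\<^esub> (y [^]\<^bsub>R\<^esub> m) | m::nat. True})"
    using assms(1) unfolding formal_multicurve_def by (elim conjE exE) (rule that; simp)
  have J: "J \<in> open_ideals R T" "fg_module K (quot_algebra R J)" "projective_module K (quot_algebra R J)"
    using assms(2) by (simp_all add: weak_divisor_def)
  interpret alg: algebra K R by (rule alg)
  interpret formal_tensor_square K R T
    by (intro formal_tensor_square.intro tensor_square.intro formal_cring.intro
        formal_cring_axioms.intro alg formal alg.M_cring)
  have "y \<in> carrier R" using y(1) by (simp add: regular_element_def)
  \<comment> \<open>The comparison with the limit is a homeomorphism, so every open ideal contains a
    power of y.\<close>
  then have "\<exists>m::nat. y [^]\<^bsub>R\<^esub> m \<in> I" if "I \<in> open_ideals R T" for I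
    using power_mem_open[OF _ y(3) that] by blast
  then have "generated_by_regular R J"
    using weak_divisor_generated_by_regular[OF y(1,2) _ gen J] by blast
  then show ?thesis using J by (simp add: divisor_def)
qed

end
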